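(* Suppose that $\boldsymbol\xi\sim P$ satisfies density-level regular variation with index $s$, that $(L_1,\dots,L_K)\in\mathcal H_1$ is regular, that $\mathcal J\in\mathfrak J$ is a nonempty subset of $[K]$ under consideration, and that the estimation-rate assumption (with exponents $m,\ell\in(0,1/2]$) and the second-order assumption (with exponent $\gamma>0$) hold. Then $$\mathsf{TV}\big(\widehat\Pi_n,\Pi_n\big)=O_P\!\left(n^{-(1-q)(m\wedge\ell)}+n^{-q\gamma/s}\right),\qquad n\to\infty.$$
   Context: Setting. $\|\cdot\|$ is the Euclidean norm on $\mathbb R^d$; $\mathcal E\subset\mathbb R^d$ is a closed cone; $\Theta_{\mathcal E}=\{\boldsymbol z\in\mathcal E:\|\boldsymbol z\|=1\}$; $B_r=\{\boldsymbol z:\|\boldsymbol z\|\le r\}$; $d\boldsymbol\phi$ is surface measure on $\Theta_{\mathcal E}$, so $d\boldsymbol z=r^{d-1}\,dr\,d\boldsymbol\phi$ for $\boldsymbol z=r\boldsymbol\phi$. $\boldsymbol\xi\sim P$ has density $f_{\boldsymbol\xi}$ supported on $\mathcal E$; $R=\|\boldsymbol\xi\|$, $\boldsymbol\Phi=\boldsymbol\xi/\|\boldsymbol\xi\|$. $[K]=\{1,\dots,K\}$. $\mathsf{TV}(P,Q)=\sup_B|P(B)-Q(B)|$. Density-level regular variation: $f_{\boldsymbol\xi}$ is continuous on $B_{r_0}^c\cap\mathcal E$ for some $r_0>0$, and there are $s>0$ and $\varphi^\star:\mathcal E\setminus\{\boldsymbol 0\}\to(0,\infty)$ with $t^{s+d}f_{\boldsymbol\xi}(t\boldsymbol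 z)\to\varphi^\star(\boldsymbol z)$ as $t\to\infty$, uniformly over compact subsets of $\mathcal E\setminus\{\boldsymbol 0\}$. Second-order assumption: moreover there is $\gamma>0$ with $\sup_{r>t,\ \boldsymbol\phi\in\Theta_{\mathcal E}}|r^{s+d}f_{\boldsymbol\xi}(r\boldsymbol\phi)-\varphi^\star(\boldsymbol\phi)|=O(t^{-\gamma})$ as $t\to\infty$. Loss systems: measurable functions $L_1,\dots,L_K:\mathcal E\to\mathbb R$ form an asymptotically homogeneous multi-loss system, $(L_1,\dots,L_K)\in\mathcal H_1$, if for each $j$ there is $L_j^\star:\mathcal E\to\mathbb R$ with $\{L_j^\star>0\}\ne\varnothing$ and $t^{-1}L_j(t\boldsymbol z_t)\to L_j^\star(\boldsymbol z)$ whenever $t\to\infty$ and $\boldsymbol z_t\to\boldsymbol z$ in $\mathcal E$. $\mathcal S(u;\mathcal J)=\{\boldsymbol z\in\mathcal E:L_j(\boldsymbol z)\ge u\ \forall j\in\mathcal J\}$, $\mathcal S^\star(\mathcal J)=\{\boldsymbol z\in\mathcal E:L_j^\star(\boldsymbol z)\ge1\ \forall j\in\mathcal J\}$. $\mathfrak J$ is the collection of nonempty subsets of $[K]$ under consideration; the system is regular if $\mathcal S^\star(\mathcal J)$ has nonzero Lebesgue measure for every $\mathcal J\in\mathfrak J$. Data and thresholds: $\boldsymbol\xi_1,\dots,\boldsymbol\xi_n$ are i.i.d. from $P$, $R_i=\|\boldsymbol\xi_i\|$, $R_{(k)}$ is the $k$th largest of $R_1,\dots,R_n$. Fix $q\in(0,1)$,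 $k_n=\lfloor n^{1-q}\rfloor$, $t_n=R_{(k_n)}$. Fix $r\ge1$ and let $u_n$ be the $(1-n^{-r})$-quantile of $R$ under $P$. For $t>0$, $\Phi^{(t)}$ denotes the conditional law of $\boldsymbol\Phi$ given $\{R>t\}$, with density $\varphi^{(t)}$ w.r.t. $d\boldsymbol\phi$; $\Phi^{(t_n)}$ is this law at $t=t_n$. Estimation-rate assumption: $\widehat s_{t_n}>0$ and a probability law $\widehat\Phi^{(t_n)}$ on $\Theta_{\mathcal E}$ with density $\widehat\varphi^{(t_n)}$ w.r.t. $d\boldsymbol\phi$ are estimators built from the observations with $R_i\ge t_n$ such that, for some $m,\ell\in(0,1/2]$, $|\widehat s_{t_n}-s|=O_P(k_n^{-m})$ and $\mathsf{TV}(\Phi^{(t_n)},\widehat\Phi^{(t_n)})=O_P(k_n^{-\ell})$. Data-driven SSGEN law $\widehat P_{\rm gen}^{(t_n)}$: the (data-dependent) law which on $\{\|\boldsymbol x\|>t_n\}$ has total mass $\widehat p_{t_n}=k_n/n$ and radial–angular density (w.r.t. $dr\,d\boldsymbol\phi$) $\widehat p_{t_n}\,\widehat s_{t_n}\,t_n^{\widehat s_{t_n}}\,r^{-(\widehat s_{t_n}+1)}\,\widehat\varphi^{(t_n)}(\boldsymbol\phi)$, $r>t_n$, the remaining mass (the body) being carried by $\{\|\boldsymbol x\|\le t_n\}$ (e.g. the empirical distribution of the data there). Stressed laws: $\Pi_n=\mathsf{Law}(u_n^{-1}\boldsymbol\xi\mid\boldsymbol\xi\in\mathcal S(u_n;\mathcal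 J))$ with $\boldsymbol\xi\sim P$, and (conditionally on the data) $\widehat\Pi_n=\mathsf{Law}(u_n^{-1}\widehat{\boldsymbol\xi}_n\mid\widehat{\boldsymbol\xi}_n\in\mathcal S(u_n;\mathcal J))$ with $\widehat{\boldsymbol\xi}_n\sim\widehat P_{\rm gen}^{(t_n)}$ (defined arbitrarily when the conditioning event has probability zero). *)

theory Defs
  imports "HOL-Probability.Probability"
begin

section \<open>Total variation and stochastic boundedness\<close>

definition TV :: "'a measure \<Rightarrow> 'a measure \<Rightarrow> real" where
  "TV P Q = (SUP B\<in>sets P. \<bar>measure P B - measure Q B\<bar>)"

text \<open>
  \<open>X\<^sub>n = O\<^sub>P(a\<^sub>n)\<close>. The exceptional set is only required to be covered by an event of small
  probability, because \<open>measure M\<close> is 0 on non-measurable sets. If \<open>X n\<close> is measurable, this says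
  that the probability of \<open>\<bar>X n\<bar> > C * a n\<close> is at most \<open>\<epsilon>\<close>.
\<close>

definition bigo_in_prob ::
  "'w measure \<Rightarrow> (nat \<Rightarrow> 'w \<Rightarrow> real) \<Rightarrow> (nat \<Rightarrow> real) \<Rightarrow> bool" where
  "bigo_in_prob M X a \<longleftrightarrow>
     (\<forall>\<epsilon>>0. \<exists>C>0. \<forall>\<^sub>F n in sequentially. \<exists>A\<in>sets M.
        {\<omega>\<in>space M. \<bar>X n \<omega>\<bar> > C * a n} \<subseteq> A \<and> measure M A \<le> \<epsilon>)"

section \<open>Angular sets and surface measure\<close>

definition angles :: "'a::euclidean_space set \<Rightarrow> 'a set" where
  "angles E = {z\<in>E. norm z = 1}"

text \<open>
  Surface measure on the unit sphere of a \<open>d\<close>-dimensional space: \<open>d\<close> times the volume of the solid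
  sector of the unit ball spanned by a set of directions. This is the normalisation for which
  \<open>dz = r\<^sup>d\<^sup>-\<^sup>1 dr d\<phi>\<close>. It is carried as a Borel measure on the whole space concentrated on the
  sphere; \<open>sgn z\<close> is \<open>z / norm z\<close>.
\<close>

definition sphere_measure :: "'a::euclidean_space measure" where
  "sphere_measure =
     scale_measure (of_nat DIM('a)) (distr (restrict_space lborel (cball 0 1 - {0})) borel sgn)"

definition surface :: "'a::euclidean_space set \<Rightarrow> 'a measure" where
  "surface E = density sphere_measure (indicator (angles E))"

section \<open>Assumptions on the population law\<close>

definition density_reg_var ::
  "'a::euclidean_space set \<Rightarrow> ('a \<Rightarrow> real) \<Rightarrow> real \<Rightarrow> ('a \<Rightarrow> real) \<Rightarrow> bool" where
  "density_reg_var E f s \<phi>star \<longleftrightarrow>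
     s > 0 \<and>
     (\<exists>r0>0. continuous_on (E - cball 0 r0) f) \<and>
     (\<forall>z\<in>E - {0}. \<phi>star z > 0) \<and>
     (\<forall>C. compact C \<and> C \<subseteq> E - {0} \<longrightarrow>
        uniform_limit C (\<lambda>t z. t powr (s + real DIM('a)) * f (t *\<^sub>R z)) \<phi>star at_top)"

text \<open>
  The bound \<open>O(t\<^sup>-\<^sup>\<gamma>)\<close> on the supremum is written pointwise over the index set, so that no
  supremum of a possibly unbounded set of reals is formed.
\<close>

definition second_order ::
  "'a::euclidean_space set \<Rightarrow> ('a \<Rightarrow> real) \<Rightarrow> real \<Rightarrow> ('a \<Rightarrow> real) \<Rightarrow> real \<Rightarrow> bool" where
  "second_order E f s \<phi>star \<gamma> \<longleftrightarrow>
     (\<exists>C. \<forall>\<^sub>F t in at_top. \<forall>r>t. \<forall>\<phi>\<in>angles E.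
        \<bar>r powr (s + real DIM('a)) * f (r *\<^sub>R \<phi>) - \<phi>star \<phi>\<bar> \<le> C * t powr (- \<gamma>))"

text \<open>Conditional law of \<open>\<xi> / norm \<xi>\<close> given \<open>norm \<xi> > t\<close> for \<open>\<xi> \<sim> P\<close>.\<close>

definition angular_law :: "'a::euclidean_space measure \<Rightarrow> real \<Rightarrow> 'a measure" where
  "angular_law P t = distr (uniform_measure P {z. norm z > t}) borel sgn"

definition norm_quantile :: "'a::euclidean_space measure \<Rightarrow> real \<Rightarrow> real" where
  "norm_quantile P p = Inf {x. measure P {z. norm z \<le> x} \<ge> p}"

definition extreme_level :: "'a::euclidean_space measure \<Rightarrow> real \<Rightarrow> nat \<Rightarrow> real" where
  "extreme_level P r n = norm_quantile P (1 - real n powr (- r))"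

section \<open>Loss systems\<close>

definition asymp_homogeneous ::
  "'a::euclidean_space set \<Rightarrow> nat \<Rightarrow> (nat \<Rightarrow> 'a \<Rightarrow> real) \<Rightarrow> (nat \<Rightarrow> 'a \<Rightarrow> real) \<Rightarrow> bool" where
  "asymp_homogeneous E K L Lstar \<longleftrightarrow>
     (\<forall>j\<in>{1..K}.
        L j \<in> borel_measurable (restrict_space borel E) \<and>
        (\<exists>z\<in>E. Lstar j z > 0) \<and>
        (\<forall>z\<in>E. \<forall>\<zeta>. (\<forall>t. \<zeta> t \<in> E) \<and> (\<zeta> \<longlongrightarrow> z) at_top \<longrightarrow>
           ((\<lambda>t::real. L j (t *\<^sub>R \<zeta> t) / t) \<longlongrightarrow> Lstar j z) at_top))"

text \<open>With \<open>Lstar\<close> in place of \<open>L\<close> and \<open>u = 1\<close> this is the limiting region.\<close>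

definition joint_exceedance ::
  "'a set \<Rightarrow> (nat \<Rightarrow> 'a \<Rightarrow> real) \<Rightarrow> nat set \<Rightarrow> real \<Rightarrow> 'a set" where
  "joint_exceedance E L J u = {z\<in>E. \<forall>j\<in>J. L j z \<ge> u}"

definition regular_system ::
  "'a::euclidean_space set \<Rightarrow> (nat \<Rightarrow> 'a \<Rightarrow> real) \<Rightarrow> nat set set \<Rightarrow> bool" where
  "regular_system E Lstar JJ \<longleftrightarrow> (\<forall>J\<in>JJ. emeasure lebesgue (joint_exceedance E Lstar J 1) \<noteq> 0)"

text \<open>
  Law of \<open>\<xi> / u\<close> given \<open>\<xi> \<in> S\<close> for \<open>\<xi> \<sim> P\<close>, with \<open>Q0\<close> the arbitrary choice when the
  conditioning event has probability zero.
\<close>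

definition stressed_law ::
  "'a::euclidean_space measure \<Rightarrow> 'a set \<Rightarrow> real \<Rightarrow> 'a measure \<Rightarrow> 'a measure" where
  "stressed_law P S u Q0 =
     (if emeasure P S = 0 then Q0 else distr (uniform_measure P S) borel (\<lambda>z. z /\<^sub>R u))"

section \<open>Data, thresholds and estimators\<close>

text \<open>The sample of size \<open>n\<close> is \<open>X 0, \<dots>, X (n - 1)\<close>.\<close>

definition tail_count :: "real \<Rightarrow> nat \<Rightarrow> nat" where
  "tail_count q n = nat \<lfloor>real n powr (1 - q)\<rfloor>"

definition kth_largest_norm ::
  "(nat \<Rightarrow> 'w \<Rightarrow> 'a::euclidean_space) \<Rightarrow> nat \<Rightarrow> nat \<Rightarrow> 'w \<Rightarrow> real" where
  "kth_largest_norm X n k \<omega> = rev (sort (map (\<lambda>i. norm (X i \<omega>)) [0..<n])) ! (k - 1)"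

definition threshold ::
  "(nat \<Rightarrow> 'w \<Rightarrow> 'a::euclidean_space) \<Rightarrow> real \<Rightarrow> nat \<Rightarrow> 'w \<Rightarrow> real" where
  "threshold X q n = kth_largest_norm X n (tail_count q n)"

definition sample_algebra ::
  "'w measure \<Rightarrow> (nat \<Rightarrow> 'w \<Rightarrow> 'a::euclidean_space) \<Rightarrow> nat \<Rightarrow> 'w measure" where
  "sample_algebra M X n =
     vimage_algebra (space M) (\<lambda>\<omega>. \<lambda>i\<in>{..<n}. X i \<omega>) (Pi\<^sub>M {..<n} (\<lambda>_. borel))"

text \<open>
  The information in the observations with norm at least the threshold: all other observations
  are overwritten by 0. Being built from these observations means being measurable with respect
  to this \<open>\<sigma>\<close>-algebra.
\<close>

definition exceedance_algebra ::
  "'w measure \<Rightarrow> (nat \<Rightarrow> 'w \<Rightarrow> 'a::euclidean_space) \<Rightarrow> real \<Rightarrow> nat \<Rightarrow> 'w measure" where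
  "exceedance_algebra M X q n =
     vimage_algebra (space M)
       (\<lambda>\<omega>. \<lambda>i\<in>{..<n}. if norm (X i \<omega>) \<ge> threshold X q n \<omega> then X i \<omega> else 0)
       (Pi\<^sub>M {..<n} (\<lambda>_. borel))"

definition angular_density_law :: "'a::euclidean_space set \<Rightarrow> ('a \<Rightarrow> real) \<Rightarrow> 'a measure" where
  "angular_density_law E h = density (surface E) (\<lambda>\<phi>. ennreal (h \<phi>))"

definition tail_estimators ::
  "'w measure \<Rightarrow> (nat \<Rightarrow> 'w \<Rightarrow> 'a::euclidean_space) \<Rightarrow> 'a set \<Rightarrow> real \<Rightarrow>
   (nat \<Rightarrow> 'w \<Rightarrow> real) \<Rightarrow> (nat \<Rightarrow> 'w \<Rightarrow> 'a \<Rightarrow> real) \<Rightarrow> bool" where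
  "tail_estimators M X E q shat \<phi>hat \<longleftrightarrow>
     (\<forall>n\<ge>1.
        shat n \<in> borel_measurable (exceedance_algebra M X q n) \<and>
        (\<lambda>(\<omega>, \<phi>). \<phi>hat n \<omega> \<phi>) \<in>
          borel_measurable (exceedance_algebra M X q n \<Otimes>\<^sub>M borel) \<and>
        (\<forall>\<omega>\<in>space M.
           shat n \<omega> > 0 \<and>
           (\<forall>\<phi>\<in>angles E. \<phi>hat n \<omega> \<phi> \<ge> 0) \<and>
           prob_space (angular_density_law E (\<phi>hat n \<omega>))))"

definition estimation_rate ::
  "'w measure \<Rightarrow> (nat \<Rightarrow> 'w \<Rightarrow> 'a::euclidean_space) \<Rightarrow> 'a measure \<Rightarrow> 'a set \<Rightarrow> real \<Rightarrow> real \<Rightarrow>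
   (nat \<Rightarrow> 'w \<Rightarrow> real) \<Rightarrow> (nat \<Rightarrow> 'w \<Rightarrow> 'a \<Rightarrow> real) \<Rightarrow> real \<Rightarrow> real \<Rightarrow> bool" where
  "estimation_rate M X P E q s shat \<phi>hat m l \<longleftrightarrow>
     tail_estimators M X E q shat \<phi>hat \<and>
     bigo_in_prob M (\<lambda>n \<omega>. \<bar>shat n \<omega> - s\<bar>) (\<lambda>n. real (tail_count q n) powr (- m)) \<and>
     bigo_in_prob M
       (\<lambda>n \<omega>. TV (angular_law P (threshold X q n \<omega>)) (angular_density_law E (\<phi>hat n \<omega>)))
       (\<lambda>n. real (tail_count q n) powr (- l))"

section \<open>The data-driven generator\<close>

definition ssgen_tail ::
  "'a::euclidean_space set \<Rightarrow> real \<Rightarrow> real \<Rightarrow> real \<Rightarrow> ('a \<Rightarrow> real) \<Rightarrow> 'a measure" where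
  "ssgen_tail E p s t h =
     distr
       (density (lborel \<Otimes>\<^sub>M surface E)
          (\<lambda>(r, \<phi>). ennreal (indicator {t<..} r * (p * s * t powr s * r powr (- (s + 1)) * h \<phi>))))
       borel (\<lambda>(r, \<phi>). r *\<^sub>R \<phi>)"

text \<open>
  The tail is prescribed on \<open>norm x > t\<close>; the body is any remaining mass on \<open>norm x \<le> t\<close>
  that makes the total mass 1.
\<close>

definition ssgen_law ::
  "'a::euclidean_space set \<Rightarrow> real \<Rightarrow> real \<Rightarrow> real \<Rightarrow> ('a \<Rightarrow> real) \<Rightarrow> 'a measure \<Rightarrow> bool" where
  "ssgen_law E p s t h Q \<longleftrightarrow>
     prob_space Q \<and> sets Q = sets borel \<and>
     (\<forall>B\<in>sets borel. emeasure Q (B \<inter> {x. norm x > t}) = emeasure (ssgen_tail E p s t h) B)"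

definition data_driven_ssgen ::
  "'w measure \<Rightarrow> (nat \<Rightarrow> 'w \<Rightarrow> 'a::euclidean_space) \<Rightarrow> 'a set \<Rightarrow> real \<Rightarrow>
   (nat \<Rightarrow> 'w \<Rightarrow> real) \<Rightarrow> (nat \<Rightarrow> 'w \<Rightarrow> 'a \<Rightarrow> real) \<Rightarrow> (nat \<Rightarrow> 'w \<Rightarrow> 'a measure) \<Rightarrow> bool" where
  "data_driven_ssgen M X E q shat \<phi>hat Pgen \<longleftrightarrow>
     (\<forall>n\<ge>1.
        Pgen n \<in> measurable (sample_algebra M X n) (prob_algebra borel) \<and>
        (\<forall>\<omega>\<in>space M.
           ssgen_law E (real (tail_count q n) / real n) (shat n \<omega>) (threshold X q n \<omega>)
             (\<phi>hat n \<omega>) (Pgen n \<omega>)))"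

end

theory Submission
  imports Defs
begin

text \<open>
  On the scale \<open>v = \<delta> u\<^sub>n\<close>, below which the stress region carries no points, the tail of \<open>P\<close> is up to
  a relative error \<open>O(t\<^sup>-\<^sup>\<gamma>)\<close> the mixture \<open>s r\<^sup>-\<^sup>s\<^sup>-\<^sup>1 dr \<otimes> \<Phi>\<close> with \<open>\<Phi>\<close> the angular law above the
  threshold \<open>t = t\<^sub>n\<close>, and the generator is exactly such a mixture with estimated index and angular law.
  Replacing the angular law costs its total variation error. Replacing the index costs
  \<open>O(\<bar>s' - s\<bar>)\<close> and not \<open>O(\<bar>s' - s\<bar> log n)\<close>, because conditioning removes constant factors, so that
  the radial densities may be matched at \<open>v\<close> instead of \<open>t\<close>. Since the region has mass of order
  \<open>v\<^sup>-\<^sup>s\<close>, these errors survive conditioning, and \<open>t\<^sub>n\<close> is of order \<open>n\<^sup>q\<^sup>/\<^sup>s\<close> with high probability.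
\<close>

section \<open>Radial mixtures and homogeneous measures\<close>

text \<open>Threshold, estimates and generator all depend on the same sample. The comparison is
  therefore a deterministic inequality whose constants are uniform in the threshold, the estimates
  and the generator; it is applied at each sample point outside three events of probability at most
  \<open>\<epsilon> / 3\<close>. As the stress event is rare, an absolute error is useless: an
  angular error made at level t must be multiplied by the radial mass beyond v, not by the mass
  beyond t. Homogeneous measures provide this, because their tails scale exactly. The constraint
  that the stress region lies beyond the threshold holds eventually, since u_n is at least of order
  \<open>n powr (1 / s)\<close> when r is at least 1. The two terms of the rate come from
  \<open>t powr (- \<gamma>)\<close> at a threshold of order \<open>n powr (q / s)\<close> and from
  the estimation rates at a tail count of order \<open>n powr (1 - q)\<close>.\<close>

lemma abs_TV_le:
  assumes "\<And>B. B \<in> sets P \<Longrightarrow> \<bar>measure P B - measure Q B\<bar> \<le> D"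
  shows "\<bar>TV P Q\<bar> \<le> D"
proof -
  have "TV P Q \<le> D"
    unfolding TV_def by (rule cSUP_least) (use assms in auto)
  moreover have "0 \<le> TV P Q"
    unfolding TV_def
  proof (rule cSUP_upper2[where x = "{}"])
    show "bdd_above ((\<lambda>B. \<bar>measure P B - measure Q B\<bar>) ` sets P)"
      using assms by (auto intro!: bdd_aboveI2)
  qed auto
  ultimately show ?thesis by simp
qed

text \<open>Both laws are probability measures, so the differences are bounded by 1; only for a
  bounded family does the real-valued \<open>SUP\<close> dominate its members.\<close>

lemma abs_measure_diff_le_TV:
  assumes "prob_space P" "prob_space Q" "B \<in> sets P"
  shows "\<bar>measure P B - measure Q B\<bar> \<le> TV P Q"
  unfolding TV_def
proof (rule cSUP_upper[OF assms(3)])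
  interpret P: prob_space P by fact
  interpret Q: prob_space Q by fact
  show "bdd_above ((\<lambda>B. \<bar>measure P B - measure Q B\<bar>) ` sets P)"
  proof (rule bdd_aboveI2)
    fix C show "\<bar>measure P C - measure Q C\<bar> \<le> 1"
      using P.prob_le_1[of C] Q.prob_le_1[of C] measure_nonneg[of P C] measure_nonneg[of Q C]
      by linarith
  qed
qed

text \<open>A Pareto density without its normalising factor \<open>s * v powr s\<close>. Left
  unnormalised, kernels of different index differ by a plain power of \<open>r\<close>, and constant
  factors can be collected in one place.\<close>

definition tail_kernel :: "real \<Rightarrow> real \<Rightarrow> real \<Rightarrow> real" where
  "tail_kernel s v r = indicator {v<..} r * r powr (-(s+1))"

lemma tail_kernel_nonneg [simp]: "0 \<le> tail_kernel s v r"
  by (simp add: tail_kernel_def)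

lemma measurable_tail_kernel [measurable]: "tail_kernel s v \<in> borel_measurable borel"
  unfolding tail_kernel_def[abs_def] by measurable

lemma nn_integral_tail_kernel:
  fixes s v :: real
  assumes "0 < s" "0 < v"
  shows "(\<integral>\<^sup>+r. ennreal (tail_kernel s v r) \<partial>lborel) = ennreal (v powr (-s) / s)"
proof -
  have "(\<integral>\<^sup>+r. ennreal (tail_kernel s v r) \<partial>lborel) =
     (\<integral>\<^sup>+r. ennreal (r powr (-(s+1))) * indicator {v..} r \<partial>lborel)"
    by (rule nn_integral_cong_AE)
       (use AE_lborel_singleton[of v] in \<open>eventually_elim, auto simp: indicator_def tail_kernel_def\<close>)
  also have "\<dots> = ennreal (0 - (- (v powr (-s)) / s))"
  proof (rule nn_integral_FTC_atLeast)
    fix x assume "v \<le> x"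
    then have "x > 0" using assms by simp
    then have "((\<lambda>r. - (r powr (-s)) / s) has_real_derivative - (- s * x powr (- s - 1)) / s) (at x)"
      by (auto intro!: derivative_eq_intros)
    then show "((\<lambda>r. - (r powr (-s)) / s) has_real_derivative x powr (-(s+1))) (at x)"
      using assms by simp
  next
    have "((\<lambda>r. r powr (-s)) \<longlongrightarrow> 0) at_top"
      by (rule tendsto_neg_powr) (use assms in \<open>auto intro: filterlim_ident\<close>)
    then have "((\<lambda>r. - (r powr (-s)) / s) \<longlongrightarrow> - 0 / s) at_top"
      using assms by (intro tendsto_intros) auto
    then show "((\<lambda>r. - (r powr (-s)) / s) \<longlongrightarrow> 0) at_top" by simp
  qed auto
  finally show ?thesis by simp
qed

lemma
  fixes s v :: real
  assumes "0 < s" "0 < v"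
  shows integrable_tail_kernel: "integrable lborel (tail_kernel s v)"
    and integral_tail_kernel: "(\<integral>r. tail_kernel s v r \<partial>lborel) = v powr (-s) / s"
proof -
  have nn: "AE r in lborel. 0 \<le> tail_kernel s v r" by simp
  show "integrable lborel (tail_kernel s v)"
    by (rule integrableI_nonneg[OF _ nn]) (auto simp: nn_integral_tail_kernel[OF assms])
  show "(\<integral>r. tail_kernel s v r \<partial>lborel) = v powr (-s) / s"
    by (subst integral_eq_nn_integral[OF _ nn]) (use assms in \<open>auto simp: nn_integral_tail_kernel[OF assms]\<close>)
qed

text \<open>The mass of \<open>B\<close> under the image of the product of
  \<open>tail_kernel s v\<close> and \<open>\<Psi>\<close> under
  \<open>(r, \<phi>) \<mapsto> r *\<^sub>R \<phi>\<close>. It is kept as a real number because the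
  estimates below subtract such values.\<close>

definition radial_mix :: "real \<Rightarrow> real \<Rightarrow> 'a::euclidean_space measure \<Rightarrow> 'a set \<Rightarrow> real" where
  "radial_mix s v \<Psi> B =
     (\<integral>r. tail_kernel s v r * measure \<Psi> {\<phi>. r *\<^sub>R \<phi> \<in> B} \<partial>lborel)"

text \<open>The slice at \<open>r\<close> is a section of the preimage of \<open>B\<close> under the
  measurable map \<open>(r, \<phi>) \<mapsto> r *\<^sub>R \<phi>\<close>.\<close>

lemma measurable_slice:
  fixes B :: "'a::euclidean_space set"
  assumes "finite_measure \<Psi>" "sets \<Psi> = sets borel" "B \<in> sets borel"
  shows "(\<lambda>r::real. emeasure \<Psi> {\<phi>. r *\<^sub>R \<phi> \<in> B}) \<in> borel_measurable borel"
    and "(\<lambda>r::real. measure \<Psi> {\<phi>. r *\<^sub>R \<phi> \<in> B}) \<in> borel_measurable borel"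
proof -
  interpret finite_measure \<Psi> by fact
  have sp: "space \<Psi> = UNIV" using sets_eq_imp_space_eq[OF assms(2)] by simp
  have "(\<lambda>x::real \<times> 'a. fst x *\<^sub>R snd x) \<in> borel \<Otimes>\<^sub>M borel \<rightarrow>\<^sub>M borel"
    by measurable
  then have "(\<lambda>x::real \<times> 'a. fst x *\<^sub>R snd x) -` B \<inter> space (borel \<Otimes>\<^sub>M borel) \<in> sets (borel \<Otimes>\<^sub>M borel)"
    using assms(3) by (rule measurable_sets)
  then have "{x. fst x *\<^sub>R snd x \<in> B} \<in> sets (borel \<Otimes>\<^sub>M \<Psi>)"
    by (simp add: vimage_def space_pair_measure sets_pair_measure_cong[OF refl assms(2)])
  from measurable_emeasure_Pair[OF this]
  show *: "(\<lambda>r::real. emeasure \<Psi> {\<phi>. r *\<^sub>R \<phi> \<in> B}) \<in> borel_measurable borel"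
    by (simp add: vimage_def)
  show "(\<lambda>r::real. measure \<Psi> {\<phi>. r *\<^sub>R \<phi> \<in> B}) \<in> borel_measurable borel"
    unfolding measure_def using * by measurable
qed

lemma integrable_radial_mix:
  fixes B :: "'a::euclidean_space set"
  assumes "finite_measure \<Psi>" "sets \<Psi> = sets borel" "B \<in> sets borel" "0 < s" "0 < v"
  shows "integrable lborel
    (\<lambda>r. tail_kernel s v r * measure \<Psi> {\<phi>. r *\<^sub>R \<phi> \<in> B})"
proof -
  interpret finite_measure \<Psi> by fact
  show ?thesis
  proof (rule Bochner_Integration.integrable_bound)
    show "integrable lborel (\<lambda>r. tail_kernel s v r * measure \<Psi> (space \<Psi>))"
      by (intro integrable_mult_left integrable_tail_kernel assms)
    show "(\<lambda>r. tail_kernel s v r * measure \<Psi> {\<phi>. r *\<^sub>R \<phi> \<in> B}) \<in>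
        borel_measurable lborel"
      using measurable_slice(2)[OF assms(1-3)] by measurable
  qed (auto intro!: mult_left_mono bounded_measure simp: abs_mult)
qed

lemma nn_integral_radial_mix:
  fixes B :: "'a::euclidean_space set"
  assumes "finite_measure \<Psi>" "sets \<Psi> = sets borel" "B \<in> sets borel" "0 < s" "0 < v"
  shows "(\<integral>\<^sup>+r. ennreal (tail_kernel s v r) * emeasure \<Psi> {\<phi>. r *\<^sub>R \<phi> \<in> B} \<partial>lborel)
     = ennreal (radial_mix s v \<Psi> B)"
proof -
  interpret finite_measure \<Psi> by fact
  have "(\<integral>\<^sup>+r. ennreal (tail_kernel s v r) * emeasure \<Psi> {\<phi>. r *\<^sub>R \<phi> \<in> B} \<partial>lborel)
    = (\<integral>\<^sup>+r. ennreal (tail_kernel s v r * measure \<Psi> {\<phi>. r *\<^sub>R \<phi> \<in> B}) \<partial>lborel)"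
    by (intro nn_integral_cong) (simp add: emeasure_eq_measure ennreal_mult)
  also have "\<dots> = ennreal (radial_mix s v \<Psi> B)"
    unfolding radial_mix_def
    by (rule nn_integral_eq_integral[OF integrable_radial_mix[OF assms]]) (auto simp: indicator_def)
  finally show ?thesis .
qed

lemma radial_mix_nonneg: "0 \<le> radial_mix s v \<Psi> B"
  unfolding radial_mix_def by (rule integral_nonneg_AE) (auto simp: indicator_def)

text \<open>A bound that is uniform in the angular set holds on every slice, and integration only
  adds the radial mass \<open>v powr (-s) / s\<close>. The weights are there because the limiting
  angular measure is not normalised, while the angular laws are.\<close>

lemma abs_radial_mix_diff_le:
  fixes B :: "'a::euclidean_space set"
  assumes fin: "finite_measure \<Psi>" "finite_measure \<Psi>'"
    and sets: "sets \<Psi> = sets borel" "sets \<Psi>' = sets borel"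
    and B: "B \<in> sets borel" and pos: "0 < s" "0 < v"
    and diff: "\<And>A. A \<in> sets borel \<Longrightarrow> \<bar>a * measure \<Psi> A - b * measure \<Psi>' A\<bar> \<le> D"
  shows "\<bar>a * radial_mix s v \<Psi> B - b * radial_mix s v \<Psi>' B\<bar> \<le> D * (v powr (-s) / s)"
proof -
  let ?k = "tail_kernel s v"
  let ?m = "\<lambda>\<Psi> r. measure \<Psi> {\<phi>. r *\<^sub>R \<phi> \<in> B}"
  note i1 = integrable_radial_mix[OF fin(1) sets(1) B pos]
  note i2 = integrable_radial_mix[OF fin(2) sets(2) B pos]
  have "a * radial_mix s v \<Psi> B - b * radial_mix s v \<Psi>' B =
      (\<integral>r. a * (?k r * ?m \<Psi> r) - b * (?k r * ?m \<Psi>' r) \<partial>lborel)"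
    unfolding radial_mix_def using i1 i2
    by (subst Bochner_Integration.integral_diff) auto
  also have "\<dots> = (\<integral>r. ?k r * (a * ?m \<Psi> r - b * ?m \<Psi>' r) \<partial>lborel)"
    by (simp add: algebra_simps)
  also have "\<bar>\<dots>\<bar> \<le> (\<integral>r. D * ?k r \<partial>lborel)"
  proof (rule integral_abs_bound_integral)
    have "integrable lborel (\<lambda>r. a * (?k r * ?m \<Psi> r) - b * (?k r * ?m \<Psi>' r))"
      using i1 i2 by (intro Bochner_Integration.integrable_diff integrable_mult_right)
    then show "integrable lborel (\<lambda>r. ?k r * (a * ?m \<Psi> r - b * ?m \<Psi>' r))"
      by (simp add: algebra_simps)
    show "integrable lborel (\<lambda>r. D * ?k r)"
      by (intro integrable_mult_right integrable_tail_kernel pos)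
    fix r
    have "(\<lambda>\<phi>::'a. r *\<^sub>R \<phi>) \<in> borel \<rightarrow>\<^sub>M borel" by measurable
    from measurable_sets[OF this B] have "{\<phi>. r *\<^sub>R \<phi> \<in> B} \<in> sets borel"
      by (simp add: vimage_def)
    from diff[OF this] show "\<bar>?k r * (a * ?m \<Psi> r - b * ?m \<Psi>' r)\<bar> \<le> D * ?k r"
      by (auto simp: abs_mult mult.commute[of D] intro!: mult_left_mono)
  qed
  also have "\<dots> = D * (v powr (-s) / s)"
    by (simp only: integral_mult_right_zero integral_tail_kernel[OF pos])
  finally show ?thesis .
qed

text \<open>
  The two radial densities are matched at \<open>r = v\<close>, so that their difference has constant sign on
  \<open>{v<..}\<close> and its \<open>L\<^sup>1\<close> norm is the difference of the integrals.
\<close>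

lemma abs_radial_mix_index_diff_le:
  fixes B :: "'a::euclidean_space set"
  assumes \<Psi>: "prob_space \<Psi>" "sets \<Psi> = sets borel"
    and B: "B \<in> sets borel" and pos: "0 < s" "0 < s'" "0 < v"
  shows "\<bar>radial_mix s v \<Psi> B - v powr (s' - s) * radial_mix s' v \<Psi> B\<bar>
     \<le> v powr (-s) * \<bar>1 / s - 1 / s'\<bar>"
proof -
  interpret prob_space \<Psi> by fact
  let ?k = "\<lambda>s. tail_kernel s v"
  let ?m = "\<lambda>r. measure \<Psi> {\<phi>. r *\<^sub>R \<phi> \<in> B}"
  let ?c = "v powr (s' - s)"
  let ?d = "\<lambda>r. ?k s r - ?c * ?k s' r"
  note i1 = integrable_radial_mix[OF finite_measure_axioms \<Psi>(2) B pos(1,3)]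
  note i2 = integrable_radial_mix[OF finite_measure_axioms \<Psi>(2) B pos(2,3)]
  have id: "integrable lborel ?d"
    using pos by (intro Bochner_Integration.integrable_diff integrable_mult_right integrable_tail_kernel)
  have "radial_mix s v \<Psi> B - ?c * radial_mix s' v \<Psi> B =
      (\<integral>r. ?k s r * ?m r - ?c * (?k s' r * ?m r) \<partial>lborel)"
    unfolding radial_mix_def using i1 i2
    by (subst Bochner_Integration.integral_diff) auto
  also have "\<dots> = (\<integral>r. ?d r * ?m r \<partial>lborel)"
    by (simp add: algebra_simps)
  also have "\<bar>\<dots>\<bar> \<le> (\<integral>r. \<bar>?d r\<bar> \<partial>lborel)"
  proof (rule integral_abs_bound_integral)
    have "integrable lborel (\<lambda>r. ?k s r * ?m r - ?c * (?k s' r * ?m r))"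
      using i1 i2 by (intro Bochner_Integration.integrable_diff integrable_mult_right)
    then show "integrable lborel (\<lambda>r. ?d r * ?m r)"
      by (simp add: algebra_simps)
    show "integrable lborel (\<lambda>r. \<bar>?d r\<bar>)" using id by simp
    fix r
    have "\<bar>?d r\<bar> * ?m r \<le> \<bar>?d r\<bar> * 1" by (intro mult_left_mono prob_le_1) auto
    then show "\<bar>?d r * ?m r\<bar> \<le> \<bar>?d r\<bar>" by (simp add: abs_mult)
  qed
  also have "\<dots> = \<bar>\<integral>r. ?d r \<partial>lborel\<bar>"
  proof -
    \<comment> \<open>The last factor vanishes at \<open>r = v\<close> and is monotone in
      \<open>r\<close>, so on \<open>{v<..}\<close> the difference has the sign of
      \<open>s' - s\<close>.\<close>
    have quot: "?d r = indicator {v<..} r * r powr (-(s'+1)) * (r powr (s'-s) - v powr (s'-s))" for r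
    proof (cases "r > v")
      case True
      then have "r powr (-(s+1)) = r powr (-(s'+1)) * r powr (s'-s)"
        by (simp add: powr_add[symmetric] algebra_simps)
      then show ?thesis using True by (simp add: tail_kernel_def algebra_simps)
    qed (simp add: tail_kernel_def)
    show ?thesis
    proof (cases "s \<le> s'")
      case True
      have "0 \<le> ?d r" for r
      proof (cases "r > v")
        case r: True
        have "v powr (s'-s) \<le> r powr (s'-s)" using True r pos by (intro powr_mono2) auto
        then show ?thesis unfolding quot by simp
      qed (simp add: tail_kernel_def)
      then have "0 \<le> (\<integral>r. ?d r \<partial>lborel)" "(\<lambda>r. \<bar>?d r\<bar>) = ?d"
        by (auto intro!: integral_nonneg_AE simp: fun_eq_iff)
      then show ?thesis by simp
    next
      case False
      have "0 \<le> - ?d r" for r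
      proof (cases "r > v")
        case r: True
        have "r powr (s'-s) \<le> v powr (s'-s)" using False r pos by (intro powr_mono2') auto
        then have "r powr (-(s'+1)) * (r powr (s'-s) - v powr (s'-s)) \<le> 0"
          by (intro mult_nonneg_nonpos) auto
        then show ?thesis unfolding quot using r by simp
      qed (simp add: tail_kernel_def)
      then have "0 \<le> (\<integral>r. - ?d r \<partial>lborel)" "(\<lambda>r. \<bar>?d r\<bar>) = (\<lambda>r. - ?d r)"
        by (auto intro!: integral_nonneg_AE simp: fun_eq_iff)
      then show ?thesis by (simp only: Bochner_Integration.integral_minus)
    qed
  qed
  also have "(\<integral>r. ?d r \<partial>lborel) = v powr (-s) / s - ?c * (v powr (-s') / s')"
    using pos
    by (subst Bochner_Integration.integral_diff)
       (auto intro!: integrable_mult_right integrable_tail_kernel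
         simp only: integral_mult_right_zero integral_tail_kernel)
  also have "\<dots> = v powr (-s) * (1 / s - 1 / s')"
  proof -
    have "?c * v powr (-s') = v powr (-s)" by (simp add: powr_add[symmetric])
    then show ?thesis by (simp add: field_simps)
  qed
  finally show ?thesis by (simp add: abs_mult)
qed

section \<open>Polar form of homogeneous measures\<close>

lemma measurable_sgn [measurable]: "(sgn :: 'a::euclidean_space \<Rightarrow> 'a) \<in> borel_measurable borel"
  unfolding sgn_div_norm[abs_def] by measurable

text \<open>
  Both sides are determined by their values on the
  product sets \<open>{z. norm z > a \<and> sgn z \<in> A}\<close>, so that no surface integration is needed.
\<close>

lemma homogeneous_measure_polar:
  fixes \<mu> \<Psi> :: "'a::euclidean_space measure"
  assumes \<Psi>: "finite_measure \<Psi>" "sets \<Psi> = sets borel" and \<mu>: "sets \<mu> = sets borel"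
    and hom: "\<And>a A. v \<le> a \<Longrightarrow> A \<in> sets borel \<Longrightarrow>
      emeasure \<mu> {z. norm z > a \<and> sgn z \<in> A} = ennreal (a powr (-s)) * emeasure \<Psi> A"
    and pos: "0 < s" "0 < v" and B: "B \<in> sets borel" "B \<subseteq> {z. norm z > v}"
  shows "emeasure \<mu> B = ennreal (s * radial_mix s v \<Psi> B)"
proof -
  interpret \<Psi>: finite_measure \<Psi> by fact
  note [measurable_cong] = \<Psi>(2) \<mu>
  have sp: "space \<mu> = UNIV" "space \<Psi> = UNIV"
    using sets_eq_imp_space_eq[OF \<mu>] sets_eq_imp_space_eq[OF \<Psi>(2)] by auto
  \<comment> \<open>Normalised so that the mass beyond \<open>x\<close> is exactly
    \<open>(max v x) powr (-s)\<close>, the radial factor in \<open>hom\<close>.\<close>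
  define \<rho> where "\<rho> = density lborel (\<lambda>r. ennreal (s * (tail_kernel s v r)))"
  have [simp]: "sets \<rho> = sets borel" by (simp add: \<rho>_def)
  have \<rho>_tail: "emeasure \<rho> {x<..} = ennreal ((max v x) powr (-s))" for x
  proof -
    have "emeasure \<rho> {x<..} =
        (\<integral>\<^sup>+r. ennreal (s * (tail_kernel s v r)) * indicator {x<..} r \<partial>lborel)"
      unfolding \<rho>_def by (subst emeasure_density) auto
    also have "\<dots> =
        (\<integral>\<^sup>+r. ennreal s * ennreal (tail_kernel s (max v x) r) \<partial>lborel)"
      using pos by (intro nn_integral_cong)
        (auto simp: tail_kernel_def indicator_def ennreal_mult)
    also have "\<dots> = ennreal s * ennreal ((max v x) powr (-s) / s)"
      using pos by (subst nn_integral_cmult) (auto simp: nn_integral_tail_kernel[of s "max v x"] simp del: ennreal_mult)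
    also have "\<dots> = ennreal ((max v x) powr (-s))"
      using pos by (simp add: ennreal_mult[symmetric])
    finally show ?thesis .
  qed
  have "emeasure \<rho> UNIV = (\<integral>\<^sup>+r. ennreal s * ennreal (tail_kernel s v r) \<partial>lborel)"
      unfolding \<rho>_def using pos by (subst emeasure_density) (auto simp: ennreal_mult intro!: nn_integral_cong)
  also have "\<dots> = ennreal s * ennreal (v powr (-s) / s)"
    using pos by (subst nn_integral_cmult) (auto simp: nn_integral_tail_kernel[of s v])
  finally have "emeasure \<rho> UNIV \<noteq> \<infinity>" by (simp add: ennreal_mult_eq_top_iff)
  then interpret \<rho>: finite_measure \<rho>
    by (intro finite_measureI) (simp add: \<rho>_def)
  define \<nu> where "\<nu> = distr (density \<mu> (indicator {z. norm z > v})) (borel \<Otimes>\<^sub>M borel) (\<lambda>z. (norm z, sgn z))"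
  have "\<rho> \<Otimes>\<^sub>M \<Psi> = \<nu>"
  proof (rule pair_measure_eqI)
    show "sigma_finite_measure \<rho>" "sigma_finite_measure \<Psi>" by unfold_locales
    show "sets (\<rho> \<Otimes>\<^sub>M \<Psi>) = sets \<nu>"
      unfolding \<nu>_def sets_distr by (rule sets_pair_measure_cong) (simp_all add: \<Psi>(2))
    fix R A assume "R \<in> sets \<rho>" "A \<in> sets \<Psi>"
    then have RA[measurable]: "R \<in> sets borel" "A \<in> sets borel" by (simp_all add: \<Psi>(2))
    have [measurable]: "{z. norm z > v \<and> sgn z \<in> A} \<in> sets borel" by measurable
    \<comment> \<open>With \<open>A\<close> fixed only a measure on the line is left, and half-lines
      determine it; there \<open>hom\<close> applies at \<open>a = max v x\<close>.\<close>
    define \<eta> where "\<eta> = distr (density \<mu> (indicator {z. norm z > v \<and> sgn z \<in> A})) borel norm"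
    have \<eta>: "emeasure \<eta> Y = emeasure \<mu> {z. norm z \<in> Y \<and> norm z > v \<and> sgn z \<in> A}"
      if [measurable]: "Y \<in> sets borel" for Y
    proof -
      have [measurable]: "norm -` Y \<in> sets (borel :: 'a measure)"
        using measurable_sets[OF borel_measurable_norm that] by simp
      have "emeasure \<eta> Y = (\<integral>\<^sup>+z. indicator {z. norm z > v \<and> sgn z \<in> A} z * indicator (norm -` Y) z \<partial>\<mu>)"
        unfolding \<eta>_def by (subst emeasure_distr) (auto simp: sp emeasure_density)
      also have "\<dots> = (\<integral>\<^sup>+z. indicator {z. norm z \<in> Y \<and> norm z > v \<and> sgn z \<in> A} z \<partial>\<mu>)"
        by (intro nn_integral_cong) (auto simp: indicator_def)
      also have "\<dots> = emeasure \<mu> {z. norm z \<in> Y \<and> norm z > v \<and> sgn z \<in> A}"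
        by (rule nn_integral_indicator) simp
      finally show ?thesis .
    qed
    have "scale_measure (emeasure \<Psi> A) \<rho> = \<eta>"
    proof (rule measure_eqI_lessThan)
      show "sets (scale_measure (emeasure \<Psi> A) \<rho>) = sets borel" "sets \<eta> = sets borel"
        by (simp_all add: \<eta>_def)
      fix x
      show "emeasure (scale_measure (emeasure \<Psi> A) \<rho>) {x<..} < \<infinity>"
        using \<Psi>.emeasure_finite[of A] by (simp add: \<rho>_tail less_top[symmetric] ennreal_mult_eq_top_iff)
      have "{z. norm z \<in> {x<..} \<and> norm z > v \<and> sgn z \<in> A} = {z. norm z > max v x \<and> sgn z \<in> A}"
        by auto
      then show "emeasure (scale_measure (emeasure \<Psi> A) \<rho>) {x<..} = emeasure \<eta> {x<..}"
        using hom[of "max v x" A] by (simp add: \<rho>_tail \<eta> mult.commute)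
    qed
    then have "emeasure \<rho> R * emeasure \<Psi> A = emeasure \<eta> R"
      by (metis emeasure_scale_measure mult.commute)
    also have "\<dots> = emeasure \<nu> (R \<times> A)"
    proof -
      have [measurable]: "(\<lambda>z::'a. (norm z, sgn z)) -` (R \<times> A) \<in> sets borel"
      proof -
        have "(\<lambda>z::'a. (norm z, sgn z)) \<in> borel \<rightarrow>\<^sub>M borel \<Otimes>\<^sub>M borel" by measurable
        from measurable_sets[OF this, of "R \<times> A"] show ?thesis by simp
      qed
      have "emeasure \<nu> (R \<times> A) = (\<integral>\<^sup>+z. indicator {z. norm z > v} z * indicator ((\<lambda>z. (norm z, sgn z)) -` (R \<times> A)) z \<partial>\<mu>)"
        unfolding \<nu>_def by (subst emeasure_distr) (auto simp: sp emeasure_density)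
      also have "\<dots> = (\<integral>\<^sup>+z. indicator {z. norm z \<in> R \<and> norm z > v \<and> sgn z \<in> A} z \<partial>\<mu>)"
        by (intro nn_integral_cong) (auto simp: indicator_def)
      also have "\<dots> = emeasure \<eta> R"
        by (subst nn_integral_indicator) (auto simp: \<eta>)
      finally show ?thesis by simp
    qed
    finally show "emeasure \<rho> R * emeasure \<Psi> A = emeasure \<nu> (R \<times> A)" .
  qed
  define C where "C = {x :: real \<times> 'a. fst x *\<^sub>R snd x \<in> B}"
  have C[measurable]: "C \<in> sets (borel \<Otimes>\<^sub>M borel)"
  proof -
    have "(\<lambda>x::real \<times> 'a. fst x *\<^sub>R snd x) \<in> borel \<Otimes>\<^sub>M borel \<rightarrow>\<^sub>M borel" by measurable
    from measurable_sets[OF this B(1)] show ?thesis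
      by (simp add: C_def vimage_def space_pair_measure)
  qed
  have [measurable]: "(\<lambda>z::'a. (norm z, sgn z)) -` C \<in> sets borel"
  proof -
    have "(\<lambda>z::'a. (norm z, sgn z)) \<in> borel \<rightarrow>\<^sub>M borel \<Otimes>\<^sub>M borel" by measurable
    from measurable_sets[OF this C] show ?thesis by simp
  qed
  have "emeasure \<mu> B = (\<integral>\<^sup>+z. indicator {z. norm z > v} z * indicator ((\<lambda>z. (norm z, sgn z)) -` C) z \<partial>\<mu>)"
  proof -
    \<comment> \<open>Polar coordinates lose nothing, because
      \<open>norm z *\<^sub>R sgn z = z\<close> for every \<open>z\<close>.\<close>
    have "B = {z. norm z > v} \<inter> ((\<lambda>z. (norm z, sgn z)) -` C)"
    proof -
      have "norm z *\<^sub>R sgn z = z" for z :: 'a by (cases "z = 0") (simp_all add: sgn_div_norm)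
      then show ?thesis using B(2) by (auto simp: C_def)
    qed
    then have "emeasure \<mu> B = (\<integral>\<^sup>+z. indicator ({z. norm z > v} \<inter> ((\<lambda>z. (norm z, sgn z)) -` C)) z \<partial>\<mu>)"
      using B(1) by (simp add: \<mu>)
    then show ?thesis by (simp add: indicator_inter_arith)
  qed
  also have "\<dots> = emeasure \<nu> C"
    unfolding \<nu>_def by (subst emeasure_distr) (auto simp: sp emeasure_density)
  also have "\<dots> = (\<integral>\<^sup>+r. emeasure \<Psi> (Pair r -` C) \<partial>\<rho>)"
    unfolding \<open>\<rho> \<Otimes>\<^sub>M \<Psi> = \<nu>\<close>[symmetric]
    by (rule \<Psi>.emeasure_pair_measure_alt)
       (use C in \<open>simp add: sets_pair_measure_cong[OF \<open>sets \<rho> = sets borel\<close> \<Psi>(2)]\<close>)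
  also have "\<dots> = (\<integral>\<^sup>+r. emeasure \<Psi> {\<phi>. r *\<^sub>R \<phi> \<in> B} \<partial>\<rho>)"
    by (simp add: C_def vimage_def)
  also have "\<dots> = (\<integral>\<^sup>+r. ennreal s * (ennreal (tail_kernel s v r) * emeasure \<Psi> {\<phi>. r *\<^sub>R \<phi> \<in> B}) \<partial>lborel)"
    unfolding \<rho>_def using pos measurable_slice(1)[OF \<Psi> B(1)]
    by (subst nn_integral_density) (auto simp: ennreal_mult' mult.assoc intro!: nn_integral_cong)
  also have "\<dots> = ennreal s * ennreal (radial_mix s v \<Psi> B)"
    using pos measurable_slice(1)[OF \<Psi> B(1)]
    by (subst nn_integral_cmult) (auto simp: nn_integral_radial_mix[OF \<Psi> B(1)])
  also have "\<dots> = ennreal (s * radial_mix s v \<Psi> B)"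
    using pos by (simp add: ennreal_mult radial_mix_nonneg)
  finally show ?thesis .
qed

section \<open>Conditioning and the generator\<close>

lemma stressed_law_scaled_preimage:
  fixes P :: "'a::euclidean_space measure"
  assumes "prob_space P" "sets P = sets borel" "S \<in> sets borel" "emeasure P S \<noteq> 0" "B \<in> sets borel"
  shows "measure (stressed_law P S u Q0) B = measure P (S \<inter> {z. z /\<^sub>R u \<in> B}) / measure P S"
proof -
  interpret prob_space P by fact
  note [measurable_cong] = assms(2)
  have sp: "space P = UNIV" using sets_eq_imp_space_eq[OF assms(2)] by simp
  have "(\<lambda>z::'a. z /\<^sub>R u) \<in> borel \<rightarrow>\<^sub>M borel" by measurable
  from measurable_sets[OF this assms(5)] have pre: "{z. z /\<^sub>R u \<in> B} \<in> sets P"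
    by (simp add: vimage_def assms(2))
  have "measure (stressed_law P S u Q0) B = measure (uniform_measure P S) {z. z /\<^sub>R u \<in> B}"
    using assms(4,5) by (simp add: stressed_law_def measure_distr vimage_def sp)
  also have "\<dots> = measure P (S \<inter> {z. z /\<^sub>R u \<in> B}) / measure P S"
    using assms(4) pre by (intro measure_uniform_measure) auto
  finally show ?thesis .
qed

lemma prob_space_stressed_law:
  assumes "prob_space P" "sets P = sets borel" "prob_space Q0"
  shows "prob_space (stressed_law P S u Q0)"
proof -
  interpret prob_space P by fact
  note [measurable_cong] = assms(2)
  show ?thesis
    using assms(3) by (auto simp: stressed_law_def intro!: prob_space.prob_space_distr
        prob_space_uniform_measure)
qed

text \<open>
  The proportionality constant \<open>\<alpha>\<close> is irrelevant after conditioning; it is this freedom that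
  avoids a logarithmic factor when \<open>Q\<close> has a misspecified tail index.
\<close>

lemma TV_stressed_law_le:
  fixes P Q :: "'a::euclidean_space measure"
  assumes P: "prob_space P" "sets P = sets borel" and Q: "prob_space Q" "sets Q = sets borel"
    and P0: "prob_space P0" and Q0: "prob_space Q0" "sets Q0 = sets borel"
    and S: "S \<in> sets borel" and c: "0 < c" "c \<le> measure P S" and \<alpha>: "0 \<le> \<alpha>"
    and close: "\<And>B. B \<in> sets borel \<Longrightarrow> B \<subseteq> S \<Longrightarrow> \<bar>measure P B - \<alpha> * measure Q B\<bar> \<le> \<Delta>"
  shows "\<bar>TV (stressed_law Q S u Q0) (stressed_law P S u P0)\<bar> \<le> 2 * \<Delta> / c"
proof (rule abs_TV_le)
  interpret P: prob_space P by fact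
  interpret Q: prob_space Q by fact
  interpret SP: prob_space "stressed_law P S u P0" using P P0 by (rule prob_space_stressed_law)
  interpret SQ: prob_space "stressed_law Q S u Q0" using Q(1,2) Q0(1) by (rule prob_space_stressed_law)
  let ?a = "measure P S"
  define y where "y = \<alpha> * measure Q S"
  have \<Delta>: "0 \<le> \<Delta>" "\<bar>?a - y\<bar> \<le> \<Delta>"
    using close[of "{}"] close[OF S] by (auto simp: y_def)
  have c_le: "2 * \<Delta> / ?a \<le> 2 * \<Delta> / c"
    using c \<Delta> by (intro divide_left_mono) auto
  fix B assume "B \<in> sets (stressed_law Q S u Q0)"
  then have B: "B \<in> sets borel" using Q0(2) by (auto simp: stressed_law_def split: if_splits)
  show "\<bar>measure (stressed_law Q S u Q0) B - measure (stressed_law P S u P0) B\<bar> \<le> 2 * \<Delta> / c"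
  \<comment> \<open>If \<open>Q\<close> gives \<open>S\<close> no mass, its stressed law is the
    arbitrary \<open>Q0\<close>. But when \<open>y = 0\<close>, the error \<open>\<Delta>\<close> is
    at least the mass of \<open>S\<close> under \<open>P\<close>, and the claimed bound exceeds the
    trivial bound 1.\<close>
  proof (cases "y = 0")
    case True
    then have "?a \<le> \<Delta>" using \<Delta>(2) by (simp only: True)
    moreover have "0 < ?a" using c by simp
    ultimately have "1 \<le> 2 * \<Delta> / ?a" by (simp add: field_simps)
    moreover have "\<bar>measure (stressed_law Q S u Q0) B - measure (stressed_law P S u P0) B\<bar> \<le> 1"
      using SP.prob_le_1[of B] SQ.prob_le_1[of B] measure_nonneg[of "stressed_law P S u P0" B]
        measure_nonneg[of "stressed_law Q S u Q0" B] by linarith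
    ultimately show ?thesis using c_le by linarith
  next
    case False
    have a: "?a > 0" using c by simp
    have y: "y > 0" using False \<alpha> by (simp add: less_le y_def)
    then have nz: "emeasure Q S \<noteq> 0" "emeasure P S \<noteq> 0" "\<alpha> \<noteq> 0"
      using a by (auto simp: y_def P.emeasure_eq_measure Q.emeasure_eq_measure)
    define B' where "B' = S \<inter> {z. z /\<^sub>R u \<in> B}"
    have "(\<lambda>z::'a. z /\<^sub>R u) \<in> borel \<rightarrow>\<^sub>M borel" by measurable
    from measurable_sets[OF this B] have B': "B' \<in> sets borel" "B' \<subseteq> S"
      using S by (auto simp: B'_def vimage_def)
    define x b where "x = \<alpha> * measure Q B'" and "b = measure P B'"
    have x: "0 \<le> x" "x \<le> y"
      using \<alpha> B' S Q(2) by (auto simp: x_def y_def intro!: mult_left_mono Q.finite_measure_mono)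
    have xb: "\<bar>b - x\<bar> \<le> \<Delta>" using close[OF B'] by (simp add: x_def b_def)
    have "measure (stressed_law Q S u Q0) B - measure (stressed_law P S u P0) B = x / y - b / ?a"
      using nz by (simp add: stressed_law_scaled_preimage[OF Q S nz(1) B]
        stressed_law_scaled_preimage[OF P S nz(2) B] B'_def[symmetric] x_def b_def y_def)
    \<comment> \<open>The product \<open>x * y\<close> is added and subtracted. Since
      \<open>x \<le> y\<close>, the mass \<open>y\<close> cancels below, and only the mass of
      \<open>S\<close> under \<open>P\<close> stays in the denominator.\<close>
    also have "\<dots> = (x * (?a - y) - y * (b - x)) / (y * ?a)"
      using y a by (subst diff_frac_eq) (auto simp: algebra_simps)
    also have "\<bar>\<dots>\<bar> \<le> (y * \<Delta> + y * \<Delta>) / (y * ?a)"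
    proof -
      have "\<bar>x * (?a - y) - y * (b - x)\<bar> \<le> \<bar>x * (?a - y)\<bar> + \<bar>y * (b - x)\<bar>"
        by (rule abs_triangle_ineq4)
      also have "\<dots> \<le> y * \<Delta> + y * \<Delta>"
        unfolding abs_mult[of x] abs_mult[of y] using x y \<Delta> xb
        by (intro add_mono mult_mono) auto
      finally have "\<bar>x * (?a - y) - y * (b - x)\<bar> / (y * ?a) \<le> (y * \<Delta> + y * \<Delta>) / (y * ?a)"
        using y a by (intro divide_right_mono) auto
      then show ?thesis using y a by (simp add: abs_divide abs_mult[of y])
    qed
    also have "\<dots> = 2 * \<Delta> / ?a" using y a by (simp add: field_simps)
    finally show ?thesis using c_le by linarith
  qed
qed

section \<open>Surface measure and the tail of the generator\<close>

lemma sets_sphere_measure [simp]: "sets (sphere_measure :: 'a::euclidean_space measure) = sets borel"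
  by (simp add: sphere_measure_def)

lemma sets_surface [simp]: "sets (surface E :: 'a::euclidean_space measure) = sets borel"
  by (simp add: surface_def)

lemma sets_angular_density_law [simp]: "sets (angular_density_law E h) = sets borel"
  by (simp add: angular_density_law_def)

lemma space_surface [simp]: "space (surface E :: 'a::euclidean_space measure) = UNIV"
  using sets_eq_imp_space_eq[OF sets_surface[of E]] by simp

lemma finite_measure_sphere_measure: "finite_measure (sphere_measure :: 'a::euclidean_space measure)"
proof (rule finite_measureI)
  let ?N = "restrict_space lborel (cball 0 1 - {0}) :: 'a measure"
  have m: "sgn \<in> ?N \<rightarrow>\<^sub>M (borel :: 'a measure)"
    by (intro measurable_restrict_space1) (simp add: measurable_sgn)
  have "emeasure (sphere_measure :: 'a measure) UNIV = of_nat DIM('a) * emeasure ?N (space ?N)"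
    by (simp add: sphere_measure_def emeasure_distr[OF m])
  note * = this
  have "emeasure ?N (space ?N) = emeasure lborel (cball 0 1 - {0} :: 'a set)"
    by (simp add: emeasure_restrict_space space_restrict_space)
  also have "\<dots> \<le> emeasure lborel (cball 0 1 :: 'a set)"
    by (rule emeasure_mono) auto
  also have "\<dots> < \<infinity>" by (rule emeasure_lborel_cball_finite)
  finally have "emeasure ?N (space ?N) < \<infinity>" .
  then have "of_nat DIM('a) * emeasure ?N (space ?N) < \<infinity>"
    by (simp add: ennreal_mult_less_top of_nat_less_top)
  then show "emeasure (sphere_measure :: 'a measure) (space sphere_measure) \<noteq> \<infinity>"
    by (simp add: * sets_eq_imp_space_eq[OF sets_sphere_measure] less_top[symmetric])
qed

lemma borel_angles: "closed E \<Longrightarrow> angles E \<in> sets borel"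
proof -
  assume "closed E"
  moreover have "angles E = E \<inter> sphere 0 1" by (auto simp: angles_def)
  ultimately show ?thesis by (auto intro!: borel_closed closed_Int)
qed

text \<open>Serves the exchange of radial and angular integration in the tail of the
  generator.\<close>

lemma sigma_finite_surface:
  assumes "closed E"
  shows "sigma_finite_measure (surface E)"
proof -
  interpret finite_measure "sphere_measure :: 'a measure" by (rule finite_measure_sphere_measure)
  have "emeasure (surface E) UNIV = emeasure sphere_measure (angles E)"
    unfolding surface_def using borel_angles[OF assms]
    by (subst emeasure_density) (auto intro!: borel_measurable_indicator)
  then have "finite_measure (surface E)"
    by (intro finite_measureI) simp
  then show ?thesis by (rule finite_measure.axioms)
qed

lemma AE_surface: "closed E \<Longrightarrow> AE \<phi> in surface E. \<phi> \<in> angles E"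
  unfolding surface_def using borel_angles[of E] by (subst AE_density) (auto intro!: borel_measurable_indicator simp: indicator_def)

text \<open>Tonelli turns the prescribed tail into a radial mixture. As \<open>B\<close> lies beyond
  \<open>v \<ge> t\<close>, the radial cut-off may be moved from \<open>t\<close> up to
  \<open>v\<close>; this is what permits matching radial densities at \<open>v\<close>.\<close>

lemma measure_ssgen_law:
  fixes h :: "'a::euclidean_space \<Rightarrow> real"
  assumes E: "closed E" and ssgen: "ssgen_law E p s t h Q"
    and h [measurable]: "h \<in> borel_measurable borel" and prob: "prob_space (angular_density_law E h)"
    and pos: "0 \<le> p" "0 < s" "0 < t" "t \<le> v"
    and B: "B \<in> sets borel" "B \<subseteq> {z. norm z > v}"
  shows "measure Q B = p * s * t powr s * radial_mix s v (angular_density_law E h) B"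
proof -
  let ?\<Phi> = "angular_density_law E h"
  note [measurable_cong] = sets_surface[of E]
  interpret S: sigma_finite_measure "surface E" by (rule sigma_finite_surface[OF E])
  interpret H: prob_space ?\<Phi> by fact
  define c where "c = p * s * t powr s"
  have c: "c \<ge> 0" using pos by (simp add: c_def)
  define F where "F = (\<lambda>(r, \<phi>). ennreal (indicator {t<..} r * (p * s * t powr s * r powr (- (s + 1)) * h \<phi>)))"
  have F [measurable]: "F \<in> borel_measurable (lborel \<Otimes>\<^sub>M surface E)"
    unfolding F_def by measurable
  define C where "C = {x :: real \<times> 'a. fst x *\<^sub>R snd x \<in> B}"
  have mul: "(\<lambda>(r::real, \<phi>::'a). r *\<^sub>R \<phi>) \<in> lborel \<Otimes>\<^sub>M surface E \<rightarrow>\<^sub>M borel"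
    by measurable
  have pre: "(\<lambda>(r::real, \<phi>::'a). r *\<^sub>R \<phi>) -` B = C" by (auto simp: C_def)
  have C [measurable]: "C \<in> sets (lborel \<Otimes>\<^sub>M surface E)"
    using measurable_sets[OF mul B(1)] by (simp add: pre space_pair_measure)
  have slice: "{\<phi>. r *\<^sub>R \<phi> \<in> B} \<in> sets borel" for r :: real
  proof -
    have "(\<lambda>\<phi>::'a. r *\<^sub>R \<phi>) \<in> borel \<rightarrow>\<^sub>M borel" by measurable
    from measurable_sets[OF this B(1)] show ?thesis by (simp add: vimage_def)
  qed
  have "B = B \<inter> {x. norm x > t}" using B(2) pos(4) by force
  then have "emeasure Q B = emeasure (ssgen_tail E p s t h) B"
    using ssgen B(1) unfolding ssgen_law_def by metis
  also have "\<dots> = (\<integral>\<^sup>+x. F x * indicator C x \<partial>(lborel \<Otimes>\<^sub>M surface E))"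
    unfolding ssgen_tail_def F_def[symmetric]
    using mul B(1) C by (subst emeasure_distr) (auto simp: pre emeasure_density space_pair_measure)
  also have "\<dots> = (\<integral>\<^sup>+r. \<integral>\<^sup>+\<phi>. F (r, \<phi>) * indicator C (r, \<phi>) \<partial>surface E \<partial>lborel)"
    by (rule S.nn_integral_fst[symmetric]) measurable
  also have "\<dots> = (\<integral>\<^sup>+r. ennreal c * (ennreal (tail_kernel s v r) * emeasure ?\<Phi> {\<phi>. r *\<^sub>R \<phi> \<in> B}) \<partial>lborel)"
  proof (rule nn_integral_cong)
    fix r :: real
    have "(\<integral>\<^sup>+\<phi>. F (r, \<phi>) * indicator C (r, \<phi>) \<partial>surface E) =
      (\<integral>\<^sup>+\<phi>. ennreal (c * tail_kernel s v r) * (ennreal (h \<phi>) * indicator {\<phi>. r *\<^sub>R \<phi> \<in> B} \<phi>) \<partial>surface E)"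
    proof (rule nn_integral_cong_AE)
      show "AE \<phi> in surface E. F (r, \<phi>) * indicator C (r, \<phi>) =
        ennreal (c * tail_kernel s v r) * (ennreal (h \<phi>) * indicator {\<phi>. r *\<^sub>R \<phi> \<in> B} \<phi>)"
        using AE_surface[OF E]
      proof eventually_elim
        case (elim \<phi>)
        \<comment> \<open>The radial integral runs over the whole line, so
          \<open>r *\<^sub>R \<phi> \<in> B\<close> only yields \<open>\<bar>r\<bar> > v\<close>.
          For negative \<open>r\<close> both cut-offs are 0, for positive \<open>r\<close> both are
          1.\<close>
        have *: "indicator {t<..} r * (p * s * t powr s * r powr (- (s + 1)) * h \<phi>) = c * tail_kernel s v r * h \<phi>"
          if "r *\<^sub>R \<phi> \<in> B"
        proof -
          have "norm (r *\<^sub>R \<phi>) > v" using that B(2) by auto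
          then have "\<bar>r\<bar> > v" using elim by (simp add: angles_def)
          then have "r > t \<longleftrightarrow> r > v" using pos by auto
          then show ?thesis by (auto simp: c_def tail_kernel_def indicator_def)
        qed
        show ?case
        proof (cases "r *\<^sub>R \<phi> \<in> B")
          case True
          have "F (r, \<phi>) = ennreal (c * tail_kernel s v r) * ennreal (h \<phi>)"
            using c by (simp only: F_def split_conv *[OF True], intro ennreal_mult') simp
          then show ?thesis using True by (simp add: C_def)
        qed (simp add: C_def)
      qed
    qed
    also have "\<dots> = ennreal (c * tail_kernel s v r) * emeasure ?\<Phi> {\<phi>. r *\<^sub>R \<phi> \<in> B}"
      using slice[of r] unfolding angular_density_law_def
      by (subst nn_integral_cmult) (auto simp: emeasure_density)
    finally show "(\<integral>\<^sup>+\<phi>. F (r, \<phi>) * indicator C (r, \<phi>) \<partial>surface E) =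
        ennreal c * (ennreal (tail_kernel s v r) * emeasure ?\<Phi> {\<phi>. r *\<^sub>R \<phi> \<in> B})"
      using c by (simp add: ennreal_mult mult.assoc)
  qed
  also have "\<dots> = ennreal c * ennreal (radial_mix s v ?\<Phi> B)"
    using pos measurable_slice(1)[OF H.finite_measure_axioms sets_angular_density_law B(1)]
    by (subst nn_integral_cmult)
       (auto simp: nn_integral_radial_mix[OF H.finite_measure_axioms sets_angular_density_law B(1)])
  also have "\<dots> = ennreal (c * radial_mix s v ?\<Phi> B)"
    using c by (simp add: ennreal_mult radial_mix_nonneg)
  finally show ?thesis
    using c by (simp add: measure_def c_def radial_mix_nonneg)
qed

section \<open>The regularly varying tail\<close>

text \<open>The density is homogeneous of degree \<open>-(s + d)\<close> with \<open>d\<close> the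
  dimension. It is cut off at the unit sphere because its mass near 0 is in general infinite and
  only the tail matters.\<close>

definition homogeneous_measure :: "real \<Rightarrow> ('a::euclidean_space \<Rightarrow> real) \<Rightarrow> 'a measure" where
  "homogeneous_measure s g =
     density lborel (\<lambda>z. ennreal (indicator {z. norm z > 1} z * (norm z powr (-(s + real DIM('a))) * g (sgn z))))"

lemma sets_homogeneous_measure [simp, measurable_cong]: "sets (homogeneous_measure s g) = sets borel"
  by (simp add: homogeneous_measure_def)

lemma emeasure_homogeneous_measure:
  fixes g :: "'a::euclidean_space \<Rightarrow> real"
  assumes [measurable]: "g \<in> borel_measurable borel" and B [measurable]: "B \<in> sets borel"
    and sub: "B \<subseteq> {z. norm z > 1}"
  shows "emeasure (homogeneous_measure s g) B =
    (\<integral>\<^sup>+z. ennreal (norm z powr (-(s + real DIM('a))) * g (sgn z)) * indicator B z \<partial>lborel)"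
  unfolding homogeneous_measure_def
  using sub by (subst emeasure_density) (auto intro!: nn_integral_cong simp: indicator_def)

lemma sgn_scaleR_pos: "a > 0 \<Longrightarrow> sgn (a *\<^sub>R z) = sgn (z :: 'a::real_normed_vector)"
  by (simp add: sgn_scaleR)

text \<open>Dilation by \<open>a\<close> contributes \<open>a ^ d\<close> from the volume and
  \<open>a powr (-(s + d))\<close> from the density. The condition \<open>a \<ge> 1\<close> keeps
  the dilated set beyond the cut-off.\<close>

lemma emeasure_homogeneous_measure_scale:
  fixes g :: "'a::euclidean_space \<Rightarrow> real"
  assumes [measurable]: "g \<in> borel_measurable borel" and B [measurable]: "B \<in> sets borel"
    and sub: "B \<subseteq> {z. norm z > 1}" and a: "a \<ge> 1" and g: "\<And>z. g z \<ge> 0"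
  shows "emeasure (homogeneous_measure s g) {z. z /\<^sub>R a \<in> B} =
    ennreal (a powr (-s)) * emeasure (homogeneous_measure s g) B"
proof -
  define k where "k = (\<lambda>z::'a. ennreal (norm z powr (-(s + real DIM('a))) * g (sgn z)))"
  have [measurable]: "k \<in> borel_measurable borel" unfolding k_def by measurable
  have "(\<lambda>z::'a. z /\<^sub>R a) \<in> borel \<rightarrow>\<^sub>M borel" by measurable
  from measurable_sets[OF this B] have pre [measurable]: "{z. z /\<^sub>R a \<in> B} \<in> sets borel"
    by (simp add: vimage_def)
  have pre_sub: "{z. z /\<^sub>R a \<in> B} \<subseteq> {z. norm z > 1}"
  proof clarify
    fix z assume "z /\<^sub>R a \<in> B"
    then have "norm (z /\<^sub>R a) > 1" using sub by auto
    then have "norm z > a" using a by (simp add: field_simps)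
    then show "norm z > 1" using a by simp
  qed
  have "emeasure (homogeneous_measure s g) {z. z /\<^sub>R a \<in> B} =
    (\<integral>\<^sup>+z. k z * indicator {z. z /\<^sub>R a \<in> B} z \<partial>lborel)"
    unfolding k_def by (rule emeasure_homogeneous_measure[OF assms(1) pre pre_sub])
  also have "\<dots> = (\<integral>\<^sup>+z. k z * indicator {z. z /\<^sub>R a \<in> B} z
      \<partial>density (distr lborel borel (\<lambda>x. 0 + a *\<^sub>R x)) (\<lambda>_. ennreal (\<bar>a\<bar> ^ DIM('a))))"
    by (subst lborel_affine[of a 0]) (use a in auto)
  also have "\<dots> = (\<integral>\<^sup>+z. ennreal (\<bar>a\<bar> ^ DIM('a)) * (k (a *\<^sub>R z) * indicator {z. z /\<^sub>R a \<in> B} (a *\<^sub>R z)) \<partial>lborel)"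
    by (subst nn_integral_density) (auto simp: nn_integral_distr)
  also have "\<dots> = (\<integral>\<^sup>+z. ennreal (a powr (-s)) * (k z * indicator B z) \<partial>lborel)"
  proof (rule nn_integral_cong)
    fix z :: 'a
    show "ennreal (\<bar>a\<bar> ^ DIM('a)) * (k (a *\<^sub>R z) * indicator {z. z /\<^sub>R a \<in> B} (a *\<^sub>R z)) =
      ennreal (a powr (-s)) * (k z * indicator B z)"
    proof (cases "z \<in> B")
      case True
      then have z: "norm z > 1" using sub by auto
      have "\<bar>a\<bar> ^ DIM('a) * (norm (a *\<^sub>R z) powr (-(s + real DIM('a))) * g (sgn (a *\<^sub>R z))) =
        (a powr real DIM('a) * a powr (-(s + real DIM('a)))) * (norm z powr (-(s + real DIM('a))) * g (sgn z))"
        using a z by (simp add: powr_mult sgn_scaleR_pos powr_realpow)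
      also have "a powr real DIM('a) * a powr (-(s + real DIM('a))) = a powr (-s)"
        by (simp add: powr_add[symmetric])
      finally show ?thesis
        using True a g by (simp add: k_def ennreal_mult[symmetric])
    qed (use a in simp)
  qed
  also have "\<dots> = ennreal (a powr (-s)) * emeasure (homogeneous_measure s g) B"
    using emeasure_homogeneous_measure[OF assms(1) B sub, of s]
    by (subst nn_integral_cmult) (auto simp: k_def)
  finally show ?thesis .
qed

text \<open>The set on the left is the dilation by \<open>a\<close> of
  \<open>{z. norm z > 1 \<and> sgn z \<in> A}\<close>, and the cut-off gives this set the same mass
  as the whole cone \<open>{z. sgn z \<in> A}\<close>.\<close>

lemma emeasure_homogeneous_measure_polar:
  fixes g :: "'a::euclidean_space \<Rightarrow> real"
  assumes g: "g \<in> borel_measurable borel" "\<And>z. g z \<ge> 0" and A [measurable]: "A \<in> sets borel" and a: "a \<ge> 1"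
  shows "emeasure (homogeneous_measure s g) {z. norm z > a \<and> sgn z \<in> A} =
    ennreal (a powr (-s)) * emeasure (homogeneous_measure s g) {z. sgn z \<in> A}"
proof -
  note g(1)[measurable]
  have [measurable]: "{z::'a. sgn z \<in> A} \<in> sets borel" "{z::'a. norm z > 1 \<and> sgn z \<in> A} \<in> sets borel"
    by measurable
  have eq: "{z. norm z > a \<and> sgn z \<in> A} = {z. z /\<^sub>R a \<in> {z. norm z > 1 \<and> sgn z \<in> A}}"
    using a by (auto simp: field_simps sgn_scaleR_pos)
  have "emeasure (homogeneous_measure s g) {z. sgn z \<in> A} =
      emeasure (homogeneous_measure s g) {z. norm z > 1 \<and> sgn z \<in> A}"
    unfolding homogeneous_measure_def
    by (subst (1 2) emeasure_density) (auto intro!: nn_integral_cong simp: indicator_def)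
  then show ?thesis
    unfolding eq using a g by (subst emeasure_homogeneous_measure_scale) auto
qed

text \<open>Only the population law is fixed here. Constants obtained in this context cannot depend
  on the sample or on the estimates, as an application at random thresholds requires.\<close>

locale second_order_tail =
  fixes E :: "'a::euclidean_space set" and f \<phi>star :: "'a \<Rightarrow> real" and s \<gamma> :: real and P :: "'a measure"
  assumes closed_E: "closed E" and cone_E: "cone E"
    and f_nonneg: "\<And>z. f z \<ge> 0" and f_zero: "\<And>z. z \<notin> E \<Longrightarrow> f z = 0"
    and f_meas [measurable]: "f \<in> borel_measurable borel"
    and P_density: "P = density lborel (\<lambda>z. ennreal (f z))"
    and prob_P: "prob_space P"
    and reg_var: "density_reg_var E f s \<phi>star"
    and \<gamma>_pos: "\<gamma> > 0" and second_order: "second_order E f s \<phi>star \<gamma>"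
begin

section \<open>The cone and the limiting angular density\<close>

sublocale P: prob_space P by (rule prob_P)

lemma sets_P [simp, measurable_cong]: "sets P = sets borel"
  by (simp add: P_density)

lemma space_P [simp]: "space P = UNIV"
  by (simp add: P_density)

lemma s_pos: "s > 0" using reg_var by (simp add: density_reg_var_def)

lemma E_scaleR_iff: "c > 0 \<Longrightarrow> c *\<^sub>R z \<in> E \<longleftrightarrow> z \<in> E"
proof
  assume c: "c > 0" and "c *\<^sub>R z \<in> E"
  then have "(1 / c) *\<^sub>R (c *\<^sub>R z) \<in> E" using cone_E unfolding cone_def by (metis less_eq_real_def zero_le_divide_1_iff)
  then show "z \<in> E" using c by simp
next
  assume "c > 0" "z \<in> E"
  then show "c *\<^sub>R z \<in> E" using cone_E unfolding cone_def by auto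
qed

lemma sgn_in_angles_iff: "sgn z \<in> angles E \<longleftrightarrow> z \<in> E \<and> z \<noteq> 0"
proof (cases "z = 0")
  case False
  then show ?thesis
    using E_scaleR_iff[of "inverse (norm z)" z] by (simp add: angles_def sgn_div_norm)
qed (simp add: angles_def)

lemma compact_angles: "compact (angles E)"
proof -
  have "angles E = sphere 0 1 \<inter> E" by (auto simp: angles_def)
  then show ?thesis using closed_E by (simp add: compact_Int_closed)
qed

lemma borel_angles_E [measurable]: "angles E \<in> sets borel" "E \<in> sets borel"
  using borel_angles closed_E by auto

text \<open>A uniform limit of rescaled densities, which are continuous on the unit directions once
  \<open>t > r0\<close>. Together with compactness this bounds \<open>\<phi>star\<close> away from 0
  and from infinity.\<close>

lemma continuous_on_\<phi>star: "continuous_on (angles E) \<phi>star"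
proof -
  have unif: "uniform_limit (angles E) (\<lambda>t z. t powr (s + real DIM('a)) * f (t *\<^sub>R z)) \<phi>star at_top"
    using reg_var compact_angles unfolding density_reg_var_def by (auto simp: angles_def)
  obtain r0 where r0: "r0 > 0" "continuous_on (E - cball 0 r0) f"
    using reg_var unfolding density_reg_var_def by auto
  have "\<forall>\<^sub>F t in at_top. continuous_on (angles E) (\<lambda>z. t powr (s + real DIM('a)) * f (t *\<^sub>R z))"
    using eventually_gt_at_top[of r0]
  proof eventually_elim
    case (elim t)
    have "(\<lambda>z. t *\<^sub>R z) ` angles E \<subseteq> E - cball 0 r0"
      using elim r0 by (auto simp: angles_def E_scaleR_iff)
    then have "continuous_on (angles E) (\<lambda>z. f (t *\<^sub>R z))"
      by (intro continuous_on_compose2[OF r0(2)] continuous_intros) auto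
    then show ?case by (intro continuous_intros)
  qed
  from uniform_limit_theorem[OF this unif] show ?thesis by simp
qed

text \<open>\<open>\<phi>star\<close> is constrained on the cone only; extended by 0 it may be
  evaluated at \<open>sgn z\<close> for every \<open>z\<close>, including
  \<open>z = 0\<close>.\<close>

definition angular_limit :: "'a \<Rightarrow> real" where
  "angular_limit z = indicator (angles E) z * \<phi>star z"

lemma \<phi>star_pos: "z \<in> angles E \<Longrightarrow> \<phi>star z > 0"
  using reg_var by (auto simp: density_reg_var_def angles_def)

lemma measurable_angular_limit [measurable]: "angular_limit \<in> borel_measurable borel"
  using borel_measurable_continuous_on_indicator[OF borel_angles_E(1) continuous_on_\<phi>star]
  by (simp add: angular_limit_def[abs_def])

lemma angular_limit_nonneg: "angular_limit z \<ge> 0"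
  using \<phi>star_pos[of z] by (auto simp: angular_limit_def indicator_def)

text \<open>Extreme values of a positive continuous function on a compact set; an empty set of
  directions has no extrema and is treated apart.\<close>

lemma angular_limit_bounds:
  obtains c C where "0 < c" "0 < C" "\<And>z. c * indicator (angles E) z \<le> angular_limit z"
    "\<And>z. angular_limit z \<le> C * indicator (angles E) z"
proof (cases "angles E = {}")
  case True
  then show ?thesis using that[of 1 1] by (simp add: angular_limit_def)
next
  case False
  obtain a where a: "a \<in> angles E" "\<And>z. z \<in> angles E \<Longrightarrow> \<phi>star a \<le> \<phi>star z"
    using continuous_attains_inf[OF compact_angles False continuous_on_\<phi>star] by blast
  obtain b where b: "b \<in> angles E" "\<And>z. z \<in> angles E \<Longrightarrow> \<phi>star z \<le> \<phi>star b"
    using continuous_attains_sup[OF compact_angles False continuous_on_\<phi>star] by blast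
  show ?thesis
    by (rule that[of "\<phi>star a" "\<phi>star b"])
       (use a b \<phi>star_pos in \<open>auto simp: angular_limit_def indicator_def\<close>)
qed

text \<open>Angular weight 1 in place of the limit density: this measure carries the error terms,
  since the second-order bound is uniform over directions.\<close>

definition \<kappa> :: "'a measure" where
  "\<kappa> = homogeneous_measure s (indicator (angles E))"

text \<open>The homogeneous limit with which the tail of \<open>P\<close> is compared.\<close>

definition \<nu> :: "'a measure" where
  "\<nu> = homogeneous_measure s angular_limit"

lemma sets_\<kappa>_\<nu> [simp, measurable_cong]: "sets \<kappa> = sets borel" "sets \<nu> = sets borel"
  by (simp_all add: \<kappa>_def \<nu>_def)

text \<open>The second-order condition in polar form, multiplied by
  \<open>norm z powr (-(s + d))\<close>. Off the cone both densities vanish, so the bound holds in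
  every direction with the indicator on the right.\<close>

lemma density_close:
  obtains C T where "C > 0" "T \<ge> 1"
    "\<And>t z :: 'a. t \<ge> T \<Longrightarrow> norm z > t \<Longrightarrow>
      \<bar>f z - norm z powr (-(s + real DIM('a))) * angular_limit (sgn z)\<bar>
        \<le> C * t powr (-\<gamma>) * (norm z powr (-(s + real DIM('a))) * indicator (angles E) (sgn z))"
proof -
  obtain C T where CT: "\<And>t r \<phi>. t \<ge> T \<Longrightarrow> r > t \<Longrightarrow> \<phi> \<in> angles E \<Longrightarrow>
     \<bar>r powr (s + real DIM('a)) * f (r *\<^sub>R \<phi>) - \<phi>star \<phi>\<bar> \<le> C * t powr (- \<gamma>)"
    using second_order unfolding second_order_def eventually_at_top_linorder by blast
  show ?thesis
  \<comment> \<open>The constant of \<open>second_order\<close> need not be positive, hence the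
    maximum with 1; a level of at least 1 places everything beyond the cut-off.\<close>
  proof (rule that[of "max C 1" "max T 1"])
    fix t :: real and z :: 'a assume t: "t \<ge> max T 1" and z: "norm z > t"
    let ?w = "norm z powr (-(s + real DIM('a)))"
    show "\<bar>f z - ?w * angular_limit (sgn z)\<bar>
        \<le> max C 1 * t powr (-\<gamma>) * (?w * indicator (angles E) (sgn z))"
    proof (cases "sgn z \<in> angles E")
      case True
      have z0: "norm z > 0" "z \<noteq> 0" using z t by auto
      have "norm z *\<^sub>R sgn z = z" using z0 by (simp add: sgn_div_norm)
      then have "\<bar>norm z powr (s + real DIM('a)) * f z - \<phi>star (sgn z)\<bar> \<le> C * t powr (-\<gamma>)"
        using CT[of t "norm z" "sgn z"] t z True by simp
      also have "\<dots> \<le> max C 1 * t powr (-\<gamma>)" by (intro mult_right_mono) auto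
      finally have "?w * \<bar>norm z powr (s + real DIM('a)) * f z - \<phi>star (sgn z)\<bar> \<le> ?w * (max C 1 * t powr (-\<gamma>))"
        by (intro mult_left_mono) auto
      also have "?w * \<bar>norm z powr (s + real DIM('a)) * f z - \<phi>star (sgn z)\<bar> =
          \<bar>(?w * norm z powr (s + real DIM('a))) * f z - ?w * \<phi>star (sgn z)\<bar>"
        by (simp only: mult.assoc right_diff_distrib[symmetric] abs_mult abs_of_nonneg[OF powr_ge_zero])
      also have "?w * norm z powr (s + real DIM('a)) = 1"
        using z0 by (simp add: powr_add[symmetric])
      finally show ?thesis using True by (simp add: angular_limit_def mult_ac)
    next
      case False
      then have "z \<notin> E" using z t by (auto simp: sgn_in_angles_iff)
      then show ?thesis using False by (simp add: angular_limit_def f_zero)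
    qed
  qed auto
qed

section \<open>Comparison of the law with homogeneous measures\<close>

lemma emeasure_P: "B \<in> sets borel \<Longrightarrow> emeasure P B = (\<integral>\<^sup>+z. ennreal (f z) * indicator B z \<partial>lborel)"
  unfolding P_density by (subst emeasure_density) auto

lemma emeasure_\<kappa>:
  assumes "B \<in> sets borel" "B \<subseteq> {z. norm z > 1}"
  shows "emeasure \<kappa> B =
    (\<integral>\<^sup>+z. ennreal (norm z powr (-(s + real DIM('a))) * indicator (angles E) (sgn z)) * indicator B z \<partial>lborel)"
  unfolding \<kappa>_def by (rule emeasure_homogeneous_measure) (use assms in auto)

lemma emeasure_\<nu>:
  assumes "B \<in> sets borel" "B \<subseteq> {z. norm z > 1}"
  shows "emeasure \<nu> B =
    (\<integral>\<^sup>+z. ennreal (norm z powr (-(s + real DIM('a))) * angular_limit (sgn z)) * indicator B z \<partial>lborel)"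
  unfolding \<nu>_def by (rule emeasure_homogeneous_measure) (use assms in auto)

text \<open>Far out the second-order error is less than half the lower bound \<open>c\<close> of the
  angular density, so the density of \<open>P\<close> stays above \<open>c / 2\<close> times that of
  \<open>\<kappa>\<close>. This yields both the finiteness of \<open>\<kappa>\<close> and the lower
  bound for stress probabilities.\<close>

lemma P_ge_\<kappa>:
  obtains c T where "c > 0" "T \<ge> 1"
    "\<And>B. B \<in> sets borel \<Longrightarrow> B \<subseteq> {z. norm z > T} \<Longrightarrow> ennreal c * emeasure \<kappa> B \<le> emeasure P B"
proof -
  obtain C T where C: "C > 0" "T \<ge> 1" and close: "\<And>t z :: 'a. t \<ge> T \<Longrightarrow> norm z > t \<Longrightarrow>
      \<bar>f z - norm z powr (-(s + real DIM('a))) * angular_limit (sgn z)\<bar>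
        \<le> C * t powr (-\<gamma>) * (norm z powr (-(s + real DIM('a))) * indicator (angles E) (sgn z))"
    by (rule density_close, rule that)
  obtain c where c: "0 < c" and c_le: "\<And>z. c * indicator (angles E) z \<le> angular_limit z"
    by (rule angular_limit_bounds, rule that)
  have "((\<lambda>t. C * t powr (-\<gamma>)) \<longlongrightarrow> C * 0) at_top"
    by (intro tendsto_intros tendsto_neg_powr) (use \<gamma>_pos in \<open>auto intro: filterlim_ident\<close>)
  then have "\<forall>\<^sub>F t in at_top. C * t powr (-\<gamma>) < c / 2"
    by (rule order_tendstoD) (use c in auto)
  then have "\<forall>\<^sub>F t in at_top. C * t powr (-\<gamma>) < c / 2 \<and> t \<ge> T"
    using eventually_ge_at_top by eventually_elim auto
  from eventually_happens[OF this] obtain t where t: "C * t powr (-\<gamma>) < c / 2" "t \<ge> T"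
    by auto
  show ?thesis
  proof (rule that[of "c / 2" t])
    fix B :: "'a set" assume B: "B \<in> sets borel" "B \<subseteq> {z. norm z > t}"
    have B1: "B \<subseteq> {z. norm z > 1}" using B(2) t C by force
    have "ennreal (c/2) * emeasure \<kappa> B = (\<integral>\<^sup>+z. ennreal (c/2) *
        (ennreal (norm z powr (-(s + real DIM('a))) * indicator (angles E) (sgn z)) * indicator B z) \<partial>lborel)"
      unfolding emeasure_\<kappa>[OF B(1) B1] using B(1) by (subst nn_integral_cmult) auto
    also have "\<dots> \<le> emeasure P B"
      unfolding emeasure_P[OF B(1)]
    proof (rule nn_integral_mono)
      fix z :: 'a
      let ?w = "norm z powr (-(s + real DIM('a)))"
      show "ennreal (c/2) * (ennreal (?w * indicator (angles E) (sgn z)) * indicator B z)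
        \<le> ennreal (f z) * indicator B z"
      proof (cases "z \<in> B")
        case True
        then have "norm z > t" using B by auto
        from close[OF t(2) this]
        have "?w * angular_limit (sgn z) - C * t powr (-\<gamma>) * (?w * indicator (angles E) (sgn z)) \<le> f z"
          by linarith
        moreover have "?w * (c * indicator (angles E) (sgn z)) \<le> ?w * angular_limit (sgn z)"
          by (intro mult_left_mono c_le) auto
        moreover have "C * t powr (-\<gamma>) * (?w * indicator (angles E) (sgn z)) \<le> c/2 * (?w * indicator (angles E) (sgn z))"
          using t by (intro mult_right_mono) auto
        ultimately have "c/2 * (?w * indicator (angles E) (sgn z)) \<le> f z"
          by (simp add: algebra_simps)
        then show ?thesis using True c by (simp add: ennreal_mult[symmetric] ennreal_leI)
      qed auto
    qed
    finally show "ennreal (c/2) * emeasure \<kappa> B \<le> emeasure P B" .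
  qed (use c t C in auto)
qed

lemma emeasure_\<kappa>_polar:
  "A \<in> sets borel \<Longrightarrow> a \<ge> 1 \<Longrightarrow>
    emeasure \<kappa> {z. norm z > a \<and> sgn z \<in> A} = ennreal (a powr (-s)) * emeasure \<kappa> {z. sgn z \<in> A}"
  unfolding \<kappa>_def by (rule emeasure_homogeneous_measure_polar) auto

lemma emeasure_\<nu>_polar:
  "A \<in> sets borel \<Longrightarrow> a \<ge> 1 \<Longrightarrow>
    emeasure \<nu> {z. norm z > a \<and> sgn z \<in> A} = ennreal (a powr (-s)) * emeasure \<nu> {z. sgn z \<in> A}"
  unfolding \<nu>_def by (rule emeasure_homogeneous_measure_polar) (auto simp: angular_limit_nonneg)

lemma space_\<kappa>_\<nu> [simp]: "space \<kappa> = UNIV" "space \<nu> = UNIV"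
  by (simp_all add: \<kappa>_def \<nu>_def homogeneous_measure_def)

text \<open>
  No integration in polar coordinates is needed: the tail of \<open>\<kappa>\<close> is dominated by the probability
  measure \<open>P\<close>.
\<close>

lemma finite_measure_\<kappa>: "finite_measure \<kappa>"
proof (rule finite_measureI)
  obtain c T where c: "c > 0" "T \<ge> 1"
    and le: "\<And>B. B \<in> sets borel \<Longrightarrow> B \<subseteq> {z. norm z > T} \<Longrightarrow> ennreal c * emeasure \<kappa> B \<le> emeasure P B"
    by (rule P_ge_\<kappa>) auto
  have "ennreal c * emeasure \<kappa> {z. norm z > T} \<le> emeasure P {z. norm z > T}"
    by (rule le) auto
  also have "\<dots> \<le> 1" by (rule P.emeasure_le_1)
  finally have "ennreal c * emeasure \<kappa> {z. norm z > T} < \<infinity>" using ennreal_one_less_top by (auto intro: le_less_trans)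
  then have "ennreal c * (ennreal (T powr (-s)) * emeasure \<kappa> UNIV) < \<infinity>"
    using emeasure_\<kappa>_polar[of UNIV T] c by simp
  then show "emeasure \<kappa> (space \<kappa>) \<noteq> \<infinity>"
    using c by (auto simp: ennreal_mult_less_top)
qed

sublocale \<kappa>: finite_measure \<kappa> by (rule finite_measure_\<kappa>)

lemma finite_measure_\<nu>: "finite_measure \<nu>"
proof (rule finite_measureI)
  obtain C where C: "0 < C" "\<And>z. angular_limit z \<le> C * indicator (angles E) z"
    by (rule angular_limit_bounds, rule that)
  have "emeasure \<nu> UNIV \<le> ennreal C * emeasure \<kappa> UNIV"
  proof -
    let ?k = "\<lambda>z::'a. indicator {z. norm z > 1} z * (norm z powr (-(s + real DIM('a))) * indicator (angles E) (sgn z))"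
    let ?n = "\<lambda>z::'a. indicator {z. norm z > 1} z * (norm z powr (-(s + real DIM('a))) * angular_limit (sgn z))"
    have "emeasure \<nu> UNIV = (\<integral>\<^sup>+z. ennreal (?n z) \<partial>lborel)"
      unfolding \<nu>_def homogeneous_measure_def by (subst emeasure_density) auto
    also have "\<dots> \<le> (\<integral>\<^sup>+z. ennreal C * ennreal (?k z) \<partial>lborel)"
    proof (rule nn_integral_mono)
      fix z :: 'a
      have "?n z \<le>
          indicator {z. norm z > 1} z * (norm z powr (-(s + real DIM('a))) * (C * indicator (angles E) (sgn z)))"
        by (intro mult_left_mono C) auto
      also have "\<dots> = C * ?k z" by (simp add: mult_ac)
      finally show "ennreal (?n z) \<le> ennreal C * ennreal (?k z)"
        using C(1) by (simp add: ennreal_mult[symmetric] ennreal_leI)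
    qed
    also have "\<dots> = ennreal C * emeasure \<kappa> UNIV"
      unfolding \<kappa>_def homogeneous_measure_def
      by (subst nn_integral_cmult) (auto simp: emeasure_density)
    finally show ?thesis .
  qed
  also have "\<dots> < \<infinity>" using \<kappa>.emeasure_finite[of UNIV] by (simp add: ennreal_mult_eq_top_iff less_top[symmetric])
  finally show "emeasure \<nu> (space \<nu>) \<noteq> \<infinity>" by simp
qed

sublocale \<nu>: finite_measure \<nu> by (rule finite_measure_\<nu>)

text \<open>The pointwise bound integrated over \<open>B\<close>. Each direction is proved as an
  inequality between sums in \<open>ennreal\<close>, which avoids subtraction there, and becomes
  real because all three measures are finite.\<close>

lemma P_\<nu>_close:
  obtains C T where "C > 0" "T \<ge> 1"
    "\<And>t B. t \<ge> T \<Longrightarrow> B \<in> sets borel \<Longrightarrow> B \<subseteq> {z. norm z > t} \<Longrightarrow>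
      \<bar>measure P B - measure \<nu> B\<bar> \<le> C * t powr (-\<gamma>) * measure \<kappa> B"
proof -
  obtain C T where C: "C > 0" "T \<ge> 1" and close: "\<And>t z :: 'a. t \<ge> T \<Longrightarrow> norm z > t \<Longrightarrow>
      \<bar>f z - norm z powr (-(s + real DIM('a))) * angular_limit (sgn z)\<bar>
        \<le> C * t powr (-\<gamma>) * (norm z powr (-(s + real DIM('a))) * indicator (angles E) (sgn z))"
    by (rule density_close, rule that)
  show ?thesis
  proof (rule that[OF C])
    fix t and B :: "'a set" assume t: "t \<ge> T" and B: "B \<in> sets borel" "B \<subseteq> {z. norm z > t}"
    note [measurable] = B(1)
    let ?D = "C * t powr (-\<gamma>)"
    let ?n = "\<lambda>z::'a. norm z powr (-(s + real DIM('a))) * angular_limit (sgn z)"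
    let ?k = "\<lambda>z::'a. norm z powr (-(s + real DIM('a))) * indicator (angles E) (sgn z)"
    have B1: "B \<subseteq> {z. norm z > 1}" using B(2) t C by force
    have D: "?D \<ge> 0" using C by simp
    have n: "?n z \<ge> 0" for z by (simp add: angular_limit_nonneg)
    have "emeasure P B \<le> (\<integral>\<^sup>+z. ennreal (?n z) * indicator B z + ennreal ?D * (ennreal (?k z) * indicator B z) \<partial>lborel)"
      unfolding emeasure_P[OF B(1)]
    proof (rule nn_integral_mono)
      fix z :: 'a
      show "ennreal (f z) * indicator B z \<le> ennreal (?n z) * indicator B z + ennreal ?D * (ennreal (?k z) * indicator B z)"
      proof (cases "z \<in> B")
        case True
        then have "norm z > t" using B by auto
        from close[OF t this] have "f z \<le> ?n z + ?D * ?k z" by linarith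
        then show ?thesis using True n D by (simp add: ennreal_mult[symmetric] ennreal_plus[symmetric] ennreal_leI del: ennreal_plus)
      qed auto
    qed
    also have "\<dots> = emeasure \<nu> B + ennreal ?D * emeasure \<kappa> B"
      unfolding emeasure_\<kappa>[OF B(1) B1] emeasure_\<nu>[OF B(1) B1]
      by (subst nn_integral_add) (auto simp: nn_integral_cmult)
    finally have 1: "measure P B \<le> measure \<nu> B + ?D * measure \<kappa> B"
      using D by (simp add: P.emeasure_eq_measure \<nu>.emeasure_eq_measure \<kappa>.emeasure_eq_measure
          ennreal_mult[symmetric] ennreal_plus[symmetric] del: ennreal_plus)
    have "emeasure \<nu> B \<le> (\<integral>\<^sup>+z. ennreal (f z) * indicator B z + ennreal ?D * (ennreal (?k z) * indicator B z) \<partial>lborel)"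
      unfolding emeasure_\<nu>[OF B(1) B1]
    proof (rule nn_integral_mono)
      fix z :: 'a
      show "ennreal (?n z) * indicator B z \<le> ennreal (f z) * indicator B z + ennreal ?D * (ennreal (?k z) * indicator B z)"
      proof (cases "z \<in> B")
        case True
        then have "norm z > t" using B by auto
        from close[OF t this] have "?n z \<le> f z + ?D * ?k z" by linarith
        then show ?thesis using True f_nonneg[of z] D by (simp add: ennreal_mult[symmetric] ennreal_plus[symmetric] ennreal_leI del: ennreal_plus)
      qed auto
    qed
    also have "\<dots> = emeasure P B + ennreal ?D * emeasure \<kappa> B"
      unfolding emeasure_\<kappa>[OF B(1) B1] emeasure_P[OF B(1)]
      by (subst nn_integral_add) (auto simp: nn_integral_cmult)
    finally have 2: "measure \<nu> B \<le> measure P B + ?D * measure \<kappa> B"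
      using D by (simp add: P.emeasure_eq_measure \<nu>.emeasure_eq_measure \<kappa>.emeasure_eq_measure
          ennreal_mult[symmetric] ennreal_plus[symmetric] del: ennreal_plus)
    from 1 2 show "\<bar>measure P B - measure \<nu> B\<bar> \<le> ?D * measure \<kappa> B" by linarith
  qed
qed

section \<open>Angular laws above a threshold\<close>

lemma prob_space_angular_law:
  assumes "measure P {z. norm z > t} > 0"
  shows "prob_space (angular_law P t)"
proof -
  have "prob_space (uniform_measure P {z. norm z > t})"
    using assms by (intro prob_space_uniform_measure) (auto simp: P.emeasure_eq_measure)
  then show ?thesis
    unfolding angular_law_def by (rule prob_space.prob_space_distr) simp
qed

lemma sets_angular_law [simp]: "sets (angular_law P t) = sets borel"
  by (simp add: angular_law_def)

lemma measure_angular_law: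
  assumes "measure P {z. norm z > t} > 0" and A [measurable]: "A \<in> sets borel"
  shows "measure P {z. norm z > t} * measure (angular_law P t) A = measure P {z. norm z > t \<and> sgn z \<in> A}"
proof -
  have pre: "{z::'a. sgn z \<in> A} \<in> sets P" by measurable
  have "measure (angular_law P t) A = measure (uniform_measure P {z. norm z > t}) {z. sgn z \<in> A}"
    unfolding angular_law_def by (subst measure_distr) (auto simp: vimage_def)
  also have "\<dots> = measure P ({z. norm z > t} \<inter> {z. sgn z \<in> A}) / measure P {z. norm z > t}"
    using assms pre by (intro measure_uniform_measure) (auto simp: P.emeasure_eq_measure)
  finally show ?thesis using assms(1) by (simp add: Int_def)
qed

text \<open>The limiting angular measure, not normalised: its total mass is the limit of
  \<open>t powr s * measure P {z. norm z > t}\<close>.\<close>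

definition \<Psi> :: "'a measure" where "\<Psi> = distr \<nu> borel sgn"

lemma sets_\<Psi> [simp]: "sets \<Psi> = sets borel"
  by (simp add: \<Psi>_def)

lemma finite_measure_\<Psi>: "finite_measure \<Psi>"
  unfolding \<Psi>_def by (rule \<nu>.finite_measure_distr) simp

lemma emeasure_\<Psi>: "A \<in> sets borel \<Longrightarrow> emeasure \<Psi> A = emeasure \<nu> {z. sgn z \<in> A}"
  unfolding \<Psi>_def by (subst emeasure_distr) (auto simp: vimage_def)

lemma measure_\<nu>_radial_mix:
  assumes "v \<ge> 1" "B \<in> sets borel" "B \<subseteq> {z. norm z > v}"
  shows "measure \<nu> B = s * radial_mix s v \<Psi> B"
proof -
  have "emeasure \<nu> B = ennreal (s * radial_mix s v \<Psi> B)"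
  proof (rule homogeneous_measure_polar[OF finite_measure_\<Psi> sets_\<Psi> sets_\<kappa>_\<nu>(2)])
    fix a A assume "v \<le> a" "A \<in> sets (borel :: 'a measure)"
    then show "emeasure \<nu> {z. norm z > a \<and> sgn z \<in> A} = ennreal (a powr (-s)) * emeasure \<Psi> A"
      using assms by (simp add: emeasure_\<nu>_polar emeasure_\<Psi>)
  qed (use assms s_pos in auto)
  then show ?thesis using s_pos by (simp add: measure_def radial_mix_nonneg)
qed

lemma measure_\<kappa>_tail: "v \<ge> 1 \<Longrightarrow> measure \<kappa> {z. norm z > v} = v powr (-s) * measure \<kappa> UNIV"
  using emeasure_\<kappa>_polar[of UNIV v]
  by (simp add: \<kappa>.emeasure_eq_measure ennreal_mult[symmetric])

text \<open>The second bound separates two levels: the precision is that of \<open>t\<close>, the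
  mass that of \<open>v\<close>. The first is the second at \<open>v = t\<close> on
  \<open>{z. norm z > t \<and> sgn z \<in> A}\<close>, multiplied by
  \<open>t powr s\<close>.\<close>

lemma angular_law_close:
  obtains C T where "C > 0" "T \<ge> 1"
    "\<And>t A. t \<ge> T \<Longrightarrow> measure P {z. norm z > t} > 0 \<Longrightarrow> A \<in> sets borel \<Longrightarrow>
      \<bar>measure \<Psi> A - t powr s * measure P {z. norm z > t} * measure (angular_law P t) A\<bar> \<le> C * t powr (-\<gamma>)"
    "\<And>t v B. t \<ge> T \<Longrightarrow> v \<ge> t \<Longrightarrow> B \<in> sets borel \<Longrightarrow> B \<subseteq> {z. norm z > v} \<Longrightarrow>
      \<bar>measure P B - measure \<nu> B\<bar> \<le> C * t powr (-\<gamma>) * v powr (-s)"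
proof -
  obtain C T where CT: "C > 0" "T \<ge> 1" and close:
    "\<And>t B. t \<ge> T \<Longrightarrow> B \<in> sets borel \<Longrightarrow> B \<subseteq> {z. norm z > t} \<Longrightarrow>
      \<bar>measure P B - measure \<nu> B\<bar> \<le> C * t powr (-\<gamma>) * measure \<kappa> B"
    by (rule P_\<nu>_close, rule that)
  \<comment> \<open>The summand 1 keeps the constant positive whatever the mass of
    \<open>\<kappa>\<close>.\<close>
  define C' where "C' = C * (measure \<kappa> UNIV + 1)"
  have 2: "\<bar>measure P B - measure \<nu> B\<bar> \<le> C' * t powr (-\<gamma>) * v powr (-s)"
    if t: "t \<ge> T" "v \<ge> t" and B: "B \<in> sets borel" "B \<subseteq> {z. norm z > v}" for t v B
  proof -
    have "\<bar>measure P B - measure \<nu> B\<bar> \<le> C * t powr (-\<gamma>) * measure \<kappa> B"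
      using B t by (intro close) auto
    also have "\<dots> \<le> C * t powr (-\<gamma>) * measure \<kappa> {z. norm z > v}"
      using CT B by (intro mult_left_mono \<kappa>.finite_measure_mono) auto
    also have "\<dots> = C * t powr (-\<gamma>) * (v powr (-s) * measure \<kappa> UNIV)"
      using t CT by (subst measure_\<kappa>_tail) auto
    also have "\<dots> \<le> C * t powr (-\<gamma>) * (v powr (-s) * (measure \<kappa> UNIV + 1))"
      using CT by (intro mult_left_mono) auto
    finally show ?thesis by (simp add: C'_def mult_ac)
  qed
  show ?thesis
  proof (rule that[OF _ CT(2) _ 2])
    show "C' > 0" using CT by (auto simp: C'_def intro!: mult_pos_pos add_nonneg_pos)
    fix t and A :: "'a set"
    assume t: "t \<ge> T" "measure P {z. norm z > t} > 0" and A [measurable]: "A \<in> sets borel"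
    have t1: "t \<ge> 1" using t CT by simp
    let ?B = "{z. norm z > t \<and> sgn z \<in> A}"
    have B: "?B \<in> sets borel" by measurable
    have \<nu>B: "measure \<nu> ?B = t powr (-s) * measure \<Psi> A"
    proof -
      have "emeasure \<nu> ?B = ennreal (t powr (-s)) * emeasure \<Psi> A"
        using emeasure_\<nu>_polar[OF A t1] emeasure_\<Psi>[OF A] by simp
      then show ?thesis by (simp add: measure_def enn2real_mult)
    qed
    have "t powr s * t powr (-s) = 1" using t1 by (simp add: powr_add[symmetric])
    then have \<Psi>A: "measure \<Psi> A = t powr s * measure \<nu> ?B"
      by (simp add: \<nu>B mult.assoc[symmetric])
    have "\<bar>measure P ?B - measure \<nu> ?B\<bar> \<le> C' * t powr (-\<gamma>) * t powr (-s)"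
      using t by (intro 2 B) auto
    then have "t powr s * \<bar>measure P ?B - measure \<nu> ?B\<bar> \<le> t powr s * (C' * t powr (-\<gamma>) * t powr (-s))"
      by (intro mult_left_mono) auto
    also have "\<dots> = C' * t powr (-\<gamma>)" using \<open>t powr s * t powr (-s) = 1\<close> by (simp add: mult_ac)
    also have "t powr s * \<bar>measure P ?B - measure \<nu> ?B\<bar> =
        \<bar>measure \<Psi> A - t powr s * measure P {z. norm z > t} * measure (angular_law P t) A\<bar>"
      unfolding \<Psi>A measure_angular_law[OF t(2) A] mult.assoc right_diff_distrib[symmetric] abs_mult
      by (simp add: abs_minus_commute)
    finally show "\<bar>measure \<Psi> A - t powr s * measure P {z. norm z > t} * measure (angular_law P t) A\<bar>
        \<le> C' * t powr (-\<gamma>)" .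
  qed
qed

text \<open>Four replacements, each costing its error times \<open>v powr (-s)\<close>:
  \<open>P\<close> by \<open>\<nu>\<close>, a mixture over \<open>\<Psi>\<close>;
  \<open>\<Psi>\<close> by the scaled angular law above \<open>t\<close>; that law by its estimate;
  the index \<open>s\<close> by \<open>s'\<close>. The result is a multiple of \<open>Q\<close>. The
  index error arises as \<open>s * \<bar>1 / s - 1 / s'\<bar>\<close>, which is
  \<open>\<bar>s' - s\<bar> / s'\<close>.\<close>

lemma generator_close:
  obtains C T where "C > 0" "T \<ge> 1"
    "\<And>t v p s' h Q \<tau>. t \<ge> T \<Longrightarrow> v \<ge> t \<Longrightarrow> p > 0 \<Longrightarrow> s' > 0 \<Longrightarrow> measure P {z. norm z > t} > 0 \<Longrightarrow>
      h \<in> borel_measurable borel \<Longrightarrow> prob_space (angular_density_law E h) \<Longrightarrow>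
      ssgen_law E p s' t h Q \<Longrightarrow> TV (angular_law P t) (angular_density_law E h) \<le> \<tau> \<Longrightarrow>
      \<exists>\<alpha>\<ge>0. \<forall>B\<in>sets borel. B \<subseteq> {z. norm z > v} \<longrightarrow>
        \<bar>measure P B - \<alpha> * measure Q B\<bar> \<le> C * (t powr (-\<gamma>) + \<tau> + \<bar>s' - s\<bar> / s') * v powr (-s)"
proof -
  obtain D T where DT: "D > 0" "T \<ge> 1" and ang:
    "\<And>t A. t \<ge> T \<Longrightarrow> measure P {z. norm z > t} > 0 \<Longrightarrow> A \<in> sets borel \<Longrightarrow>
      \<bar>measure \<Psi> A - t powr s * measure P {z. norm z > t} * measure (angular_law P t) A\<bar> \<le> D * t powr (-\<gamma>)"
    and P\<nu>: "\<And>t v B. t \<ge> T \<Longrightarrow> v \<ge> t \<Longrightarrow> B \<in> sets borel \<Longrightarrow> B \<subseteq> {z. norm z > v} \<Longrightarrow>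
      \<bar>measure P B - measure \<nu> B\<bar> \<le> D * t powr (-\<gamma>) * v powr (-s)"
    by (rule angular_law_close, rule that)
  \<comment> \<open>\<open>2 * D\<close> pays for the two second-order replacements;
    \<open>D + measure \<Psi> UNIV\<close> bounds the scale \<open>a\<close> of the other
    two.\<close>
  define C where "C = 2 * D + measure \<Psi> UNIV"
  show ?thesis
  proof (rule that[of C T])
    show "C > 0" using DT by (simp add: C_def add_pos_nonneg)
    fix t v p s' h Q \<tau>
    assume t: "t \<ge> T" "v \<ge> t" "p > 0" "s' > 0" and Ppos: "measure P {z. norm z > t} > 0"
      and h: "h \<in> borel_measurable borel" "prob_space (angular_density_law E h)"
      and ssgen: "ssgen_law E p s' t h Q" and TV: "TV (angular_law P t) (angular_density_law E h) \<le> \<tau>"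
    have t1: "t \<ge> 1" "v \<ge> 1" "t > 0" "v > 0" using t DT by auto
    let ?\<Phi> = "angular_law P t" and ?\<Phi>h = "angular_density_law E h"
    interpret \<Phi>: prob_space ?\<Phi> by (rule prob_space_angular_law[OF Ppos])
    interpret \<Phi>h: prob_space ?\<Phi>h by (rule h)
    \<comment> \<open>The factor that brings the angular law above \<open>t\<close> to the scale of
      \<open>\<Psi>\<close>.\<close>
    define a where "a = t powr s * measure P {z. norm z > t}"
    define x where "x = t powr (-\<gamma>)"
    define e where "e = \<bar>s' - s\<bar> / s'"
    have a0: "a \<ge> 0" by (simp add: a_def)
    have x: "0 \<le> x" "x \<le> 1"
      using powr_mono[of "-\<gamma>" 0 t] t1 \<gamma>_pos by (auto simp: x_def)
    have e0: "e \<ge> 0" using t by (simp add: e_def)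
    have dist: "\<bar>measure ?\<Phi> A - measure ?\<Phi>h A\<bar> \<le> \<tau>" if "A \<in> sets borel" for A
      using abs_measure_diff_le_TV[OF \<Phi>.prob_space_axioms h(2), of A] that TV by simp
    have \<tau>0: "\<tau> \<ge> 0" using dist[of "{}"] by simp
    have a_le: "a \<le> C"
    proof -
      have "space ?\<Phi> = UNIV" using sets_eq_imp_space_eq[OF sets_angular_law] by simp
      then have "measure ?\<Phi> UNIV = 1" using \<Phi>.prob_space by simp
      then have "\<bar>measure \<Psi> UNIV - a\<bar> \<le> D * x" using ang[OF t(1) Ppos, of UNIV] by (simp add: a_def x_def)
      also have "\<dots> \<le> D * 1" using DT x by (intro mult_left_mono) auto
      finally show ?thesis using DT by (simp add: C_def)
    qed
    \<comment> \<open>Chosen so that \<open>\<alpha>\<close> times the constant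
      \<open>p * s' * t powr s'\<close> of the generator is \<open>s * a * v powr (s' - s)\<close>;
      in particular the prescribed tail mass \<open>p\<close> cancels.\<close>
    define \<alpha> where "\<alpha> = s * a * v powr (s' - s) / (p * s' * t powr s')"
    have "\<bar>measure P B - \<alpha> * measure Q B\<bar> \<le> C * (x + \<tau> + e) * v powr (-s)"
      if B: "B \<in> sets borel" "B \<subseteq> {z. norm z > v}" for B
    proof -
      let ?r = "\<lambda>\<Psi>. radial_mix s v \<Psi> B" and ?r' = "v powr (s' - s) * radial_mix s' v ?\<Phi>h B"
      have 1: "\<bar>measure P B - s * ?r \<Psi>\<bar> \<le> D * x * v powr (-s)"
        using P\<nu>[OF t(1,2) B] measure_\<nu>_radial_mix[OF t1(2) B] by (simp add: x_def)
      have "\<bar>1 * ?r \<Psi> - a * ?r ?\<Phi>\<bar> \<le> D * x * (v powr (-s) / s)"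
        using s_pos t1 ang[OF t(1) Ppos]
        by (intro abs_radial_mix_diff_le finite_measure_\<Psi> \<Phi>.finite_measure_axioms B)
           (auto simp: a_def x_def)
      then have "s * \<bar>?r \<Psi> - a * ?r ?\<Phi>\<bar> \<le> s * (D * x * (v powr (-s) / s))"
        using s_pos by (intro mult_left_mono) auto
      also have "\<dots> = D * x * v powr (-s)" using s_pos by simp
      finally have 2: "\<bar>s * ?r \<Psi> - s * (a * ?r ?\<Phi>)\<bar> \<le> D * x * v powr (-s)"
        using s_pos by (simp add: right_diff_distrib[symmetric] abs_mult)
      have "\<bar>a * ?r ?\<Phi> - a * ?r ?\<Phi>h\<bar> \<le> (a * \<tau>) * (v powr (-s) / s)"
      proof (intro abs_radial_mix_diff_le \<Phi>.finite_measure_axioms \<Phi>h.finite_measure_axioms B)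
        fix A :: "'a set" assume "A \<in> sets borel"
        from mult_left_mono[OF dist[OF this] a0]
        show "\<bar>a * measure ?\<Phi> A - a * measure ?\<Phi>h A\<bar> \<le> a * \<tau>"
          using a0 by (simp add: right_diff_distrib[symmetric] abs_mult)
      qed (use s_pos t1 in auto)
      then have "s * \<bar>a * ?r ?\<Phi> - a * ?r ?\<Phi>h\<bar> \<le> s * ((a * \<tau>) * (v powr (-s) / s))"
        using s_pos by (intro mult_left_mono) auto
      also have "\<dots> = a * \<tau> * v powr (-s)" using s_pos by simp
      finally have 3: "\<bar>s * (a * ?r ?\<Phi>) - s * (a * ?r ?\<Phi>h)\<bar> \<le> a * \<tau> * v powr (-s)"
        using s_pos by (simp add: right_diff_distrib[symmetric] abs_mult)
      have "\<bar>?r ?\<Phi>h - ?r'\<bar> \<le> v powr (-s) * \<bar>1 / s - 1 / s'\<bar>"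
        using s_pos t t1 by (intro abs_radial_mix_index_diff_le h(2) B) auto
      then have "s * a * \<bar>?r ?\<Phi>h - ?r'\<bar> \<le> s * a * (v powr (-s) * \<bar>1 / s - 1 / s'\<bar>)"
        using s_pos a0 by (intro mult_left_mono) auto
      also have "\<dots> = a * (s * \<bar>1 / s - 1 / s'\<bar>) * v powr (-s)" by (simp add: mult_ac)
      also have "s * \<bar>1 / s - 1 / s'\<bar> = e"
      proof -
        have "1 / s - 1 / s' = (s' - s) / (s * s')" using s_pos t by (simp add: field_simps)
        then show ?thesis using s_pos t by (simp add: e_def abs_mult)
      qed
      also have "s * a * \<bar>?r ?\<Phi>h - ?r'\<bar> = \<bar>s * (a * ?r ?\<Phi>h) - s * (a * ?r')\<bar>"
        using s_pos a0 by (simp only: right_diff_distrib[symmetric] abs_mult)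
      finally have 4: "\<bar>s * (a * ?r ?\<Phi>h) - s * (a * ?r')\<bar> \<le> a * e * v powr (-s)" .
      have Q: "\<alpha> * measure Q B = s * (a * ?r')"
        using measure_ssgen_law[OF closed_E ssgen h _ t(4) t1(3) t(2) B] t t1
        by (simp add: \<alpha>_def)
      have "\<bar>measure P B - \<alpha> * measure Q B\<bar> \<le> (2 * D * x + a * \<tau> + a * e) * v powr (-s)"
        unfolding Q using 1 2 3 4 by (simp add: distrib_right)
      also have "\<dots> \<le> (C * x + C * \<tau> + C * e) * v powr (-s)"
        using a_le \<tau>0 e0 x DT by (intro mult_right_mono add_mono) (auto simp: C_def)
      finally show ?thesis by (simp add: distrib_left)
    qed
    moreover have "\<alpha> \<ge> 0" using s_pos a0 t by (simp add: \<alpha>_def)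
    ultimately show "\<exists>\<alpha>\<ge>0. \<forall>B\<in>sets borel. B \<subseteq> {z. norm z > v} \<longrightarrow>
        \<bar>measure P B - \<alpha> * measure Q B\<bar> \<le> C * (t powr (-\<gamma>) + \<tau> + \<bar>s' - s\<bar> / s') * v powr (-s)"
      unfolding x_def e_def by blast
  qed (use DT in auto)
qed

end

section \<open>Joint exceedance regions\<close>

text \<open>Continuous convergence is locally uniform. The assumed limit concerns paths indexed by
  all real \<open>t\<close>, so a failure along a sequence of levels has to be turned into such a
  path.\<close>

lemma asymp_homogeneous_locally_uniform:
  fixes L :: "nat \<Rightarrow> 'a::euclidean_space \<Rightarrow> real"
  assumes hom: "asymp_homogeneous E K L Lstar" and j: "j \<in> {1..K}" and z: "z \<in> E" and e: "e > 0"
  obtains \<delta> T where "\<delta> > 0"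
    "\<And>t w. t \<ge> T \<Longrightarrow> w \<in> E \<Longrightarrow> dist w z < \<delta> \<Longrightarrow> \<bar>L j (t *\<^sub>R w) / t - Lstar j z\<bar> < e"
proof -
  have "\<exists>\<delta>>0. \<exists>T. \<forall>t w. t \<ge> T \<longrightarrow> w \<in> E \<longrightarrow> dist w z < \<delta> \<longrightarrow> \<bar>L j (t *\<^sub>R w) / t - Lstar j z\<bar> < e"
  proof (rule ccontr)
    assume neg: "\<not> ?thesis"
    define bad where "bad = (\<lambda>t w. w \<in> E \<and> \<bar>L j (t *\<^sub>R w) / t - Lstar j z\<bar> \<ge> e)"
    have ex: "\<exists>t w. t \<ge> T \<and> dist w z < \<delta> \<and> bad t w" if "\<delta> > 0" for \<delta> T
      using neg that unfolding bad_def by (meson linorder_not_le)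
    \<comment> \<open>Strictly increasing levels make the bad point a function of its level, which
      the path below requires.\<close>
    have "\<exists>x. \<forall>n. (fst (x n) \<ge> real n \<and> dist (snd (x n)) z < 1 / real (Suc n) \<and> bad (fst (x n)) (snd (x n))) \<and>
        fst (x n) < fst (x (Suc n))"
    proof (rule dependent_nat_choice)
      show "\<exists>x. fst x \<ge> real 0 \<and> dist (snd x) z < 1 / real (Suc 0) \<and> bad (fst x) (snd x)"
        using ex[of 1 0] by auto
      fix x :: "real \<times> 'a" and n
      obtain t w where "t \<ge> max (fst x + 1) (real (Suc n))" "dist w z < 1 / real (Suc (Suc n))" "bad t w"
        using ex[of "1 / real (Suc (Suc n))" "max (fst x + 1) (real (Suc n))"] by auto
      then show "\<exists>y. (fst y \<ge> real (Suc n) \<and> dist (snd y) z < 1 / real (Suc (Suc n)) \<and> bad (fst y) (snd y)) \<and> fst x < fst y"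
        by (intro exI[of _ "(t, w)"]) auto
    qed
    then obtain x where x: "\<And>n. fst (x n) \<ge> real n" "\<And>n. dist (snd (x n)) z < 1 / real (Suc n)"
      "\<And>n. bad (fst (x n)) (snd (x n))" and step: "\<And>n. fst (x n) < fst (x (Suc n))"
      by auto
    have mono: "strict_mono (\<lambda>n. fst (x n))" using step by (simp add: strict_mono_Suc_iff)
    \<comment> \<open>The path visits the bad point at each bad level and rests at \<open>z\<close>
      otherwise: it stays in \<open>E\<close> and tends to \<open>z\<close>, yet the loss along it
      misses its limit at arbitrarily high levels.\<close>
    define \<zeta> where "\<zeta> t = (if \<exists>n. t = fst (x n) then snd (x (THE n. t = fst (x n))) else z)" for t
    have \<zeta>_x: "\<zeta> (fst (x n)) = snd (x n)" for n
    proof -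
      have "(THE m. fst (x n) = fst (x m)) = n"
        using strict_mono_eq[OF mono] by (intro the_equality) auto
      then show ?thesis by (auto simp: \<zeta>_def)
    qed
    have \<zeta>_cases: "(\<exists>n. t = fst (x n) \<and> \<zeta> t = snd (x n)) \<or> \<zeta> t = z" for t
    proof (cases "\<exists>n. t = fst (x n)")
      case True
      then obtain n where "t = fst (x n)" by blast
      then show ?thesis using \<zeta>_x[of n] by blast
    next
      case False
      then show ?thesis unfolding \<zeta>_def by (simp only: if_False) simp
    qed
    have "\<zeta> t \<in> E" for t using \<zeta>_cases[of t] x(3) z by (auto simp: bad_def)
    moreover have "(\<zeta> \<longlongrightarrow> z) at_top"
    proof (rule tendstoI)
      fix \<epsilon> :: real assume "\<epsilon> > 0"
      then obtain m where m: "1 / real (Suc m) < \<epsilon>" using nat_approx_posE by blast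
      show "\<forall>\<^sub>F t in at_top. dist (\<zeta> t) z < \<epsilon>"
        using eventually_gt_at_top[of "fst (x m)"]
      proof eventually_elim
        case (elim t)
        show ?case
        proof (cases "\<zeta> t = z")
          case False
          then obtain n where n: "t = fst (x n)" "\<zeta> t = snd (x n)" using \<zeta>_cases by blast
          then have "m < n" using elim strict_mono_less[OF mono, of m n] by simp
          then have "1 / real (Suc n) \<le> 1 / real (Suc m)" by (intro divide_left_mono) auto
          then show ?thesis using x(2)[of n] n m by simp
        qed (use \<open>\<epsilon> > 0\<close> in simp)
      qed
    qed
    ultimately have "((\<lambda>t::real. L j (t *\<^sub>R \<zeta> t) / t) \<longlongrightarrow> Lstar j z) at_top"
      using hom j z unfolding asymp_homogeneous_def by blast
    then have "\<forall>\<^sub>F t in at_top. dist (L j (t *\<^sub>R \<zeta> t) / t) (Lstar j z) < e"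
      using e by (rule tendstoD)
    then obtain T where T: "\<And>t. t \<ge> T \<Longrightarrow> dist (L j (t *\<^sub>R \<zeta> t) / t) (Lstar j z) < e"
      unfolding eventually_at_top_linorder by blast
    obtain n where "real n \<ge> T" using real_arch_simple by blast
    then have "dist (L j (fst (x n) *\<^sub>R snd (x n)) / fst (x n)) (Lstar j z) < e"
      using T[of "fst (x n)"] x(1)[of n] \<zeta>_x[of n] by simp
    then show False using x(3)[of n] by (simp add: bad_def dist_real_def)
  qed
  then show ?thesis using that by blast
qed

lemma asymp_homogeneous_tendsto:
  fixes L :: "nat \<Rightarrow> 'a::euclidean_space \<Rightarrow> real"
  assumes hom: "asymp_homogeneous E K L Lstar" and j: "j \<in> {1..K}" and w: "w \<in> E"
  shows "((\<lambda>t::real. L j (t *\<^sub>R w) / t) \<longlongrightarrow> Lstar j w) at_top"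
proof -
  have "\<forall>\<zeta>. (\<forall>t. \<zeta> t \<in> E) \<and> (\<zeta> \<longlongrightarrow> w) at_top \<longrightarrow>
      ((\<lambda>t::real. L j (t *\<^sub>R \<zeta> t) / t) \<longlongrightarrow> Lstar j w) at_top"
    using hom j w unfolding asymp_homogeneous_def by blast
  from spec[OF this, of "\<lambda>_. w"] show ?thesis using w by simp
qed

text \<open>Substituting \<open>c * t\<close> for \<open>t\<close> in the limit along the constant
  path at \<open>z\<close> produces, up to the factor \<open>c\<close>, the limit along the constant
  path at \<open>c *\<^sub>R z\<close>.\<close>

lemma asymp_homogeneous_scale:
  assumes hom: "asymp_homogeneous E K L Lstar" and j: "j \<in> {1..K}" and E: "cone E" and z: "z \<in> E" and c: "c > 0"
  shows "Lstar j (c *\<^sub>R z) = c * Lstar j z"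
proof -
  have cz: "c *\<^sub>R z \<in> E" using E z c by (auto simp: cone_def)
  have lim: "((\<lambda>t::real. L j (t *\<^sub>R w) / t) \<longlongrightarrow> Lstar j w) at_top" if "w \<in> E" for w
    by (rule asymp_homogeneous_tendsto[OF hom j that])
  have "filterlim (\<lambda>t::real. c * t) at_top at_top"
    by (rule filterlim_tendsto_pos_mult_at_top[OF tendsto_const c filterlim_ident])
  then have "((\<lambda>t. c * (L j ((c * t) *\<^sub>R z) / (c * t))) \<longlongrightarrow> c * Lstar j z) at_top"
    by (intro tendsto_intros filterlim_compose[OF lim[OF z]])
  then have "((\<lambda>t. L j (t *\<^sub>R (c *\<^sub>R z)) / t) \<longlongrightarrow> c * Lstar j z) at_top"
    using c by (simp add: mult.commute)
  then show ?thesis using tendsto_unique[OF _ lim[OF cz]] by simp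
qed

text \<open>Homogeneity at 0 gives \<open>Lstar j 0 = 2 * Lstar j 0\<close>. Small losses near the
  origin are what keeps stress regions away from it.\<close>

lemma asymp_homogeneous_zero:
  assumes hom: "asymp_homogeneous E K L Lstar" and j: "j \<in> {1..K}" and E: "cone E"
  shows "0 \<in> E" "Lstar j 0 = 0"
proof -
  obtain z where "z \<in> E" using hom j unfolding asymp_homogeneous_def by blast
  then show 0: "0 \<in> E" using E by (metis cone_def order_refl scaleR_zero_left)
  from asymp_homogeneous_scale[OF hom j E 0, of 2] show "Lstar j 0 = 0" by simp
qed

lemma borel_joint_exceedance:
  fixes L :: "nat \<Rightarrow> 'a::euclidean_space \<Rightarrow> real"
  assumes hom: "asymp_homogeneous E K L Lstar" and E: "E \<in> sets borel" and J: "J \<subseteq> {1..K}"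
  shows "joint_exceedance E L J u \<in> sets borel"
proof -
  have "{z \<in> E. L j z \<ge> u} \<in> sets borel" if "j \<in> J" for j
  proof -
    have "L j \<in> borel_measurable (restrict_space borel E)"
      using hom J that unfolding asymp_homogeneous_def by auto
    then have "{z \<in> space (restrict_space borel E). L j z \<ge> u} \<in> sets (restrict_space borel E)"
      by measurable
    then show ?thesis using E by (simp add: sets_restrict_space_iff space_restrict_space)
  qed
  moreover have "finite J" using J finite_subset by blast
  moreover have "joint_exceedance E L J u = E \<inter> (\<Inter>j\<in>J. {z \<in> E. L j z \<ge> u})" if "J \<noteq> {}"
    using that by (auto simp: joint_exceedance_def)
  moreover have "joint_exceedance E L {} u = E" by (simp add: joint_exceedance_def)
  ultimately show ?thesis using E by (cases "J = {}") (auto intro!: sets.Int sets.finite_INT)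
qed

text \<open>One loss of the system suffices: its limit at the origin is 0, so on a ball around 0 the
  rescaled loss is below 1, uniformly in high levels.\<close>

lemma joint_exceedance_away_from_0:
  fixes L :: "nat \<Rightarrow> 'a::euclidean_space \<Rightarrow> real"
  assumes hom: "asymp_homogeneous E K L Lstar" and E: "cone E" and J: "J \<subseteq> {1..K}" "J \<noteq> {}"
  obtains \<delta> T where "\<delta> > 0" "T > 0"
    "\<And>u. u \<ge> T \<Longrightarrow> joint_exceedance E L J u \<subseteq> {z. norm z > \<delta> * u}"
proof -
  obtain j where j: "j \<in> J" "j \<in> {1..K}" using J by blast
  note zero = asymp_homogeneous_zero[OF hom j(2) E]
  obtain \<delta> T where \<delta>: "\<delta> > 0" and T:
    "\<And>t w. t \<ge> T \<Longrightarrow> w \<in> E \<Longrightarrow> dist w 0 < \<delta> \<Longrightarrow> \<bar>L j (t *\<^sub>R w) / t - Lstar j 0\<bar> < 1"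
    using asymp_homogeneous_locally_uniform[OF hom j(2) zero(1), of 1] by auto
  show ?thesis
  \<comment> \<open>Halving turns the negated strict inequality into a distance strictly below
    \<open>\<delta>\<close>; the maximum with 1 makes \<open>u\<close> positive.\<close>
  proof (rule that[of "\<delta> / 2" "max T 1"])
    fix u assume u: "u \<ge> max T 1"
    show "joint_exceedance E L J u \<subseteq> {z. norm z > \<delta> / 2 * u}"
    proof (clarify, rule ccontr)
      fix z assume z: "z \<in> joint_exceedance E L J u" and "\<not> norm z > \<delta> / 2 * u"
      then have "norm z / u \<le> \<delta> / 2" using u by (simp add: divide_le_eq)
      moreover have "norm ((1 / u) *\<^sub>R z) = norm z / u" using u by simp
      ultimately have "dist ((1 / u) *\<^sub>R z) 0 < \<delta>" using \<delta> unfolding dist_norm diff_zero by linarith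
      moreover have "(1 / u) *\<^sub>R z \<in> E" using E z u by (auto simp: cone_def joint_exceedance_def)
      ultimately have "\<bar>L j (u *\<^sub>R (1 / u) *\<^sub>R z) / u\<bar> < 1" using T[of u "(1 / u) *\<^sub>R z"] u zero by simp
      then have "L j z < u" using u by (simp add: abs_less_iff divide_less_eq)
      then show False using z j by (auto simp: joint_exceedance_def)
    qed
  qed (use \<delta> in auto)
qed

text \<open>
  By homogeneity the limiting region can be enlarged until it avoids the unit ball and all limit
  losses exceed 1 with a margin; one of countably many balls on which the convergence is uniform
  then carries positive volume.
\<close>

lemma joint_exceedance_contains_scaled_ball:
  fixes L :: "nat \<Rightarrow> 'a::euclidean_space \<Rightarrow> real"
  assumes hom: "asymp_homogeneous E K L Lstar" and E: "cone E" "closed E" and J: "J \<subseteq> {1..K}" "J \<noteq> {}"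
    and reg: "emeasure lebesgue (joint_exceedance E Lstar J 1) \<noteq> 0"
  obtains B T where "B \<in> sets borel" "B \<subseteq> E \<inter> {z. norm z > 1}" "emeasure lborel B > 0" "T > 0"
    "\<And>u. u \<ge> T \<Longrightarrow> {z. z /\<^sub>R u \<in> B} \<subseteq> joint_exceedance E L J u"
proof -
  let ?S = "joint_exceedance E Lstar J 1"
  have [simp]: "finite J" using J finite_subset by blast
  obtain j where j: "j \<in> J" "j \<in> {1..K}" using J by blast
  note zero = asymp_homogeneous_zero[OF hom j(2) E(1)]
  obtain \<delta> T where \<delta>: "\<delta> > 0" and T:
    "\<And>t w. t \<ge> T \<Longrightarrow> w \<in> E \<Longrightarrow> dist w 0 < \<delta> \<Longrightarrow> \<bar>L j (t *\<^sub>R w) / t - Lstar j 0\<bar> < 1 / 2"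
    using asymp_homogeneous_locally_uniform[OF hom j(2) zero(1), of "1/2"] by auto
  \<comment> \<open>Near the origin the rescaled losses are below 1/2, hence the limit loss is at
    most 1/2 there and cannot reach 1.\<close>
  have lower: "norm w \<ge> \<delta>" if w: "w \<in> ?S" for w
  proof (rule ccontr)
    assume "\<not> norm w \<ge> \<delta>"
    then have "\<bar>L j (t *\<^sub>R w) / t - 0\<bar> < 1 / 2" if "t \<ge> T" for t
      using T[OF that, of w] w unfolding zero(2) by (auto simp: joint_exceedance_def)
    then have "L j (t *\<^sub>R w) / t \<le> 1 / 2" if "t \<ge> T" for t
      using that unfolding diff_zero abs_less_iff by (meson less_imp_le)
    then have "\<forall>\<^sub>F t in at_top. L j (t *\<^sub>R w) / t \<le> 1 / 2"
      unfolding eventually_at_top_linorder by blast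
    moreover have "((\<lambda>t::real. L j (t *\<^sub>R w) / t) \<longlongrightarrow> Lstar j w) at_top"
      using w by (intro asymp_homogeneous_tendsto[OF hom j(2)]) (simp add: joint_exceedance_def)
    ultimately have "Lstar j w \<le> 1 / 2" by (intro tendsto_upperbound[of _ _ at_top]) auto
    then show False using w j by (auto simp: joint_exceedance_def)
  qed
  \<comment> \<open>The bound 2 gives the limit losses their margin over 1, and
    \<open>2 / \<delta>\<close> pushes the region out of the unit ball.\<close>
  define c where "c = max 2 (2 / \<delta>)"
  have c: "c \<ge> 2" "c * \<delta> \<ge> 2" using \<delta> by (auto simp: c_def max_def field_simps)
  define S' where "S' = (\<lambda>z. c *\<^sub>R z + 0) ` ?S"
  have S'_E: "w \<in> E" if "w \<in> S'" for w
    using that E(1) c by (auto simp: S'_def cone_def joint_exceedance_def)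
  have S'_norm: "norm w > 1" if w: "w \<in> S'" for w
  proof -
    obtain z where z: "z \<in> ?S" "w = c *\<^sub>R z" using w by (auto simp: S'_def)
    have "c * \<delta> \<le> c * norm z" using lower[OF z(1)] c by (intro mult_left_mono) auto
    then have "c * norm z > 1" using c by linarith
    then show ?thesis using z c by simp
  qed
  have S'_L: "Lstar i w > 1" if w: "w \<in> S'" and i: "i \<in> J" for w i
  proof -
    obtain z where z: "z \<in> ?S" "w = c *\<^sub>R z" using w by (auto simp: S'_def)
    have "Lstar i w = c * Lstar i z"
      using asymp_homogeneous_scale[OF hom _ E(1), of i z c] z c J i by (auto simp: joint_exceedance_def)
    moreover have "Lstar i z \<ge> 1" using z i by (auto simp: joint_exceedance_def)
    then have "c * 1 \<le> c * Lstar i z" using c by (intro mult_left_mono) auto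
    ultimately show ?thesis using c by linarith
  qed
  have S'_pos: "emeasure lebesgue S' \<noteq> 0"
    unfolding S'_def emeasure_lebesgue_affine using reg c by simp
  \<comment> \<open>\<open>p\<close> pairs the radius of a ball around \<open>w\<close> with a level
    from which on the losses of \<open>J\<close> exceed the level throughout that ball.\<close>
  define good where "good = (\<lambda>w p. fst p > 0 \<and>
    (\<forall>t z. t \<ge> snd p \<longrightarrow> z \<in> E \<longrightarrow> dist z w < fst p \<longrightarrow> (\<forall>i\<in>J. L i (t *\<^sub>R z) / t > 1)))"
  have "\<exists>p. good w p" if w: "w \<in> S'" for w
  proof -
    have "\<exists>p. fst p > 0 \<and> (\<forall>t z. t \<ge> snd p \<longrightarrow> z \<in> E \<longrightarrow> dist z w < fst p \<longrightarrow> L i (t *\<^sub>R z) / t > 1)" if "i \<in> J" for i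
    proof -
      have "Lstar i w - 1 > 0" using S'_L[OF w that] by simp
      moreover have "i \<in> {1..K}" using J that by blast
      ultimately obtain r T where "r > 0" and rT: "\<And>t z. t \<ge> T \<Longrightarrow> z \<in> E \<Longrightarrow> dist z w < r \<Longrightarrow>
          \<bar>L i (t *\<^sub>R z) / t - Lstar i w\<bar> < Lstar i w - 1"
        using asymp_homogeneous_locally_uniform[OF hom _ S'_E[OF w], of i "Lstar i w - 1"] by blast
      have "L i (t *\<^sub>R z) / t > 1" if "t \<ge> T" "z \<in> E" "dist z w < r" for t z
        using rT[OF that] unfolding abs_less_iff by linarith
      then show ?thesis using \<open>r > 0\<close> by (intro exI[of _ "(r, T)"]) simp
    qed
    then have "\<forall>i\<in>J. \<exists>p. fst p > 0 \<and> (\<forall>t z. t \<ge> snd p \<longrightarrow> z \<in> E \<longrightarrow> dist z w < fst p \<longrightarrow> L i (t *\<^sub>R z) / t > 1)"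
      by blast
    from bchoice[OF this] obtain p where
      p: "\<And>i. i \<in> J \<Longrightarrow> fst (p i) > 0 \<and> (\<forall>t z. t \<ge> snd (p i) \<longrightarrow> z \<in> E \<longrightarrow> dist z w < fst (p i) \<longrightarrow> L i (t *\<^sub>R z) / t > 1)"
      by blast
    define r T where "r i = fst (p i)" and "T i = snd (p i)" for i
    have rT: "\<And>i. i \<in> J \<Longrightarrow> r i > 0" "\<And>i t z. i \<in> J \<Longrightarrow> t \<ge> T i \<Longrightarrow> z \<in> E \<Longrightarrow> dist z w < r i \<Longrightarrow>
        L i (t *\<^sub>R z) / t > 1"
      using p by (simp_all add: r_def T_def)
    have "Min (r ` J) > 0" using rT(1) J by (subst Min_gr_iff) auto
    moreover have "L i (t *\<^sub>R z) / t > 1" if "t \<ge> Max (T ` J)" "z \<in> E" "dist z w < Min (r ` J)" "i \<in> J" for t z i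
      using that J by (intro rT(2)) auto
    ultimately show ?thesis
      by (intro exI[of _ "(Min (r ` J), Max (T ` J))"]) (simp only: good_def fst_conv snd_conv, blast)
  qed
  then have "\<forall>w\<in>S'. \<exists>p. good w p" by blast
  from bchoice[OF this] obtain p where p: "\<And>w. w \<in> S' \<Longrightarrow> good w (p w)" by blast
  define r T where "r w = fst (p w)" and "T w = snd (p w)" for w
  have r: "\<And>w. w \<in> S' \<Longrightarrow> r w > 0" and rT: "\<And>w t z i. w \<in> S' \<Longrightarrow> t \<ge> T w \<Longrightarrow> z \<in> E \<Longrightarrow>
      dist z w < r w \<Longrightarrow> i \<in> J \<Longrightarrow> L i (t *\<^sub>R z) / t > 1"
    using p by (simp_all add: r_def T_def good_def)
  define B where "B w = E \<inter> {z. norm z > 1} \<inter> ball w (r w)" for w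
  have B [measurable]: "B w \<in> sets borel" for w
    unfolding B_def using E(2) by (intro sets.Int borel_closed borel_open) (auto intro: open_Collect_less continuous_intros)
  have "\<exists>w\<in>S'. emeasure lborel (B w) > 0"
  proof (rule ccontr)
    assume "\<not> ?thesis"
    then have null: "emeasure lborel (B w) = 0" if "w \<in> S'" for w
      using that by (simp add: not_gr_zero)
    \<comment> \<open>The radii vary with the point, so a countable subcover is extracted. If all
      its balls were null within \<open>E\<close>, then \<open>S'\<close> would lie in a null set,
      against regularity.\<close>
    obtain F where F: "F \<subseteq> (\<lambda>w. ball w (r w)) ` S'" "countable F" "\<Union>F = \<Union>((\<lambda>w. ball w (r w)) ` S')"
      by (rule Lindelof[of "(\<lambda>w. ball w (r w)) ` S'"]) auto
    define N where "N = (\<Union>U\<in>F. E \<inter> {z. norm z > 1} \<inter> U)"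
    have "N \<in> null_sets lborel"
      unfolding N_def
    proof (rule null_sets_UN'[OF F(2)])
      fix U assume "U \<in> F"
      then obtain w where "w \<in> S'" "U = ball w (r w)" using F(1) by blast
      then show "E \<inter> {z. norm z > 1} \<inter> U \<in> null_sets lborel"
        using null[of w] B[of w] by (auto simp: null_sets_def B_def)
    qed
    then have "N \<in> null_sets lebesgue" by (rule null_sets_completionI)
    moreover have "S' \<subseteq> N"
    proof
      fix w assume w: "w \<in> S'"
      then have "w \<in> \<Union>F" unfolding F(3) using r[OF w] w by (auto intro!: bexI[of _ w])
      then show "w \<in> N" using S'_E[OF w] S'_norm[OF w] by (auto simp: N_def)
    qed
    ultimately have "emeasure lebesgue S' \<le> 0"
      using emeasure_mono[of S' N lebesgue] by (simp add: null_sets_def)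
    then show False using S'_pos by simp
  qed
  then obtain w where w: "w \<in> S'" "emeasure lborel (B w) > 0" by blast
  show ?thesis
  proof (rule that[of "B w" "max (T w) 1"])
    show "B w \<subseteq> E \<inter> {z. norm z > 1}" by (auto simp: B_def)
    fix u assume u: "u \<ge> max (T w) 1"
    show "{z. z /\<^sub>R u \<in> B w} \<subseteq> joint_exceedance E L J u"
    proof clarify
      fix z assume z: "z /\<^sub>R u \<in> B w"
      then have "z /\<^sub>R u \<in> E" by (simp add: B_def)
      from mem_cone[OF E(1) this, of u] have "u *\<^sub>R (z /\<^sub>R u) \<in> E" using u by simp
      then have zE: "z \<in> E" using u by simp
      have "L i (u *\<^sub>R (z /\<^sub>R u)) / u > 1" if "i \<in> J" for i
        using z u that by (intro rT[OF w(1)]) (auto simp: B_def dist_commute)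
      then have "L i z > u" if "i \<in> J" for i using u that by (simp add: less_divide_eq)
      then show "z \<in> joint_exceedance E L J u" using zE by (force simp: joint_exceedance_def)
    qed
  qed (use w in auto)
qed

context second_order_tail begin

text \<open>The set \<open>B\<close> has positive volume and lies in the cone beyond the unit ball,
  where \<open>\<kappa>\<close> has a positive density. Dilation by \<open>u\<close> multiplies its
  \<open>\<kappa>\<close>-mass by \<open>u powr (-s)\<close>, and far out \<open>P\<close> dominates
  a multiple of \<open>\<kappa>\<close>.\<close>

lemma measure_joint_exceedance_ge:
  fixes L :: "nat \<Rightarrow> 'a \<Rightarrow> real"
  assumes hom: "asymp_homogeneous E K L Lstar" and J: "J \<subseteq> {1..K}" "J \<noteq> {}"
    and reg: "emeasure lebesgue (joint_exceedance E Lstar J 1) \<noteq> 0"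
  obtains c T where "c > 0" "T > 0" "\<And>u. u \<ge> T \<Longrightarrow> c * u powr (-s) \<le> measure P (joint_exceedance E L J u)"
proof -
  obtain B T where B: "B \<in> sets borel" "B \<subseteq> E \<inter> {z. norm z > 1}" "emeasure lborel B > 0" and T: "T > 0"
    "\<And>u. u \<ge> T \<Longrightarrow> {z. z /\<^sub>R u \<in> B} \<subseteq> joint_exceedance E L J u"
    by (rule joint_exceedance_contains_scaled_ball[OF hom cone_E closed_E J reg], rule that)
  obtain c T' where c: "c > 0" "T' \<ge> 1" and
    le: "\<And>B. B \<in> sets borel \<Longrightarrow> B \<subseteq> {z. norm z > T'} \<Longrightarrow> ennreal c * emeasure \<kappa> B \<le> emeasure P B"
    by (rule P_ge_\<kappa>, rule that)
  have "measure \<kappa> B > 0"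
  proof (rule ccontr)
    assume "\<not> measure \<kappa> B > 0"
    then have "emeasure \<kappa> B = 0" using \<kappa>.emeasure_eq_measure[of B] measure_nonneg[of \<kappa> B] by simp
    then have "(\<integral>\<^sup>+z. ennreal (norm z powr (-(s + real DIM('a))) * indicator (angles E) (sgn z)) * indicator B z \<partial>lborel) = 0"
      using emeasure_\<kappa>[OF B(1)] B(2) by simp
    then have "AE z in lborel. ennreal (norm z powr (-(s + real DIM('a))) * indicator (angles E) (sgn z)) * indicator B z = 0"
      using B(1) by (subst (asm) nn_integral_0_iff_AE) auto
    then have "AE z in lborel. z \<notin> B"
    proof eventually_elim
      case (elim z)
      show ?case
      proof
        assume z: "z \<in> B"
        then have "sgn z \<in> angles E" "norm z > 1" using B(2) by (auto simp: sgn_in_angles_iff)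
        then have "norm z powr (-(s + real DIM('a))) * indicator (angles E) (sgn z) > 0" by auto
        then have "ennreal (norm z powr (-(s + real DIM('a))) * indicator (angles E) (sgn z)) > 0"
          by (simp only: ennreal_less_zero_iff)
        moreover have "ennreal (norm z powr (-(s + real DIM('a))) * indicator (angles E) (sgn z)) = 0"
          using elim unfolding indicator_simps(1)[OF z] mult_1_right .
        ultimately show False by (metis less_irrefl)
      qed
    qed
    then have "emeasure lborel B = 0" using B(1) by (subst (asm) AE_iff_measurable[of B]) auto
    then show False using B(3) by simp
  qed
  show ?thesis
  proof (rule that[of "c * measure \<kappa> B" "max T T'"])
    show "c * measure \<kappa> B > 0" using c \<open>measure \<kappa> B > 0\<close> by simp
    show "max T T' > 0" using T by simp
    fix u assume u: "u \<ge> max T T'"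
    have u1: "u \<ge> 1" using u c by simp
    have "(\<lambda>z::'a. z /\<^sub>R u) \<in> borel \<rightarrow>\<^sub>M borel" by measurable
    from measurable_sets[OF this B(1)] have pre: "{z. z /\<^sub>R u \<in> B} \<in> sets borel"
      by (simp add: vimage_def)
    have sub: "{z. z /\<^sub>R u \<in> B} \<subseteq> {z. norm z > T'}"
    proof clarify
      fix z assume "z /\<^sub>R u \<in> B"
      then have "norm (z /\<^sub>R u) > 1" using B(2) by auto
      then have "norm z > u" using u1 by (simp add: field_simps)
      then show "norm z > T'" using u by simp
    qed
    have "emeasure \<kappa> {z. z /\<^sub>R u \<in> B} = ennreal (u powr (-s)) * emeasure \<kappa> B"
      unfolding \<kappa>_def using B u1 by (intro emeasure_homogeneous_measure_scale) auto
    then have \<kappa>: "measure \<kappa> {z. z /\<^sub>R u \<in> B} = u powr (-s) * measure \<kappa> B"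
      by (simp add: measure_def enn2real_mult)
    have "c * measure \<kappa> {z. z /\<^sub>R u \<in> B} \<le> measure P {z. z /\<^sub>R u \<in> B}"
      using le[OF pre sub] c by (simp add: P.emeasure_eq_measure \<kappa>.emeasure_eq_measure ennreal_mult[symmetric])
    also have "\<dots> \<le> measure P (joint_exceedance E L J u)"
      using T(2)[of u] u borel_joint_exceedance[OF hom borel_angles_E(2) J(1)]
      by (intro P.finite_measure_mono) auto
    finally show "c * measure \<kappa> B * u powr (-s) \<le> measure P (joint_exceedance E L J u)"
      by (simp add: \<kappa> mult_ac)
  qed
qed

end

section \<open>Thresholds and quantiles\<close>

lemma card_nth_eq_of_mset_eq:
  assumes "mset xs = mset ys"
  shows "card {i. i < length xs \<and> Q (xs ! i)} = card {i. i < length ys \<and> Q (ys ! i)}"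
proof -
  have "size (filter_mset Q (mset xs)) = size (filter_mset Q (mset ys))" using assms by simp
  then show ?thesis by (simp add: length_filter_conv_card[symmetric] mset_filter[symmetric] del: mset_filter)
qed

text \<open>In descending order the statistic sits at index \<open>k - 1\<close>. If it exceeds
  \<open>y\<close>, so do all \<open>k\<close> entries up to it; if it is below \<open>y\<close>, so
  are all entries from it on. Strict inequalities make ties harmless.\<close>

lemma kth_largest_norm_count:
  assumes k: "1 \<le> k" "k \<le> n"
  shows less_kth_largest_norm_imp: "y < kth_largest_norm X n k \<omega> \<Longrightarrow> k \<le> card {i. i < n \<and> norm (X i \<omega>) > y}"
    and kth_largest_norm_less_imp: "kth_largest_norm X n k \<omega> < y \<Longrightarrow> card {i. i < n \<and> norm (X i \<omega>) > y} < k"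
proof -
  define xs where "xs = map (\<lambda>i. norm (X i \<omega>)) [0..<n]"
  define ys where "ys = rev (sort xs)"
  have len: "length ys = n" by (simp add: ys_def xs_def)
  have desc: "ys ! j \<le> ys ! i" if "i \<le> j" "j < n" for i j
    using that by (intro sorted_rev_nth_mono) (auto simp: ys_def xs_def)
  have thr: "kth_largest_norm X n k \<omega> = ys ! (k - 1)"
    by (simp add: kth_largest_norm_def ys_def xs_def)
  have "card {i. i < length xs \<and> xs ! i > y} = card {i. i < length ys \<and> ys ! i > y}" for y
    by (rule card_nth_eq_of_mset_eq) (simp add: ys_def)
  moreover have "{i. i < length xs \<and> xs ! i > y} = {i. i < n \<and> norm (X i \<omega>) > y}" for y
    by (auto simp: xs_def)
  ultimately have count: "card {i. i < n \<and> norm (X i \<omega>) > y} = card {i. i < n \<and> ys ! i > y}" for y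
    by (simp add: len)
  show "k \<le> card {i. i < n \<and> norm (X i \<omega>) > y}" if "y < kth_largest_norm X n k \<omega>"
  proof -
    have "{..<k} \<subseteq> {i. i < n \<and> ys ! i > y}"
    proof
      fix i assume "i \<in> {..<k}"
      then have i: "i \<le> k - 1" "k - 1 < n" "i < n" using k by auto
      then show "i \<in> {i. i < n \<and> ys ! i > y}"
        using that desc[OF i(1,2)] unfolding thr by simp
    qed
    then have "card {..<k} \<le> card {i. i < n \<and> ys ! i > y}" by (intro card_mono) auto
    then show ?thesis by (simp add: count)
  qed
  show "card {i. i < n \<and> norm (X i \<omega>) > y} < k" if "kth_largest_norm X n k \<omega> < y"
  proof -
    \<comment> \<open>The entry at \<open>k - 1\<close> itself is excluded, which leaves at most
      \<open>k - 1\<close> indices and gives the strict bound.\<close>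
    have "{i. i < n \<and> ys ! i > y} \<subseteq> {..<k - 1}"
    proof
      fix i assume i: "i \<in> {i. i < n \<and> ys ! i > y}"
      show "i \<in> {..<k - 1}"
      proof (rule ccontr)
        assume "i \<notin> {..<k - 1}"
        then show False using that thr desc[of "k - 1" i] i by auto
      qed
    qed
    then have "card {i. i < n \<and> ys ! i > y} \<le> k - 1" using card_mono[of "{..<k - 1}"] by simp
    then show ?thesis using k by (simp add: count)
  qed
qed

context prob_space begin

text \<open>Markov's inequality for the count, whose expectation is at most
  \<open>n * p\<close>.\<close>

lemma prob_count_ge:
  fixes X :: "nat \<Rightarrow> 'a \<Rightarrow> 'b"
  assumes X [measurable]: "\<And>i. X i \<in> M \<rightarrow>\<^sub>M N" and B [measurable]: "B \<in> sets N"
    and p: "\<And>i. prob {\<omega> \<in> space M. X i \<omega> \<in> B} \<le> p" and k: "k > 0"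
  shows "prob {\<omega> \<in> space M. k \<le> card {i. i < n \<and> X i \<omega> \<in> B}} \<le> real n * p / real k"
proof -
  define Y where "Y i = indicat_real {\<omega> \<in> space M. X i \<omega> \<in> B}" for i
  have count: "real (card {i. i < n \<and> X i \<omega> \<in> B}) = (\<Sum>i<n. Y i \<omega>)" if "\<omega> \<in> space M" for \<omega>
  proof -
    have "(\<Sum>i<n. Y i \<omega>) = (\<Sum>i<n. if X i \<omega> \<in> B then 1 else 0)"
      using that by (intro sum.cong) (auto simp: Y_def indicator_def)
    also have "\<dots> = real (card {i \<in> {..<n}. X i \<omega> \<in> B})"
      by (simp add: sum.If_cases Int_def)
    finally show ?thesis by simp
  qed
  have int: "integrable M (Y i)" for i
    unfolding Y_def by (intro integrable_real_indicator) (auto simp: less_top[symmetric])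
  have "{\<omega> \<in> space M. k \<le> card {i. i < n \<and> X i \<omega> \<in> B}} = {\<omega> \<in> space M. (\<Sum>i<n. Y i \<omega>) \<ge> real k}"
    by (auto simp: count[symmetric])
  also have "prob \<dots> \<le> expectation (\<lambda>\<omega>. \<Sum>i<n. Y i \<omega>) / real k"
    using k int by (intro integral_Markov_inequality_measure[where A = "space M"])
      (auto intro!: sum_nonneg AE_I2 simp: Y_def)
  also have "expectation (\<lambda>\<omega>. \<Sum>i<n. Y i \<omega>) = (\<Sum>i<n. prob {\<omega> \<in> space M. X i \<omega> \<in> B})"
    using int by (subst Bochner_Integration.integral_sum) (auto simp: Y_def)
  also have "(\<Sum>i<n. prob {\<omega> \<in> space M. X i \<omega> \<in> B}) \<le> (\<Sum>i<n. p)"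
    by (intro sum_mono p)
  finally show ?thesis by (simp add: divide_right_mono)
qed

text \<open>Markov's inequality for \<open>2\<^sup>-\<^sup>N\<close>, where \<open>N\<close> is the count.\<close>

lemma prob_count_less:
  fixes X :: "nat \<Rightarrow> 'a \<Rightarrow> 'b"
  assumes indep: "indep_vars (\<lambda>_. N) X UNIV" and B [measurable]: "B \<in> sets N"
    and p: "\<And>i. prob {\<omega> \<in> space M. X i \<omega> \<in> B} = p"
  shows "prob {\<omega> \<in> space M. card {i. i < n \<and> X i \<omega> \<in> B} < k} \<le> 2 ^ k * exp (- (real n * p / 2))"
proof -
  have X [measurable]: "X i \<in> M \<rightarrow>\<^sub>M N" for i using indep by (auto simp: indep_vars_def)
  \<comment> \<open>The product of the \<open>g (X i \<omega>)\<close> is 1/2 to the power of the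
    count, and by independence its expectation factorises.\<close>
  define g where "g x = (if x \<in> B then 1 / 2 else 1 :: real)" for x
  have g [measurable]: "g \<in> borel_measurable N" unfolding g_def by measurable
  have "indep_vars (\<lambda>_. borel) (\<lambda>i \<omega>. g (X i \<omega>)) UNIV"
    by (rule indep_vars_compose2[OF indep]) simp
  then have indep': "indep_vars (\<lambda>_. borel) (\<lambda>i \<omega>. g (X i \<omega>)) {..<n}"
    by (rule indep_vars_subset) auto
  have int: "integrable M (\<lambda>\<omega>. g (X i \<omega>))" for i
    by (rule integrable_const_bound[where B = 1]) (auto simp: g_def)
  note product = indep_vars_lebesgue_integral[OF _ indep' int] indep_vars_integrable[OF _ indep' int]
  have prod_eq: "(\<Prod>i<n. g (X i \<omega>)) = (1 / 2) ^ card {i. i < n \<and> X i \<omega> \<in> B}" for \<omega>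
  proof -
    have "(\<Prod>i<n. g (X i \<omega>)) = (1 / 2) ^ card {i \<in> {..<n}. X i \<omega> \<in> B}"
      unfolding g_def by (subst prod.If_cases) (auto simp: Int_def)
    then show ?thesis by simp
  qed
  have Eg: "expectation (\<lambda>\<omega>. g (X i \<omega>)) = 1 - p / 2" for i
  proof -
    have "expectation (\<lambda>\<omega>. g (X i \<omega>)) = expectation (\<lambda>\<omega>. 1 - 1 / 2 * indicator {\<omega> \<in> space M. X i \<omega> \<in> B} \<omega>)"
      by (intro Bochner_Integration.integral_cong) (auto simp: g_def indicator_def)
    also have "\<dots> = 1 - p / 2"
      using p[of i]
      by (subst Bochner_Integration.integral_diff) (auto simp: prob_space less_top[symmetric] intro!: integrable_real_indicator)
    finally show ?thesis .
  qed
  have p1: "0 \<le> p" "p \<le> 1" using p[of 0] by auto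
  have "prob {\<omega> \<in> space M. card {i. i < n \<and> X i \<omega> \<in> B} < k} \<le>
      prob {\<omega> \<in> space M. (\<Prod>i<n. g (X i \<omega>)) \<ge> (1 / 2) ^ k}"
    by (intro finite_measure_mono) (auto simp: prod_eq intro!: power_decreasing)
  also have "\<dots> \<le> expectation (\<lambda>\<omega>. \<Prod>i<n. g (X i \<omega>)) / (1 / 2) ^ k"
    using product(2) by (intro integral_Markov_inequality_measure[where A = "space M"])
      (auto simp: prod_eq)
  also have "expectation (\<lambda>\<omega>. \<Prod>i<n. g (X i \<omega>)) = (1 - p / 2) ^ n"
    by (subst product(1)) (auto simp: Eg)
  also have "(1 - p / 2) ^ n \<le> exp (- (p / 2)) ^ n"
    using exp_ge_add_one_self[of "- (p / 2)"] p1 by (intro power_mono) auto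
  also have "exp (- (p / 2)) ^ n = exp (- (real n * p / 2))"
    by (simp add: exp_of_nat_mult[symmetric])
  finally show ?thesis by (simp add: divide_right_mono power_divide mult.commute)
qed

end

section \<open>Growth of the tail count, the threshold and the extreme level\<close>

lemma tail_count_bounds:
  assumes q: "0 < q" "q < 1" and n: "n \<ge> 1"
  shows "1 \<le> tail_count q n" "tail_count q n \<le> n" "real (tail_count q n) \<le> real n powr (1 - q)"
    "real n powr (1 - q) / 2 \<le> real (tail_count q n)"
proof -
  let ?x = "real n powr (1 - q)"
  have x1: "1 \<le> ?x" using powr_mono[of 0 "1 - q" "real n"] q n by simp
  have xn: "?x \<le> real n" using powr_mono[of "1 - q" 1 "real n"] q n by simp
  have k: "real (tail_count q n) = of_int \<lfloor>?x\<rfloor>" using x1 by (simp add: tail_count_def)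
  then show le: "real (tail_count q n) \<le> ?x" by simp
  then show "tail_count q n \<le> n" using xn by linarith
  have "1 \<le> \<lfloor>?x\<rfloor>" using x1 by (simp add: le_floor_iff)
  then have "1 \<le> real (tail_count q n)" using k by linarith
  then show "1 \<le> tail_count q n" by simp
  \<comment> \<open>Adding \<open>1 \<le> real (tail_count q n)\<close> gives twice the count on the
    right, hence the factor 1/2 in the claim.\<close>
  have "?x < real (tail_count q n) + 1" using k by linarith
  then show "?x / 2 \<le> real (tail_count q n)" using \<open>1 \<le> real (tail_count q n)\<close> by linarith
qed

lemma filterlim_powr_at_top:
  assumes "p > 0"
  shows "filterlim (\<lambda>x::real. x powr p) at_top at_top"
  unfolding filterlim_at_top_gt[where c = 0]
proof (intro allI impI)
  fix Z :: real assume Z: "Z > 0"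
  show "\<forall>\<^sub>F x in at_top. Z \<le> x powr p"
    using eventually_ge_at_top[of "Z powr (1 / p)"]
  proof eventually_elim
    case (elim x)
    have "(Z powr (1 / p)) powr p \<le> x powr p" using elim assms by (intro powr_mono2) auto
    then show ?case using assms Z by (simp add: powr_powr)
  qed
qed

lemma powr_root_ge_eventually:
  assumes "b > 0" "a > 0" "s > 0"
  shows "\<forall>\<^sub>F n in sequentially. T \<le> (b * real n powr a) powr (1 / s)"
proof -
  have "filterlim (\<lambda>n. real n powr a) at_top sequentially"
    by (rule filterlim_compose[OF filterlim_powr_at_top[OF \<open>a > 0\<close>] filterlim_real_sequentially])
  then have "filterlim (\<lambda>n. b * real n powr a) at_top sequentially"
    by (rule filterlim_tendsto_pos_mult_at_top[OF tendsto_const \<open>b > 0\<close>])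
  then have "filterlim (\<lambda>n. (b * real n powr a) powr (1 / s)) at_top sequentially"
    using \<open>s > 0\<close> by (intro filterlim_compose[OF filterlim_powr_at_top]) auto
  then show ?thesis by (simp add: filterlim_at_top)
qed

text \<open>The expected number of norms above \<open>y\<close> is of order
  \<open>n * y powr (-s)\<close>, which matches the tail count for \<open>y\<close> of order
  \<open>n powr (q / s)\<close>. Too many exceedances are ruled out by Markov's inequality; too few
  require a lower-tail estimate, where independence enters.\<close>

lemma threshold_bounds:
  fixes X :: "nat \<Rightarrow> 'w \<Rightarrow> 'a::euclidean_space"
  assumes M: "prob_space M" and indep: "prob_space.indep_vars M (\<lambda>_. borel) X UNIV"
    and law: "\<And>i. distr M borel (X i) = P"
    and q: "0 < q" "q < 1" and s: "s > 0" and c: "c > 0" and C: "C > 0"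
    and tail_ge: "\<And>x. x \<ge> T \<Longrightarrow> c * x powr (-s) \<le> measure P {z. norm z > x}"
    and tail_le: "\<And>x. x \<ge> T \<Longrightarrow> measure P {z. norm z > x} \<le> C * x powr (-s)"
    and \<epsilon>: "\<epsilon> > 0"
  shows "\<exists>b>0. \<exists>\<beta>>0. \<forall>\<^sub>F n in sequentially. \<exists>A\<in>sets M. measure M A \<le> \<epsilon> \<and>
    (\<forall>\<omega>\<in>space M - A. (b * real n powr q) powr (1 / s) \<le> threshold X q n \<omega> \<and>
       threshold X q n \<omega> \<le> (\<beta> * real n powr q) powr (1 / s))"
proof -
  interpret prob_space M by fact
  have X [measurable]: "X i \<in> M \<rightarrow>\<^sub>M borel" for i using indep by (auto simp: indep_vars_def)
  define p where "p y = measure P {z. norm z > y}" for y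
  have prob_X: "prob {\<omega> \<in> space M. X i \<omega> \<in> {z. norm z > y}} = p y" for i y
  proof -
    have "{z::'a. norm z > y} \<in> sets borel" by measurable
    then show ?thesis unfolding p_def law[of i, symmetric]
      by (subst measure_distr) (auto simp: vimage_def Int_def conj_commute)
  qed
  \<comment> \<open>The expected count above the upper level is then at most
    \<open>\<epsilon> / 2\<close> times the tail count, with a factor 2 lost to rounding.\<close>
  define \<beta> where "\<beta> = 4 * C / \<epsilon>"
  \<comment> \<open>The expected count above the lower level is then at least four times the tail
    count \<open>k\<close>, so that \<open>exp (- 2 * k)\<close> outweighs the factor
    \<open>2 ^ k\<close>.\<close>
  define b where "b = c / 4"
  have b: "b > 0" "\<beta> > 0" using c C \<epsilon> by (auto simp: b_def \<beta>_def)
  have inv: "((x * real n powr q) powr (1 / s)) powr (-s) = real n powr (-q) / x" if "x > 0" "n \<ge> 1" for x n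
  proof -
    have pos: "x * real n powr q > 0" using that by simp
    have "((x * real n powr q) powr (1 / s)) powr (-s) = (x * real n powr q) powr (-1)"
      using s by (simp add: powr_powr)
    also have "\<dots> = real n powr (-q) / x"
      using pos that by (simp only: powr_minus powr_one[OF less_imp_le]) (simp add: divide_inverse mult.commute)
    finally show ?thesis .
  qed
  have "filterlim (\<lambda>n. real n powr (1 - q)) at_top sequentially"
    by (rule filterlim_compose[OF filterlim_powr_at_top filterlim_real_sequentially]) (use q in auto)
  \<comment> \<open>The tail count \<open>k\<close> is at least half of the right-hand side, so
    \<open>exp (- k) \<le> \<epsilon> / 2\<close>.\<close>
  then have "\<forall>\<^sub>F n in sequentially. 2 * ln (2 / \<epsilon>) \<le> real n powr (1 - q)"
    by (simp add: filterlim_at_top)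
  then have "\<forall>\<^sub>F n in sequentially. \<exists>A\<in>sets M. measure M A \<le> \<epsilon> \<and>
    (\<forall>\<omega>\<in>space M - A. (b * real n powr q) powr (1 / s) \<le> threshold X q n \<omega> \<and>
       threshold X q n \<omega> \<le> (\<beta> * real n powr q) powr (1 / s))"
    using powr_root_ge_eventually[OF b(1) q(1) s, of T] powr_root_ge_eventually[OF b(2) q(1) s, of T]
      eventually_ge_at_top[of 1]
  proof eventually_elim
    case (elim n)
    let ?k = "tail_count q n"
    note k = tail_count_bounds[OF q elim(4)]
    define yl where "yl = (b * real n powr q) powr (1 / s)"
    define yu where "yu = (\<beta> * real n powr q) powr (1 / s)"
    define Al where "Al = {\<omega> \<in> space M. card {i. i < n \<and> X i \<omega> \<in> {z. norm z > yl}} < ?k}"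
    define Au where "Au = {\<omega> \<in> space M. ?k \<le> card {i. i < n \<and> X i \<omega> \<in> {z. norm z > yu}}}"
    have [measurable]: "Measurable.pred M (\<lambda>\<omega>. X i \<omega> \<in> {z. norm z > y})" for i y
      by measurable
    have meas: "Al \<in> sets M" "Au \<in> sets M"
    proof -
      have "card {i. i < n \<and> X i \<omega> \<in> {z. norm z > y}} = (\<Sum>i<n. if X i \<omega> \<in> {z. norm z > y} then 1 else 0)" for \<omega> y
        by (simp add: sum.If_cases Int_def)
      then show "Al \<in> sets M" "Au \<in> sets M" unfolding Al_def Au_def by simp_all
    qed
    have nq: "real n * real n powr (-q) = real n powr (1 - q)"
      using elim(4) by (simp add: powr_diff powr_minus divide_inverse)
    have "prob Au \<le> real n * (C * yu powr (-s)) / real ?k"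
      unfolding Au_def
    proof (rule prob_count_ge[where N = borel])
      show "prob {\<omega> \<in> space M. X i \<omega> \<in> {z. norm z > yu}} \<le> C * yu powr (-s)" for i
        unfolding prob_X unfolding p_def using elim(3) by (intro tail_le) (simp add: yu_def)
    qed (use k in auto)
    also have "\<dots> = C / \<beta> * (real n powr (1 - q) / real ?k)"
      unfolding yu_def inv[OF b(2) elim(4)] nq[symmetric] by simp
    also have "\<dots> \<le> C / \<beta> * 2"
      using k C b by (intro mult_left_mono) (auto simp: divide_le_eq)
    also have "\<dots> = \<epsilon> / 2" using C \<epsilon> by (simp add: \<beta>_def)
    finally have Au: "prob Au \<le> \<epsilon> / 2" .
    have "4 * real ?k \<le> real n * p yl"
    proof -
      have "4 * real ?k \<le> 4 * real n powr (1 - q)" using k by simp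
      also have "\<dots> = real n * (c * yl powr (-s))"
        unfolding yl_def inv[OF b(1) elim(4)] nq[symmetric] using c by (simp add: b_def)
      also have "\<dots> \<le> real n * p yl"
        unfolding p_def using elim(2) by (intro mult_left_mono tail_ge) (auto simp: yl_def)
      finally show ?thesis .
    qed
    have "prob Al \<le> 2 ^ ?k * exp (- (real n * p yl / 2))"
      unfolding Al_def by (rule prob_count_less[OF indep _ prob_X]) measurable
    also have "\<dots> \<le> exp 1 ^ ?k * exp (- (2 * real ?k))"
      using \<open>4 * real ?k \<le> real n * p yl\<close> exp_ge_add_one_self[of 1]
      by (intro mult_mono power_mono) auto
    also have "\<dots> = exp (- real ?k)"
      by (simp add: exp_of_nat_mult[symmetric] exp_add[symmetric])
    also have "\<dots> \<le> exp (- ln (2 / \<epsilon>))" using elim(1) k by simp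
    also have "\<dots> = \<epsilon> / 2" using \<epsilon> by (simp add: exp_minus)
    finally have Al: "prob Al \<le> \<epsilon> / 2" .
    have "prob (Al \<union> Au) \<le> \<epsilon>"
      using measure_Un_le[OF meas] Al Au by linarith
    moreover have "yl \<le> threshold X q n \<omega> \<and> threshold X q n \<omega> \<le> yu" if "\<omega> \<in> space M - (Al \<union> Au)" for \<omega>
    proof
      show "yl \<le> threshold X q n \<omega>"
      proof (rule ccontr)
        assume "\<not> yl \<le> threshold X q n \<omega>"
        then have "card {i. i < n \<and> norm (X i \<omega>) > yl} < ?k"
          using k by (intro kth_largest_norm_less_imp) (auto simp: threshold_def)
        then show False using that by (auto simp: Al_def)
      qed
      show "threshold X q n \<omega> \<le> yu"
      proof (rule ccontr)
        assume "\<not> threshold X q n \<omega> \<le> yu"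
        then have "?k \<le> card {i. i < n \<and> norm (X i \<omega>) > yu}"
          using k by (intro less_kth_largest_norm_imp) (auto simp: threshold_def)
        then show False using that by (auto simp: Au_def)
      qed
    qed
    ultimately show ?case using meas unfolding yl_def yu_def by (intro bexI[of _ "Al \<union> Au"]) auto
  qed
  then show ?thesis using b by blast
qed

text \<open>Below \<open>T\<close> the tail still exceeds \<open>e\<close>, so every candidate for
  the infimum is at least \<open>T\<close> and obeys the power bound, which is solved for
  \<open>x\<close>. A candidate exists because the mass of growing balls tends to 1.\<close>

lemma norm_quantile_ge:
  fixes P :: "'a::euclidean_space measure"
  assumes P: "prob_space P" "sets P = sets borel" and s: "s > 0" and c: "c > 0" and T: "T > 0"
    and tail_ge: "\<And>x. x \<ge> T \<Longrightarrow> c * x powr (-s) \<le> measure P {z. norm z > x}"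
    and e: "0 < e" "e < c * T powr (-s)"
  shows "(c / e) powr (1 / s) \<le> norm_quantile P (1 - e)"
  unfolding norm_quantile_def
proof (rule cInf_greatest)
  interpret prob_space P by fact
  note [measurable_cong] = P(2)
  have sp: "space P = UNIV" using sets_eq_imp_space_eq[OF P(2)] by simp
  have meas: "{z. norm z \<le> x} \<in> sets P" for x unfolding P(2) by measurable
  have compl: "measure P {z. norm z > x} = 1 - measure P {z. norm z \<le> x}" for x
  proof -
    have "{z::'a. norm z > x} = space P - {z. norm z \<le> x}" by (auto simp: sp)
    then show ?thesis using prob_compl[OF meas] by simp
  qed
  have "(\<lambda>n. measure P {z. norm z \<le> real n}) \<longlonglongrightarrow> measure P (\<Union>n. {z. norm z \<le> real n})"
    using meas by (intro finite_Lim_measure_incseq) (auto simp: incseq_def)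
  also have "(\<Union>n. {z::'a. norm z \<le> real n}) = space P" using real_arch_simple by (auto simp: sp)
  finally have "(\<lambda>n. measure P {z. norm z \<le> real n}) \<longlonglongrightarrow> 1" by (simp add: prob_space)
  then have "\<forall>\<^sub>F n in sequentially. measure P {z. norm z \<le> real n} > 1 - e"
    by (rule order_tendstoD) (use e in auto)
  from eventually_happens[OF this] obtain n where "measure P {z. norm z \<le> real n} > 1 - e" by auto
  then have "real n \<in> {x. 1 - e \<le> measure P {z. norm z \<le> x}}" by simp
  then show "{x. 1 - e \<le> measure P {z. norm z \<le> x}} \<noteq> {}" by blast
  fix x assume "x \<in> {x. 1 - e \<le> measure P {z. norm z \<le> x}}"
  then have x: "measure P {z. norm z > x} \<le> e" by (simp add: compl)
  have "x \<ge> T"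
  proof (rule ccontr)
    assume "\<not> x \<ge> T"
    then have "measure P {z. norm z > T} \<le> measure P {z. norm z > x}"
      by (intro finite_measure_mono) (auto simp: P(2))
    then show False using x tail_ge[of T] e by simp
  qed
  then have "c * x powr (-s) \<le> e" "x > 0" using tail_ge[of x] x T by auto
  then have "c / e \<le> x powr s" using e by (simp add: powr_minus field_simps)
  then have "(c / e) powr (1 / s) \<le> (x powr s) powr (1 / s)"
    using c e s by (intro powr_mono2) auto
  also have "\<dots> = x" using s \<open>x > 0\<close> by (simp add: powr_powr)
  finally show "(c / e) powr (1 / s) \<le> x" .
qed

section \<open>The convergence rate\<close>

context second_order_tail begin

text \<open>The lower bound is inherited from the stress region, which has mass at least of order
  \<open>u powr (-s)\<close> and lies in \<open>{z. norm z > \<delta> * u}\<close>; the upper bound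
  is the tail of \<open>\<nu>\<close> plus the second-order error.\<close>

lemma norm_tail_bounds:
  fixes L :: "nat \<Rightarrow> 'a \<Rightarrow> real"
  assumes hom: "asymp_homogeneous E K L Lstar" and J: "J \<subseteq> {1..K}" "J \<noteq> {}"
    and reg: "emeasure lebesgue (joint_exceedance E Lstar J 1) \<noteq> 0"
  obtains c C T where "c > 0" "C > 0" "T > 0"
    "\<And>x. x \<ge> T \<Longrightarrow> c * x powr (-s) \<le> measure P {z. norm z > x}"
    "\<And>x. x \<ge> T \<Longrightarrow> measure P {z. norm z > x} \<le> C * x powr (-s)"
proof -
  obtain \<delta> T1 where \<delta>: "\<delta> > 0" "T1 > 0" and
    sub: "\<And>u. u \<ge> T1 \<Longrightarrow> joint_exceedance E L J u \<subseteq> {z. norm z > \<delta> * u}"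
    by (rule joint_exceedance_away_from_0[OF hom cone_E J], rule that)
  obtain c T2 where c: "c > 0" "T2 > 0" and
    ge: "\<And>u. u \<ge> T2 \<Longrightarrow> c * u powr (-s) \<le> measure P (joint_exceedance E L J u)"
    by (rule measure_joint_exceedance_ge[OF hom J reg], rule that)
  obtain D T3 where D: "D > 0" "T3 \<ge> 1" and
    P\<nu>: "\<And>t v B. t \<ge> T3 \<Longrightarrow> v \<ge> t \<Longrightarrow> B \<in> sets borel \<Longrightarrow> B \<subseteq> {z. norm z > v} \<Longrightarrow>
      \<bar>measure P B - measure \<nu> B\<bar> \<le> D * t powr (-\<gamma>) * v powr (-s)"
    by (rule angular_law_close, rule that)
  show ?thesis
  proof (rule that[of "c * \<delta> powr s" "measure \<nu> UNIV + D" "max (max (\<delta> * T1) (\<delta> * T2)) T3"])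
    show "c * \<delta> powr s > 0" using c \<delta> by simp
    show "measure \<nu> UNIV + D > 0" using D by (simp add: add_nonneg_pos)
    show "max (max (\<delta> * T1) (\<delta> * T2)) T3 > 0" using D by simp
    fix x assume x: "x \<ge> max (max (\<delta> * T1) (\<delta> * T2)) T3"
    define u where "u = x / \<delta>"
    have u: "u \<ge> T1" "u \<ge> T2" "x = \<delta> * u" using x \<delta> by (auto simp: u_def le_divide_eq mult.commute)
    have "c * \<delta> powr s * x powr (-s) = c * u powr (-s)"
    proof -
      have "u > 0" using u \<delta> by simp
      then have "x powr (-s) = \<delta> powr (-s) * u powr (-s)" using u \<delta> by (simp add: powr_mult)
      then show ?thesis using \<delta> by (simp add: powr_minus)
    qed
    also have "\<dots> \<le> measure P (joint_exceedance E L J u)" by (rule ge[OF u(2)])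
    also have "\<dots> \<le> measure P {z. norm z > x}"
      using sub[OF u(1)] u(3) by (intro P.finite_measure_mono) auto
    finally show "c * \<delta> powr s * x powr (-s) \<le> measure P {z. norm z > x}" .
    have x1: "x \<ge> T3" "x \<ge> 1" using x D by auto
    have "emeasure \<nu> {z. norm z > x} = ennreal (x powr (-s)) * emeasure \<nu> UNIV"
      using emeasure_\<nu>_polar[of UNIV x] x1 by simp
    then have "measure \<nu> {z. norm z > x} = x powr (-s) * measure \<nu> UNIV"
      by (simp add: measure_def enn2real_mult)
    moreover have "\<bar>measure P {z. norm z > x} - measure \<nu> {z. norm z > x}\<bar> \<le> D * x powr (-\<gamma>) * x powr (-s)"
      using x1 by (intro P\<nu>) auto
    moreover have "D * x powr (-\<gamma>) * x powr (-s) \<le> D * 1 * x powr (-s)"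
      using powr_mono[of "-\<gamma>" 0 x] x1 \<gamma>_pos D by (intro mult_right_mono mult_left_mono) auto
    ultimately show "measure P {z. norm z > x} \<le> (measure \<nu> UNIV + D) * x powr (-s)"
      by (simp add: algebra_simps)
  qed
qed

text \<open>The comparison at \<open>v = \<delta> * u\<close> covers the whole stress region, and
  division by its mass cancels \<open>u powr (-s)\<close>. The condition
  \<open>t \<le> \<delta> * u\<close> places the region where the law of the generator is
  prescribed.\<close>

lemma TV_stressed_generator_le:
  fixes L :: "nat \<Rightarrow> 'a \<Rightarrow> real"
  assumes hom: "asymp_homogeneous E K L Lstar" and J: "J \<subseteq> {1..K}" "J \<noteq> {}"
    and reg: "emeasure lebesgue (joint_exceedance E Lstar J 1) \<noteq> 0"
  obtains C \<delta> T where "C > 0" "\<delta> > 0"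
    "\<And>t u p s' h Q Q0 P0 \<tau>. t \<ge> T \<Longrightarrow> u \<ge> T \<Longrightarrow> t \<le> \<delta> * u \<Longrightarrow> p > 0 \<Longrightarrow> s' > 0 \<Longrightarrow>
      h \<in> borel_measurable borel \<Longrightarrow> prob_space (angular_density_law E h) \<Longrightarrow>
      ssgen_law E p s' t h Q \<Longrightarrow> TV (angular_law P t) (angular_density_law E h) \<le> \<tau> \<Longrightarrow>
      prob_space Q0 \<Longrightarrow> sets Q0 = sets borel \<Longrightarrow> prob_space P0 \<Longrightarrow>
      \<bar>TV (stressed_law Q (joint_exceedance E L J u) u Q0)
          (stressed_law P (joint_exceedance E L J u) u P0)\<bar>
        \<le> C * (t powr (-\<gamma>) + \<tau> + \<bar>s' - s\<bar> / s')"
proof -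
  obtain \<delta> T1 where \<delta>: "\<delta> > 0" "T1 > 0" and
    sub: "\<And>u. u \<ge> T1 \<Longrightarrow> joint_exceedance E L J u \<subseteq> {z. norm z > \<delta> * u}"
    by (rule joint_exceedance_away_from_0[OF hom cone_E J], rule that)
  obtain c T2 where c: "c > 0" "T2 > 0" and
    ge: "\<And>u. u \<ge> T2 \<Longrightarrow> c * u powr (-s) \<le> measure P (joint_exceedance E L J u)"
    by (rule measure_joint_exceedance_ge[OF hom J reg], rule that)
  obtain C T3 where C: "C > 0" "T3 \<ge> 1" and gen:
    "\<And>t v p s' h Q \<tau>. t \<ge> T3 \<Longrightarrow> v \<ge> t \<Longrightarrow> p > 0 \<Longrightarrow> s' > 0 \<Longrightarrow> measure P {z. norm z > t} > 0 \<Longrightarrow>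
      h \<in> borel_measurable borel \<Longrightarrow> prob_space (angular_density_law E h) \<Longrightarrow>
      ssgen_law E p s' t h Q \<Longrightarrow> TV (angular_law P t) (angular_density_law E h) \<le> \<tau> \<Longrightarrow>
      \<exists>\<alpha>\<ge>0. \<forall>B\<in>sets borel. B \<subseteq> {z. norm z > v} \<longrightarrow>
        \<bar>measure P B - \<alpha> * measure Q B\<bar> \<le> C * (t powr (-\<gamma>) + \<tau> + \<bar>s' - s\<bar> / s') * v powr (-s)"
    by (rule generator_close, rule that)
  define C' where "C' = 2 * C * \<delta> powr (-s) / c"
  show ?thesis
  proof (rule that[of C' \<delta> "max (max T1 T2) T3"])
    show "C' > 0" "\<delta> > 0" using C c \<delta> by (auto simp: C'_def)
    fix t u p s' \<tau> and h :: "'a \<Rightarrow> real" and Q Q0 P0 :: "'a measure"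
    assume t: "t \<ge> max (max T1 T2) T3" and u: "u \<ge> max (max T1 T2) T3" and tu: "t \<le> \<delta> * u"
      and p: "p > 0" and s': "s' > 0" and h: "h \<in> borel_measurable borel" "prob_space (angular_density_law E h)"
      and ssgen: "ssgen_law E p s' t h Q" and TV: "TV (angular_law P t) (angular_density_law E h) \<le> \<tau>"
      and Q0: "prob_space Q0" "sets Q0 = sets borel" and P0: "prob_space P0"
    let ?S = "joint_exceedance E L J u" and ?e = "t powr (-\<gamma>) + \<tau> + \<bar>s' - s\<bar> / s'"
    have u0: "u > 0" using u \<delta> by simp
    have S: "?S \<in> sets borel" by (rule borel_joint_exceedance[OF hom borel_angles_E(2) J(1)])
    have S_sub: "?S \<subseteq> {z. norm z > \<delta> * u}" using u by (intro sub) simp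
    have PS: "c * u powr (-s) \<le> measure P ?S" using u by (intro ge) simp
    have c0: "c * u powr (-s) > 0" using c u0 by simp
    have "measure P ?S \<le> measure P {z. norm z > t}"
      using S_sub tu by (intro P.finite_measure_mono) auto
    then have Pt: "measure P {z. norm z > t} > 0" using PS c0 by linarith
    obtain \<alpha> where \<alpha>: "\<alpha> \<ge> 0" "\<And>B. B \<in> sets borel \<Longrightarrow> B \<subseteq> {z. norm z > \<delta> * u} \<Longrightarrow>
        \<bar>measure P B - \<alpha> * measure Q B\<bar> \<le> C * ?e * (\<delta> * u) powr (-s)"
      using gen[OF _ tu p s' Pt h ssgen TV] t by auto
    have Q: "prob_space Q" "sets Q = sets borel" using ssgen by (auto simp: ssgen_law_def)
    have "\<bar>TV (stressed_law Q ?S u Q0) (stressed_law P ?S u P0)\<bar> \<le>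
        2 * (C * ?e * (\<delta> * u) powr (-s)) / (c * u powr (-s))"
      using \<alpha>(2) S_sub
      by (intro TV_stressed_law_le[OF prob_P sets_P Q P0 Q0 S c0 PS \<alpha>(1)]) blast
    also have "\<dots> = C' * ?e"
      using u0 \<delta> c by (simp add: C'_def powr_mult)
    finally show "\<bar>TV (stressed_law Q ?S u Q0) (stressed_law P ?S u P0)\<bar> \<le> C' * ?e" .
  qed
qed

end

theorem theorem3:
  fixes M :: "'w measure"
    and X :: "nat \<Rightarrow> 'w \<Rightarrow> 'a::euclidean_space"
    and E :: "'a set"
    and f \<phi>star :: "'a \<Rightarrow> real"
    and K :: nat
    and L Lstar :: "nat \<Rightarrow> 'a \<Rightarrow> real"
    and JJ :: "nat set set" and J :: "nat set"
    and s \<gamma> q r m l :: real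
    and shat :: "nat \<Rightarrow> 'w \<Rightarrow> real"
    and \<phi>hat :: "nat \<Rightarrow> 'w \<Rightarrow> 'a \<Rightarrow> real"
    and P :: "'a measure"
    and Pgen :: "nat \<Rightarrow> 'w \<Rightarrow> 'a measure"
    and Q0 :: "nat \<Rightarrow> 'a measure"
    and Q0hat :: "nat \<Rightarrow> 'w \<Rightarrow> 'a measure"
    and u :: "nat \<Rightarrow> real"
    and Pin :: "nat \<Rightarrow> 'a measure"
    and Pihat :: "nat \<Rightarrow> 'w \<Rightarrow> 'a measure"
  assumes "closed E" and "cone E"
    and "\<And>z. f z \<ge> 0" and "\<And>z. z \<notin> E \<Longrightarrow> f z = 0"
    and P_def: "P = density lborel (\<lambda>z. ennreal (f z))"
    and "prob_space M"
    and "prob_space.indep_vars M (\<lambda>_. borel) X UNIV"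
    and "\<And>i. distributed M lborel (X i) (\<lambda>z. ennreal (f z))"
    and "density_reg_var E f s \<phi>star"
    and "\<gamma> > 0" and "second_order E f s \<phi>star \<gamma>"
    and "asymp_homogeneous E K L Lstar"
    and "JJ \<subseteq> Pow {1..K} - {{}}" and "regular_system E Lstar JJ" and "J \<in> JJ"
    and "0 < q" "q < 1" and "r \<ge> 1"
    and u_def: "\<And>n. u n = extreme_level P r n"
    and "0 < m" "m \<le> 1/2" and "0 < l" "l \<le> 1/2"
    and "estimation_rate M X P E q s shat \<phi>hat m l"
    and "data_driven_ssgen M X E q shat \<phi>hat Pgen"
    and "\<And>n. prob_space (Q0 n)" and "\<And>n. sets (Q0 n) = sets borel"
    and "\<And>n \<omega>. \<omega> \<in> space M \<Longrightarrow> prob_space (Q0hat n \<omega>)"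
    and "\<And>n \<omega>. \<omega> \<in> space M \<Longrightarrow> sets (Q0hat n \<omega>) = sets borel"
    and Pin_def: "\<And>n. Pin n = stressed_law P (joint_exceedance E L J (u n)) (u n) (Q0 n)"
    and Pihat_def: "\<And>n \<omega>. Pihat n \<omega> =
           stressed_law (Pgen n \<omega>) (joint_exceedance E L J (u n)) (u n) (Q0hat n \<omega>)"
  shows "bigo_in_prob M (\<lambda>n \<omega>. TV (Pihat n \<omega>) (Pin n))
           (\<lambda>n. real n powr (- (1 - q) * min m l) + real n powr (- q * \<gamma> / s))"
proof -
  note q = assms(16,17) and m = assms(20,21) and l = assms(22,23) and hom = assms(12)
  interpret M: prob_space M by fact
  have law: "distr M borel (X i) = P" for i
  proof -
    have "distr M borel (X i) = distr M lborel (X i)" by (rule distr_cong) auto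
    then show ?thesis using distributed_distr_eq_density[OF assms(8), of i] unfolding P_def by simp
  qed
  have f_meas: "f \<in> borel_measurable borel"
  proof -
    have "(\<lambda>z. ennreal (f z)) \<in> borel_measurable borel"
      using distributed_borel_measurable[OF assms(8)] by simp
    then have "(\<lambda>z. enn2real (ennreal (f z))) \<in> borel_measurable borel" by measurable
    then show ?thesis using assms(3) by simp
  qed
  have prob_P: "prob_space P"
    unfolding law[of 0, symmetric]
    by (rule M.prob_space_distr) (use assms(7) in \<open>auto simp: M.indep_vars_def\<close>)
  interpret second_order_tail E f \<phi>star s \<gamma> P
    by (intro second_order_tail.intro) fact+
  have J: "J \<subseteq> {1..K}" "J \<noteq> {}" and reg: "emeasure lebesgue (joint_exceedance E Lstar J 1) \<noteq> 0"
    using assms(13-15) by (auto simp: regular_system_def)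
  obtain C \<delta> T where C: "C > 0" "\<delta> > 0" and TV_le:
    "\<And>t u p s' h Q Q0 P0 \<tau>. t \<ge> T \<Longrightarrow> u \<ge> T \<Longrightarrow> t \<le> \<delta> * u \<Longrightarrow> p > 0 \<Longrightarrow> s' > 0 \<Longrightarrow>
      h \<in> borel_measurable borel \<Longrightarrow> prob_space (angular_density_law E h) \<Longrightarrow>
      ssgen_law E p s' t h Q \<Longrightarrow> TV (angular_law P t) (angular_density_law E h) \<le> \<tau> \<Longrightarrow>
      prob_space Q0 \<Longrightarrow> sets Q0 = sets borel \<Longrightarrow> prob_space P0 \<Longrightarrow>
      \<bar>TV (stressed_law Q (joint_exceedance E L J u) u Q0)
          (stressed_law P (joint_exceedance E L J u) u P0)\<bar>
        \<le> C * (t powr (-\<gamma>) + \<tau> + \<bar>s' - s\<bar> / s')"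
    by (rule TV_stressed_generator_le[OF hom J reg], rule that)
  obtain cl Cu T' where cl: "cl > 0" "Cu > 0" "T' > 0"
    and tail_ge: "\<And>x. x \<ge> T' \<Longrightarrow> cl * x powr (-s) \<le> measure P {z. norm z > x}"
    and tail_le: "\<And>x. x \<ge> T' \<Longrightarrow> measure P {z. norm z > x} \<le> Cu * x powr (-s)"
    by (rule norm_tail_bounds[OF hom J reg], rule that)
  have at_top: "filterlim (\<lambda>n. real n powr a) at_top sequentially" if "a > 0" for a
    by (rule filterlim_compose[OF filterlim_powr_at_top[OF that] filterlim_real_sequentially])
  \<comment> \<open>As \<open>r \<ge> 1\<close>, the exceedance probability
    \<open>n powr (-r)\<close> is at most \<open>1 / n\<close>, so the quantile is at least of order
    \<open>n powr (1 / s)\<close>, beyond the order \<open>n powr (q / s)\<close> of the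
    threshold.\<close>
  have u_ge: "\<forall>\<^sub>F n in sequentially. (cl * real n) powr (1 / s) \<le> u n"
  proof -
    \<comment> \<open>The factor 2 makes \<open>1 / n\<close> strictly smaller than
      \<open>cl * T' powr (-s)\<close>, as the quantile bound demands.\<close>
    have "\<forall>\<^sub>F n in sequentially. 2 / (cl * T' powr (-s)) \<le> real n powr 1"
      using at_top[of 1] by (simp only: filterlim_at_top)
    then show ?thesis
      using eventually_ge_at_top[of 1]
    proof eventually_elim
      case (elim n)
      have nr: "real n powr (-r) \<le> 1 / real n"
        using powr_mono[of "-r" "-1" "real n"] \<open>r \<ge> 1\<close> elim(2) by (simp add: powr_minus divide_inverse)
      have c0: "cl * T' powr (-s) > 0" using cl by simp
      have "1 / real n < cl * T' powr (-s)"
        using elim c0 by (simp add: divide_le_eq divide_less_eq mult.commute)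
      then have "real n powr (-r) < cl * T' powr (-s)" using nr by linarith
      then have "(cl / real n powr (-r)) powr (1 / s) \<le> u n"
        unfolding u_def extreme_level_def using elim(2)
        by (intro norm_quantile_ge[OF prob_P sets_P s_pos cl(1,3) tail_ge]) auto
      moreover have "cl * real n \<le> cl / real n powr (-r)"
      proof -
        have "cl / (1 / real n) \<le> cl / real n powr (-r)"
          using nr cl elim(2) by (intro divide_left_mono) auto
        then show ?thesis by simp
      qed
      then have "(cl * real n) powr (1 / s) \<le> (cl / real n powr (-r)) powr (1 / s)"
        using cl s_pos by (intro powr_mono2) auto
      ultimately show ?case by linarith
    qed
  qed
  show ?thesis
    unfolding bigo_in_prob_def
  proof (intro allI impI)
    fix \<epsilon> :: real assume \<epsilon>: "\<epsilon> > 0"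
    then have \<epsilon>3: "\<epsilon> / 3 > 0" by simp
    have rate: "bigo_in_prob M (\<lambda>n \<omega>. \<bar>shat n \<omega> - s\<bar>) (\<lambda>n. real (tail_count q n) powr (- m))"
      "bigo_in_prob M
         (\<lambda>n \<omega>. TV (angular_law P (threshold X q n \<omega>)) (angular_density_law E (\<phi>hat n \<omega>)))
         (\<lambda>n. real (tail_count q n) powr (- l))"
      using assms(24) by (simp_all add: estimation_rate_def)
    obtain b \<beta> where b: "b > 0" "\<beta> > 0" and ev_t: "\<forall>\<^sub>F n in sequentially. \<exists>A\<in>sets M. measure M A \<le> \<epsilon> / 3 \<and>
      (\<forall>\<omega>\<in>space M - A. (b * real n powr q) powr (1 / s) \<le> threshold X q n \<omega> \<and>
        threshold X q n \<omega> \<le> (\<beta> * real n powr q) powr (1 / s))"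
      using threshold_bounds[OF assms(6,7) law q s_pos cl(1,2), of T' "\<epsilon> / 3", OF tail_ge tail_le \<epsilon>3]
      by blast
    obtain C1 where C1: "C1 > 0" and ev_s: "\<forall>\<^sub>F n in sequentially. \<exists>A\<in>sets M.
        {\<omega>\<in>space M. \<bar>\<bar>shat n \<omega> - s\<bar>\<bar> > C1 * real (tail_count q n) powr (- m)} \<subseteq> A \<and> measure M A \<le> \<epsilon> / 3"
      using rate(1)[unfolded bigo_in_prob_def, rule_format, OF \<epsilon>3] by blast
    obtain C2 where C2: "C2 > 0" and ev_a: "\<forall>\<^sub>F n in sequentially. \<exists>A\<in>sets M.
        {\<omega>\<in>space M. \<bar>TV (angular_law P (threshold X q n \<omega>)) (angular_density_law E (\<phi>hat n \<omega>))\<bar>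
          > C2 * real (tail_count q n) powr (- l)} \<subseteq> A \<and> measure M A \<le> \<epsilon> / 3"
      using rate(2)[unfolded bigo_in_prob_def, rule_format, OF \<epsilon>3] by blast
    \<comment> \<open>One summand for each error: the second-order term at the lower threshold
      bound, the angular estimate, and the index estimate relative to
      \<open>s' \<ge> s / 2\<close>.\<close>
    define C3 where "C3 = b powr (-\<gamma> / s) + 2 * C2 + 4 * C1 / s"
    have C3: "C3 > 0" using C1 C2 b s_pos by (auto simp: C3_def intro!: add_pos_pos)
    \<comment> \<open>Forces the index error below \<open>s / 2\<close>, so that dividing by
      \<open>s'\<close> costs at most a factor 2 against dividing by \<open>s\<close>.\<close>
    have ev_m: "\<forall>\<^sub>F n in sequentially. 4 * C1 / s \<le> real n powr ((1 - q) * m)"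
      using at_top[of "(1 - q) * m"] q m by (simp add: filterlim_at_top)
    \<comment> \<open>Brings the upper bound for the threshold below \<open>\<delta>\<close> times
      the lower bound for \<open>u n\<close>.\<close>
    have ev_u: "\<forall>\<^sub>F n in sequentially. \<beta> / (\<delta> powr s * cl) \<le> real n powr (1 - q)"
      using at_top[of "1 - q"] q by (simp add: filterlim_at_top)
    have ev_T: "\<forall>\<^sub>F n in sequentially. T \<le> (cl * real n powr 1) powr (1 / s)"
      by (rule powr_root_ge_eventually) (use cl s_pos in auto)
    show "\<exists>C>0. \<forall>\<^sub>F n in sequentially. \<exists>A\<in>sets M.
        {\<omega>\<in>space M. \<bar>TV (Pihat n \<omega>) (Pin n)\<bar> >
          C * (real n powr (- (1 - q) * min m l) + real n powr (- q * \<gamma> / s))} \<subseteq> A \<and> measure M A \<le> \<epsilon>"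
    proof (intro exI[of _ "C * C3"] conjI)
      show "C * C3 > 0" using C C3 by simp
      show "\<forall>\<^sub>F n in sequentially. \<exists>A\<in>sets M.
        {\<omega>\<in>space M. \<bar>TV (Pihat n \<omega>) (Pin n)\<bar> >
          C * C3 * (real n powr (- (1 - q) * min m l) + real n powr (- q * \<gamma> / s))} \<subseteq> A \<and> measure M A \<le> \<epsilon>"
        using ev_t ev_s ev_a ev_m ev_u ev_T u_ge powr_root_ge_eventually[OF b(1) q(1) s_pos, of T]
          eventually_ge_at_top[of 1]
      proof eventually_elim
        case (elim n)
        let ?k = "tail_count q n"
        let ?X = "real n powr (- (1 - q) * min m l)" and ?Y = "real n powr (- q * \<gamma> / s)"
        note k = tail_count_bounds[OF q elim(9)]
        have n1: "real n \<ge> 1" using elim(9) by simp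
        \<comment> \<open>The tail count is at least half of \<open>n powr (1 - q)\<close>, and for
          \<open>e \<le> 1/2\<close> the resulting factor \<open>2 powr e\<close> is at most
          2.\<close>
        have k_rate: "real ?k powr (-e) \<le> 2 * real n powr (- (1 - q) * e)" if e: "0 < e" "e \<le> 1/2" for e
        proof -
          have "real ?k powr (-e) \<le> (real n powr (1 - q) / 2) powr (-e)"
            using k(4) e n1 by (intro powr_mono2') auto
          also have "\<dots> = 2 powr e * real n powr (- (1 - q) * e)"
          proof -
            have "(real n powr (1 - q) / 2) powr (-e) = (real n powr (1 - q)) powr (-e) / 2 powr (-e)"
              by (rule powr_divide)
            moreover have "(real n powr (1 - q)) powr (-e) = real n powr (- (1 - q) * e)"
              by (simp only: powr_powr mult_minus_left mult_minus_right)
            moreover have "2 powr (-e) = inverse (2 powr e)" by (rule powr_minus)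
            ultimately show ?thesis by (simp only: divide_inverse inverse_inverse_eq mult.commute)
          qed
          also have "\<dots> \<le> 2 powr 1 * real n powr (- (1 - q) * e)"
            using e by (intro mult_right_mono powr_mono) auto
          finally show ?thesis by simp
        qed
        have min_rate: "real n powr (- (1 - q) * e) \<le> ?X" if "min m l \<le> e" for e
          using n1 q that by (intro powr_mono) (auto simp: mult_left_mono)
        obtain A1 where A1: "A1 \<in> sets M" "measure M A1 \<le> \<epsilon> / 3" and
          thr: "\<And>\<omega>. \<omega> \<in> space M - A1 \<Longrightarrow> (b * real n powr q) powr (1 / s) \<le> threshold X q n \<omega> \<and>
            threshold X q n \<omega> \<le> (\<beta> * real n powr q) powr (1 / s)"
          using elim(1) by blast
        obtain A2 where A2: "A2 \<in> sets M" "measure M A2 \<le> \<epsilon> / 3" and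
          shat: "\<And>\<omega>. \<omega> \<in> space M - A2 \<Longrightarrow> \<bar>shat n \<omega> - s\<bar> \<le> C1 * real ?k powr (- m)"
        proof -
          obtain A where A: "A \<in> sets M" "measure M A \<le> \<epsilon> / 3"
            "{\<omega>\<in>space M. \<bar>\<bar>shat n \<omega> - s\<bar>\<bar> > C1 * real ?k powr (- m)} \<subseteq> A"
            using elim(2) by blast
          show thesis by (rule that[OF A(1,2)], rule leI) (use A(3) in auto)
        qed
        obtain A3 where A3: "A3 \<in> sets M" "measure M A3 \<le> \<epsilon> / 3" and
          ang: "\<And>\<omega>. \<omega> \<in> space M - A3 \<Longrightarrow>
            \<bar>TV (angular_law P (threshold X q n \<omega>)) (angular_density_law E (\<phi>hat n \<omega>))\<bar> \<le> C2 * real ?k powr (- l)"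
        proof -
          obtain A where A: "A \<in> sets M" "measure M A \<le> \<epsilon> / 3"
            "{\<omega>\<in>space M. \<bar>TV (angular_law P (threshold X q n \<omega>)) (angular_density_law E (\<phi>hat n \<omega>))\<bar>
              > C2 * real ?k powr (- l)} \<subseteq> A"
            using elim(3) by blast
          show thesis by (rule that[OF A(1,2)], rule leI) (use A(3) in auto)
        qed
        have bound: "\<bar>TV (Pihat n \<omega>) (Pin n)\<bar> \<le> C * C3 * (?X + ?Y)"
          if \<omega>: "\<omega> \<in> space M" "\<omega> \<notin> A1 \<union> A2 \<union> A3" for \<omega>
        proof -
          define t where "t = threshold X q n \<omega>"
          define s' where "s' = shat n \<omega>"
          have t: "(b * real n powr q) powr (1 / s) \<le> t" "t \<le> (\<beta> * real n powr q) powr (1 / s)"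
            using thr[of \<omega>] \<omega> by (auto simp: t_def)
          have tu: "t \<le> \<delta> * u n"
          proof -
            have "\<beta> * real n powr q \<le> \<delta> powr s * (cl * real n)"
            proof -
              have "\<beta> \<le> (\<delta> powr s * cl) * real n powr (1 - q)"
                using elim(5) C cl by (simp add: divide_le_eq mult.commute)
              then have "\<beta> * real n powr q \<le> (\<delta> powr s * cl) * real n powr (1 - q) * real n powr q"
                by (intro mult_right_mono) auto
              also have "\<dots> = \<delta> powr s * (cl * real n)"
                using n1 by (simp add: powr_add[symmetric] mult.assoc)
              finally show ?thesis .
            qed
            then have "(\<beta> * real n powr q) powr (1 / s) \<le> (\<delta> powr s * (cl * real n)) powr (1 / s)"
              using b s_pos by (intro powr_mono2) auto
            also have "\<dots> = \<delta> * (cl * real n) powr (1 / s)"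
              using C cl s_pos by (simp add: powr_mult powr_powr)
            also have "\<dots> \<le> \<delta> * u n" using elim(7) C by (intro mult_left_mono) auto
            finally show ?thesis using t by simp
          qed
          have s'_close: "\<bar>s' - s\<bar> \<le> 2 * C1 * real n powr (- (1 - q) * m)"
          proof -
            have "\<bar>s' - s\<bar> \<le> C1 * real ?k powr (- m)" using shat[of \<omega>] \<omega> by (simp add: s'_def)
            also have "\<dots> \<le> C1 * (2 * real n powr (- (1 - q) * m))"
              using C1 m by (intro mult_left_mono k_rate) auto
            finally show ?thesis by simp
          qed
          have "s' \<ge> s / 2"
          proof -
            have "4 * C1 \<le> s * real n powr ((1 - q) * m)"
              using elim(4) s_pos by (simp add: divide_le_eq mult.commute)
            then have "4 * C1 * real n powr (- (1 - q) * m) \<le>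
                s * real n powr ((1 - q) * m) * real n powr (- (1 - q) * m)"
              by (intro mult_right_mono) auto
            also have "\<dots> = s * real n powr ((1 - q) * m + - (1 - q) * m)"
              by (simp only: mult.assoc powr_add)
            also have "\<dots> = s" using n1 by (simp only: mult_minus_left add.right_inverse) simp
            finally show ?thesis using s'_close by linarith
          qed
          then have s'_pos: "s' > 0" using s_pos by linarith
          have err_s: "\<bar>s' - s\<bar> / s' \<le> 4 * C1 / s * ?X"
          proof -
            have "\<bar>s' - s\<bar> / s' \<le> \<bar>s' - s\<bar> / (s / 2)"
              using \<open>s' \<ge> s / 2\<close> s_pos by (intro divide_left_mono) auto
            also have "\<dots> \<le> (2 * C1 * ?X) / (s / 2)"
            proof (intro divide_right_mono)
              have "2 * C1 * real n powr (- (1 - q) * m) \<le> 2 * C1 * ?X"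
                using C1 by (intro mult_left_mono min_rate) auto
              then show "\<bar>s' - s\<bar> \<le> 2 * C1 * ?X" using s'_close by linarith
            qed (use s_pos in simp)
            finally show ?thesis by simp
          qed
          have err_a: "C2 * real ?k powr (- l) \<le> 2 * C2 * ?X"
          proof -
            have "C2 * real ?k powr (- l) \<le> C2 * (2 * real n powr (- (1 - q) * l))"
              using C2 l by (intro mult_left_mono k_rate) auto
            also have "\<dots> \<le> C2 * (2 * ?X)" using C2 by (intro mult_left_mono min_rate) auto
            finally show ?thesis by simp
          qed
          have err_t: "t powr (-\<gamma>) \<le> b powr (-\<gamma> / s) * ?Y"
          proof -
            have "0 < (b * real n powr q) powr (1 / s)" using b n1 by simp
            then have "t powr (-\<gamma>) \<le> ((b * real n powr q) powr (1 / s)) powr (-\<gamma>)"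
              using t \<gamma>_pos by (intro powr_mono2') auto
            also have "\<dots> = b powr (-\<gamma> / s) * ?Y"
              using b n1 by (simp add: powr_powr powr_mult)
            finally show ?thesis .
          qed
          have est: "(\<lambda>(\<omega>, \<phi>). \<phi>hat n \<omega> \<phi>) \<in> borel_measurable (exceedance_algebra M X q n \<Otimes>\<^sub>M borel)"
            "prob_space (angular_density_law E (\<phi>hat n \<omega>))"
            using assms(24) \<omega> elim(9) by (auto simp: estimation_rate_def tail_estimators_def)
          \<comment> \<open>At a fixed sample point the estimated density is a section of a jointly
            measurable function.\<close>
          have h: "\<phi>hat n \<omega> \<in> borel_measurable borel"
            using measurable_Pair2[OF est(1), of \<omega>] \<omega> by (simp add: exceedance_algebra_def)
          have "\<bar>TV (Pihat n \<omega>) (Pin n)\<bar> \<le>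
              C * (t powr (-\<gamma>) + C2 * real ?k powr (- l) + \<bar>s' - s\<bar> / s')"
            unfolding Pihat_def Pin_def
          proof (rule TV_le[OF _ _ tu _ s'_pos h est(2)])
            show "T \<le> t" using t elim(8) by linarith
            show "T \<le> u n" using elim(6,7) n1 by simp
            show "0 < real ?k / real n" using k n1 by simp
            show "ssgen_law E (real ?k / real n) s' t (\<phi>hat n \<omega>) (Pgen n \<omega>)"
              using assms(25) \<omega> elim(9) by (auto simp: data_driven_ssgen_def s'_def t_def)
            show "TV (angular_law P t) (angular_density_law E (\<phi>hat n \<omega>)) \<le> C2 * real ?k powr (- l)"
              using ang[of \<omega>] \<omega> by (simp add: t_def)
          qed (use assms(26-29) \<omega> in auto)
          also have "\<dots> \<le> C * (b powr (-\<gamma> / s) * ?Y + 2 * C2 * ?X + 4 * C1 / s * ?X)"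
            using C err_t err_a err_s by (intro mult_left_mono add_mono) auto
          also have "\<dots> \<le> C * (C3 * (?X + ?Y))"
          proof -
            have "b powr (-\<gamma> / s) * ?Y \<le> C3 * ?Y" "(2 * C2 + 4 * C1 / s) * ?X \<le> C3 * ?X"
              using C1 C2 s_pos by (auto simp: C3_def intro!: mult_right_mono)
            then have "b powr (-\<gamma> / s) * ?Y + 2 * C2 * ?X + 4 * C1 / s * ?X \<le> C3 * (?X + ?Y)"
              by (simp only: distrib_left distrib_right)
            then show ?thesis using C by (intro mult_left_mono) auto
          qed
          finally show ?thesis by (simp only: mult.assoc)
        qed
        have "measure M (A1 \<union> A2 \<union> A3) \<le> \<epsilon>"
          using measure_Un_le[of "A1 \<union> A2" M A3] measure_Un_le[of A1 M A2] A1 A2 A3 by auto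
        moreover have "{\<omega>\<in>space M. \<bar>TV (Pihat n \<omega>) (Pin n)\<bar> > C * C3 * (?X + ?Y)} \<subseteq> A1 \<union> A2 \<union> A3"
        proof
          fix \<omega> assume \<omega>: "\<omega> \<in> {\<omega>\<in>space M. \<bar>TV (Pihat n \<omega>) (Pin n)\<bar> > C * C3 * (?X + ?Y)}"
          show "\<omega> \<in> A1 \<union> A2 \<union> A3"
          proof (rule ccontr)
            assume "\<omega> \<notin> A1 \<union> A2 \<union> A3"
            with bound[of \<omega>] \<omega> show False by simp
          qed
        qed
        ultimately show ?case using A1 A2 A3 by (intro bexI[of _ "A1 \<union> A2 \<union> A3"]) auto
      qed
    qed
  qed
qed

end
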